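(* The Yoshikawa moves $\Omega_4$ and $\Omega_4'$ are independent from the other Yoshikawa moves. That is: there exist marked graph diagrams $D$ and $D'$ related by a single move $\Omega_4$ which are not related by any finite sequence of the moves $\Omega_1,\Omega_2,\Omega_3,\Omega_5,\Omega_6,\Omega_6',\Omega_7,\Omega_8$; and there exist marked graph diagrams $D$ and $D'$ related by a single move $\Omega_4'$ which are not related by any finite sequence of the moves $\Omega_1,\Omega_2,\Omega_3,\Omega_5,\Omega_6,\Omega_6',\Omega_7,\Omega_8$ (moves being used in either direction).
   Context: **Marked graph diagrams.** A marked graph diagram $D$ is a link diagram in $\mathbb R^2$ possibly with some $4$-valent marked vertices: a generic planar diagram whose double points are finitely many classical crossings (with over/under information) and finitely many marked vertices. Near a marked vertex the diagram looks like the letter X, and the vertex carries a marker, a short segment through the vertex lying in one pair of opposite sectors of the X. Diagrams are considered up to isotopy of the plane and are unoriented. In pictures, the four arms at a crossing or vertex are called NW, NE, SW, SE; a horizontal marker lies in the left and right sectors, a vertical marker in the upper and lower sectors. **Yoshikawa moves.** The Yoshikawa moves are $\Omega_1,\Omega_2,\Omega_3,\Omega_4,\Omega_4',\Omega_5,\Omega_6,\Omega_6',\Omega_7,\Omega_8$. Each move replaces the part of the diagram in a disk by another one with the same boundary points, the rest being unchanged (moves may be used in both directions, up to isotopy of the plane). - $\Omega_1$: a crossing with over-strand SW–NE, whose NE and SE arms are joined by an arc on the right and whose NW and SW arms go to the boundary, $\leftrightarrow$ a simple arc. - $\Omega_2$: two arcs, the left one passing over the right one at two crossings that bound a bigon,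 $\leftrightarrow$ two disjoint arcs. - $\Omega_3$: two straight strands crossing at a point, the NW–SE strand over the SW–NE strand, and a third, left-to-right, strand $H$ passing over both; $H$ passes below the crossing point (crossing its SW and SE arms) $\leftrightarrow$ $H$ passes above it (crossing the NW and NE arms). - $\Omega_4$: a marked vertex with horizontal marker and a left-to-right strand $H$; $H$ passes over the SW and SE arms $\leftrightarrow$ $H$ passes over the NW and NE arms. - $\Omega_4'$: as $\Omega_4$, but $H$ passes under the arms. - $\Omega_5$: a crossing with over-strand SW–NE on the left and a marked vertex with horizontal marker on the right, with the NE (resp. SE) arm of the crossing joined to the NW (resp. SW) arm of the vertex, the other four arms going to the boundary, $\leftrightarrow$ the marked vertex with horizontal marker on the left and a crossing with over-strand SW–NE on the right, joined in the same way. - $\Omega_6$: a marked vertex with vertical marker whose NE and SE arms are joined by an arc on the right and whose NW and SW arms go to the boundary $\leftrightarrow$ a simple arc. - $\Omega_6'$: as $\Omega_6$, with horizontal marker. - $\Omega_7$: a disk with boundary points $t_1,t_2,t_3$ on top and $b_1,b_2,b_3$ at the bottom (left to right), no crossings. One side: a lower-left vertex $v$ with vertical marker and an upper-right vertex $v'$ with horizontal marker; $v$ has SW to $b_1$, NW to $t_1$, SE to $b_2$, NE joined to the SW arm of $v'$; $v'$ has NW to $t_2$, NE to $t_3$, SE to $b_3$. Other side: an upper-left vertex $u$ with vertical marker and a lower-right vertex $u'$ with horizontal marker; $u$ has NW to $t_1$, NE to $t_2$, SW to $b_1$, SE joined to the NW arm of $u'$; $u'$ has SW to $b_2$, SE to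 $b_3$, NE to $t_3$. - $\Omega_8$: a disk with boundary points $t_1,\dots,t_4$ on top and $b_1,\dots,b_4$ at the bottom. A left vertex $v$ with vertical marker has NW to $t_1$, NE to $t_2$, SW to $b_3$, SE to $b_4$; a right vertex $v'$ with horizontal marker has NW to $t_3$, NE to $t_4$, SW to $b_1$, SE to $b_2$; the two parallel lower arms of $v$ cross the two parallel lower arms of $v'$ in exactly four crossings. On one side the arms of $v'$ are over at all four crossings $\leftrightarrow$ on the other side the arms of $v$ are over at all four crossings. *)

theory Defs
  imports "HOL-Analysis.Analysis"
begin

text \<open>
  A diagram is given by the point set it occupies in the plane, together with two sets carrying
  the decorations: a short arc of the over-strand around every classical crossing, and the marker
  of every marked vertex.  The lengths of these arcs carry no information, since diagrams are
  considered up to isotopy.  The same record describes the part of a diagram inside a disk.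
\<close>

record picture =
  curve :: "complex set"
  overs :: "complex set"
  markers :: "complex set"

definition image_pic :: "(complex \<Rightarrow> complex) \<Rightarrow> picture \<Rightarrow> picture" where
  "image_pic h D = \<lparr>curve = h ` curve D, overs = h ` overs D, markers = h ` markers D\<rparr>"

definition restrict_pic :: "picture \<Rightarrow> complex set \<Rightarrow> picture" where
  "restrict_pic D A = \<lparr>curve = curve D \<inter> A, overs = overs D \<inter> A, markers = markers D \<inter> A\<rparr>"

definition crossing_model :: picture where
  "crossing_model =
     \<lparr>curve = {z \<in> ball 0 1. \<bar>Re z\<bar> = \<bar>Im z\<bar>},
      overs = {z. Re z = Im z \<and> norm z \<le> 1/2},
      markers = {}\<rparr>"

definition vertex_model :: picture where
  "vertex_model =
     \<lparr>curve = {z \<in> ball 0 1. \<bar>Re z\<bar> = \<bar>Im z\<bar>},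
      overs = {},
      markers = {z. Im z = 0 \<and> norm z \<le> 1/2}\<rparr>"

definition chart_at :: "complex \<Rightarrow> complex set \<Rightarrow> (complex \<Rightarrow> complex) \<Rightarrow> bool" where
  "chart_at p U h \<longleftrightarrow> open U \<and> p \<in> U \<and> h p = 0 \<and> (\<exists>g. homeomorphism U (ball 0 1) h g)"

text \<open>
  \<open>S\<close> is the set of double points: the crossings and the marked vertices.
  The charts may reverse the orientation and need not respect angles, so every crossing and every
  marker fits the single model above.
\<close>

definition marked_graph_diagram :: "picture \<Rightarrow> bool" where
  "marked_graph_diagram D \<longleftrightarrow>
     compact (curve D) \<and>
     (\<exists>S U. finite S \<and> S \<subseteq> curve D \<and> disjoint_family_on U S \<and>
        (\<forall>p\<in>S. \<exists>h. chart_at p (U p) h \<and>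
           image_pic h (restrict_pic D (U p)) \<in> {crossing_model, vertex_model}) \<and>
        overs D \<union> markers D \<subseteq> (\<Union>p\<in>S. U p) \<and>
        (\<forall>p \<in> curve D - S. \<exists>V h. chart_at p V h \<and>
           h ` (curve D \<inter> V) = {z \<in> ball 0 1. Im z = 0}))"

definition plane_isotopic :: "picture \<Rightarrow> picture \<Rightarrow> bool" where
  "plane_isotopic D D' \<longleftrightarrow>
     (\<exists>h :: real \<Rightarrow> complex \<Rightarrow> complex.
        continuous_on ({0..1} \<times> UNIV) (\<lambda>(t, z). h t z) \<and>
        (\<forall>t\<in>{0..1}. \<exists>g. homeomorphism UNIV UNIV (h t) g) \<and>
        (\<forall>z. h 0 z = z) \<and>
        D' = image_pic (h 1) D)"

fun polyline :: "complex list \<Rightarrow> complex set" where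
  "polyline (p # q # ps) = closed_segment p q \<union> polyline (q # ps)"
| "polyline _ = {}"

definition drawn :: "(real \<times> real) list \<Rightarrow> complex set" where
  "drawn ps = polyline (map (\<lambda>(x, y). Complex x y) ps)"

text \<open>The segment with midpoint \<open>(x, y)\<close> and direction \<open>d\<close> (for instance, \<open>1 + \<i>\<close> means SW--NE).\<close>

definition tick :: "complex \<Rightarrow> real \<times> real \<Rightarrow> complex set" where
  "tick d = (\<lambda>(x, y). closed_segment (Complex x y - d / 2) (Complex x y + d / 2))"

definition disk :: "complex set" where
  "disk = cbox (Complex (-8) (-8)) (Complex 8 8)"

datatype yoshikawa_move =
  \<Omega>1 | \<Omega>2 | \<Omega>3 | \<Omega>4 | \<Omega>4' | \<Omega>5 | \<Omega>6 | \<Omega>6' | \<Omega>7 | \<Omega>8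

definition kink :: "complex set" where
  "kink = drawn [(-8,-4), (-4,-4), (4,4), (4,-4), (-4,4), (-8,4)]"

definition simple_arc :: picture where
  "simple_arc =
     \<lparr>curve = drawn [(-8,-4), (-4,-4), (-4,4), (-8,4)], overs = {}, markers = {}\<rparr>"

definition strand_SW_NE :: "complex set" where
  "strand_SW_NE = drawn [(-6,-8), (-6,-6), (6,6), (6,8)]"

definition strand_NW_SE :: "complex set" where
  "strand_NW_SE = drawn [(-6,8), (-6,6), (6,-6), (6,-8)]"

definition strand_H_below :: "complex set" where
  "strand_H_below = drawn [(-8,0), (-7,0), (-5,-3), (5,-3), (7,0), (8,0)]"

definition strand_H_above :: "complex set" where
  "strand_H_above = drawn [(-8,0), (-7,0), (-5,3), (5,3), (7,0), (8,0)]"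

definition curve_\<Omega>5 :: "complex set" where
  "curve_\<Omega>5 = drawn [(-8,-3), (-6,-3), (0,3), (6,-3), (8,-3)]
            \<union> drawn [(-8,3), (-6,3), (0,-3), (6,3), (8,3)]"

text \<open>The two vertices are \<open>v = (-4,4)\<close> and \<open>v' = (4,4)\<close>; the first two paths run through \<open>v\<close>.\<close>

definition curve_\<Omega>8 :: "complex set" where
  "curve_\<Omega>8 = drawn [(-6,8), (-6,6), (6,-6), (6,-8)]
            \<union> drawn [(-2,8), (-2,6), (-6,2), (2,-6), (2,-8)]
            \<union> drawn [(6,8), (6,6), (-6,-6), (-6,-8)]
            \<union> drawn [(2,8), (2,6), (6,2), (-2,-6), (-2,-8)]"

fun left_side :: "yoshikawa_move \<Rightarrow> picture" where
  "left_side \<Omega>1 = \<lparr>curve = kink, overs = tick (1 + \<i>) (0,0), markers = {}\<rparr>"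
| "left_side \<Omega>2 =
     \<lparr>curve = drawn [(-4,-8), (-4,-6), (2,0), (-4,6), (-4,8)]
            \<union> drawn [(4,-8), (4,-6), (-2,0), (4,6), (4,8)],
      overs = tick (1 + \<i>) (0,-2) \<union> tick (1 - \<i>) (0,2),
      markers = {}\<rparr>"
| "left_side \<Omega>3 =
     \<lparr>curve = strand_SW_NE \<union> strand_NW_SE \<union> strand_H_below,
      overs = tick (1 - \<i>) (0,0) \<union> tick 1 (-3,-3) \<union> tick 1 (3,-3),
      markers = {}\<rparr>"
| "left_side \<Omega>4 =
     \<lparr>curve = strand_SW_NE \<union> strand_NW_SE \<union> strand_H_below,
      overs = tick 1 (-3,-3) \<union> tick 1 (3,-3),
      markers = tick 1 (0,0)\<rparr>"
| "left_side \<Omega>4' =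
     \<lparr>curve = strand_SW_NE \<union> strand_NW_SE \<union> strand_H_below,
      overs = tick (1 + \<i>) (-3,-3) \<union> tick (1 - \<i>) (3,-3),
      markers = tick 1 (0,0)\<rparr>"
| "left_side \<Omega>5 =
     \<lparr>curve = curve_\<Omega>5, overs = tick (1 + \<i>) (-3,0), markers = tick 1 (3,0)\<rparr>"
| "left_side \<Omega>6 = \<lparr>curve = kink, overs = {}, markers = tick \<i> (0,0)\<rparr>"
| "left_side \<Omega>6' = \<lparr>curve = kink, overs = {}, markers = tick 1 (0,0)\<rparr>"
| "left_side \<Omega>7 =
     \<lparr>curve = drawn [(-4,-8), (-4,-4), (4,4), (4,8)]
            \<union> drawn [(-4,8), (-4,0), (0,-4), (0,-8)]
            \<union> drawn [(0,8), (0,4), (4,0), (4,-8)],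
      overs = {},
      markers = tick \<i> (-2,-2) \<union> tick 1 (2,2)\<rparr>"
| "left_side \<Omega>8 =
     \<lparr>curve = curve_\<Omega>8,
      overs = tick (1 + \<i>) (0,0) \<union> tick (1 + \<i>) (-2,-2) \<union> tick (1 + \<i>) (2,-2) \<union> tick (1 + \<i>) (0,-4),
      markers = tick \<i> (-4,4) \<union> tick 1 (4,4)\<rparr>"

fun right_side :: "yoshikawa_move \<Rightarrow> picture" where
  "right_side \<Omega>1 = simple_arc"
| "right_side \<Omega>2 =
     \<lparr>curve = drawn [(-4,-8), (-4,8)] \<union> drawn [(4,-8), (4,8)], overs = {}, markers = {}\<rparr>"
| "right_side \<Omega>3 =
     \<lparr>curve = strand_SW_NE \<union> strand_NW_SE \<union> strand_H_above,
      overs = tick (1 - \<i>) (0,0) \<union> tick 1 (-3,3) \<union> tick 1 (3,3),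
      markers = {}\<rparr>"
| "right_side \<Omega>4 =
     \<lparr>curve = strand_SW_NE \<union> strand_NW_SE \<union> strand_H_above,
      overs = tick 1 (-3,3) \<union> tick 1 (3,3),
      markers = tick 1 (0,0)\<rparr>"
| "right_side \<Omega>4' =
     \<lparr>curve = strand_SW_NE \<union> strand_NW_SE \<union> strand_H_above,
      overs = tick (1 - \<i>) (-3,3) \<union> tick (1 + \<i>) (3,3),
      markers = tick 1 (0,0)\<rparr>"
| "right_side \<Omega>5 =
     \<lparr>curve = curve_\<Omega>5, overs = tick (1 + \<i>) (3,0), markers = tick 1 (-3,0)\<rparr>"
| "right_side \<Omega>6 = simple_arc"
| "right_side \<Omega>6' = simple_arc"
| "right_side \<Omega>7 =
     \<lparr>curve = drawn [(-4,8), (-4,4), (4,-4), (4,-8)]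
            \<union> drawn [(0,8), (0,4), (-4,0), (-4,-8)]
            \<union> drawn [(4,8), (4,0), (0,-4), (0,-8)],
      overs = {},
      markers = tick \<i> (-2,2) \<union> tick 1 (2,-2)\<rparr>"
| "right_side \<Omega>8 =
     \<lparr>curve = curve_\<Omega>8,
      overs = tick (1 - \<i>) (0,0) \<union> tick (1 - \<i>) (-2,-2) \<union> tick (1 - \<i>) (2,-2) \<union> tick (1 - \<i>) (0,-4),
      markers = tick \<i> (-4,4) \<union> tick 1 (4,4)\<rparr>"

definition replaces :: "yoshikawa_move \<Rightarrow> picture \<Rightarrow> picture \<Rightarrow> bool" where
  "replaces m D D' \<longleftrightarrow>
     marked_graph_diagram D \<and> marked_graph_diagram D' \<and>
     restrict_pic D (- disk) = restrict_pic D' (- disk) \<and>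
     restrict_pic D disk = left_side m \<and> restrict_pic D' disk = right_side m"

text \<open>
  A move may take place in any disk, in which the diagram looks like the standard picture;
  an isotopy of the plane brings that disk and its contents to the standard position.
\<close>

definition move :: "yoshikawa_move \<Rightarrow> picture \<Rightarrow> picture \<Rightarrow> bool" where
  "move m D D' \<longleftrightarrow>
     (\<exists>E E'. plane_isotopic D E \<and> replaces m E E' \<and> plane_isotopic E' D')"

definition related_by :: "yoshikawa_move set \<Rightarrow> picture \<Rightarrow> picture \<Rightarrow> bool" where
  "related_by M =
     (\<lambda>D D'. plane_isotopic D D' \<or> (\<exists>m\<in>M. move m D D' \<or> move m D' D))\<^sup>*\<^sup>*"

end

theory Submission
  imports Defs
begin

text \<open>
  The theorem follows from a mod 2 invariant, computed from the curve and the markers of a diagram,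
  that survives every move except \<open>\<Omega>4\<close> and \<open>\<Omega>4'\<close>.

  Colour each region, that is, each component of the complement of the curve, by a pair
  \<open>(\<rho>, \<beta>)\<close> of bits.  The shading \<open>\<rho>\<close> is the chequerboard shading: it changes across every edge
  and is \<open>False\<close> near infinity, so the curve determines it.  The bit \<open>\<beta>\<close> varies from colouring to
  colouring.  It changes across the edges of a subgraph of the curve; call these edges active.
  Opposite sectors of a double point agree in \<open>\<rho>\<close>, adjacent ones do not, and therefore the number of
  colours that meet at the point says how the active edges run there:

    \<^item> two colours: none or all four edges are active;
    \<^item> four colours: exactly one of the two strands is active, and it goes straight through;
    \<^item> three colours: the active edges turn, from one strand to the other.

  Three colours are forbidden at the crossings, where active edges go straight, and are allowed at
  the marked vertices.  A marked vertex is a rainbow vertex of the colouring if all four colours meet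
  there and its marker lies in the two sectors with \<open>\<rho> = True\<close>.  The invariant of the diagram
  (\<open>odd_colourable\<close>) is the existence of a colouring with an odd number of rainbow vertices.

  Why the moves preserve it.  Outside the disk of a move a colouring is left alone; inside, it has to
  be continued over the new picture without changing the parity.

    \<^item> \<open>\<Omega>1\<close>, \<open>\<Omega>2\<close>, \<open>\<Omega>3\<close>: active edges go straight, so the colours around the disk determine the
      colour of the loop, bigon or triangle, and a colouring that exists on one side of the move
      exists on the other.
    \<^item> \<open>\<Omega>6\<close>, \<open>\<Omega>6'\<close>: two opposite sectors of the vertex lie in the same region, so at most three
      colours meet there.
    \<^item> \<open>\<Omega>5\<close>: the bigon between crossing and vertex is recoloured so that the active edges go straight at the
      new crossing; then the new vertex is a rainbow vertex iff the old one was.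
    \<^item> \<open>\<Omega>7\<close>: write \<open>W\<close>, \<open>N\<^sub>1\<close>, \<open>N\<^sub>2\<close>, \<open>E\<close>, \<open>S\<^sub>2\<close>, \<open>S\<^sub>1\<close> for the bits \<open>\<beta>\<close> of the six regions, clockwise from
      the left.  All four markers lie in regions of the same shading, and over the field with two
      elements
      \<open>(W + S\<^sub>2) (N\<^sub>1 + S\<^sub>1) + (N\<^sub>1 + E) (N\<^sub>2 + S\<^sub>2) = (W + N\<^sub>2) (S\<^sub>1 + N\<^sub>1) + (S\<^sub>1 + E) (S\<^sub>2 + N\<^sub>2)\<close>,
      where the products are the rainbow conditions at the four vertices.
    \<^item> \<open>\<Omega>8\<close> keeps the curve and the markers.

  These checks are \<open>moves_transfer\<close>; invariance is \<open>related_by_odd_colourable\<close>.  All conditions on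
  colourings are phrased with closures of sets of points of one colour, without charts or sectors,
  so that homeomorphisms of the plane preserve them for trivial reasons.

  Pushing a strand over or under a marked vertex exchanges the shadings of its four sectors, hence
  may turn a rainbow vertex into one that is not.  This happens for a diagram with one marked vertex
  and two crossings: two strands of the picture of \<open>\<Omega>4\<close> close up to a figure eight, the third one to
  a simple loop.  With the strand above the vertex, the colouring whose \<open>\<beta>\<close> marks the inside of the
  loop has exactly one rainbow vertex (\<open>upper_link_odd_colourable\<close>).  With the strand below, one
  marker sector is part of the unbounded region, so no colouring has a rainbow vertex
  (\<open>lower_link_not_odd_colourable\<close>).
\<close>

section \<open>Colourings of the regions of a diagram\<close>

text \<open>
  The colours of the sectors that meet at \<open>p\<close>.
\<close>

definition colours_at :: "complex set \<Rightarrow> (complex \<Rightarrow> bool \<times> bool) \<Rightarrow> complex \<Rightarrow> (bool \<times> bool) set" where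
  "colours_at C f p = {c. p \<in> closure {z. z \<notin> C \<and> f z = c}}"

text \<open>
  A colouring is a total function that is read off the curve \<open>C\<close> only, where it has to be constant on
  the components of the complement.
\<close>

definition locally_constant_off :: "complex set \<Rightarrow> (complex \<Rightarrow> 'a) \<Rightarrow> bool" where
  "locally_constant_off C f \<longleftrightarrow> (\<forall>z. z \<notin> C \<longrightarrow> (\<forall>\<^sub>F w in nhds z. w \<notin> C \<longrightarrow> f w = f z))"

text \<open>
  The two components of a colour are the shading \<open>\<rho>\<close> and the bit \<open>\<beta>\<close>.  The second condition makes
  \<open>\<rho>\<close> change across every edge, the third one makes active edges go straight at crossings
  (\<open>M\<close> meets the curve in the marked vertices only), and the last one makes the unbounded region white.
\<close>

definition region_colouring :: "complex set \<Rightarrow> complex set \<Rightarrow> (complex \<Rightarrow> bool \<times> bool) \<Rightarrow> bool" where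
  "region_colouring C M f \<longleftrightarrow>
     locally_constant_off C f \<and>
     (\<forall>p\<in>C. fst ` colours_at C f p = UNIV) \<and>
     (\<forall>p\<in>C - M. card (colours_at C f p) \<noteq> 3) \<and>
     bounded {z. z \<notin> C \<and> fst (f z)}"

text \<open>
  The two marker sectors at a double point have the same shading, so the marker lies in shaded
  sectors iff no unshaded points of the marker accumulate at the vertex.
\<close>

definition rainbow :: "complex set \<Rightarrow> complex set \<Rightarrow> (complex \<Rightarrow> bool \<times> bool) \<Rightarrow> complex set" where
  "rainbow C M f =
     {v \<in> M. colours_at C f v = UNIV \<and> v \<notin> closure {z \<in> M - C. \<not> fst (f z)}}"

definition odd_colourable :: "complex set \<Rightarrow> complex set \<Rightarrow> bool" where
  "odd_colourable C M \<longleftrightarrow>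
     (\<exists>f. region_colouring C M f \<and> finite (rainbow C M f) \<and> odd (card (rainbow C M f)))"

lemma locally_constant_offI:
  assumes "\<And>z. z \<notin> C \<Longrightarrow> \<exists>N. open N \<and> z \<in> N \<and> (\<forall>w\<in>N. w \<notin> C \<longrightarrow> f w = f z)"
  shows "locally_constant_off C f"
  unfolding locally_constant_off_def eventually_nhds using assms by blast

lemma closure_local:
  fixes A B :: "complex set"
  assumes "open N" "p \<in> N" "A \<inter> N = B \<inter> N"
  shows "p \<in> closure A \<longleftrightarrow> p \<in> closure B"
proof -
  have "p \<in> closure Y" if "X \<inter> N = Y \<inter> N" "p \<in> closure X" for X Y :: "complex set"
  proof -
    have "p \<in> closure (N \<inter> X)"
      using open_Int_closure_subset[OF \<open>open N\<close>, of X] \<open>p \<in> N\<close> that(2) by blast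
    moreover have "closure (N \<inter> X) \<subseteq> closure Y"
      by (rule closure_mono) (use that(1) in blast)
    ultimately show ?thesis by blast
  qed
  from this[OF assms(3)] this[OF assms(3)[symmetric]] show ?thesis by blast
qed

lemma colours_at_local:
  assumes "open N" "p \<in> N" "C \<inter> N = C' \<inter> N" "\<And>z. z \<in> N \<Longrightarrow> z \<notin> C \<Longrightarrow> f z = f' z"
  shows "colours_at C f p = colours_at C' f' p"
proof -
  have "{z. z \<notin> C \<and> f z = c} \<inter> N = {z. z \<notin> C' \<and> f' z = c} \<inter> N" for c
    using assms(3,4) by auto
  then have "p \<in> closure {z. z \<notin> C \<and> f z = c} \<longleftrightarrow> p \<in> closure {z. z \<notin> C' \<and> f' z = c}" for c
    by (rule closure_local[OF assms(1,2)])
  then show ?thesis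
    by (simp only: colours_at_def)
qed

lemma constant_on_connected:
  assumes "locally_constant_off C f" "connected S" "S \<inter> C = {}" "a \<in> S" "b \<in> S"
  shows "f a = f b"
proof (rule connected_local_const[OF assms(2,4,5)], intro ballI)
  fix z assume "z \<in> S"
  then have "\<forall>\<^sub>F w in nhds z. w \<notin> C \<longrightarrow> f w = f z"
    using assms(1,3) unfolding locally_constant_off_def by blast
  then have "\<forall>\<^sub>F w in at z within S. w \<notin> C \<longrightarrow> f w = f z"
    by (simp add: eventually_at_filter eventually_mono)
  moreover have "\<forall>\<^sub>F w in at z within S. w \<in> S"
    by (simp add: eventually_at_filter)
  ultimately show "\<forall>\<^sub>F w in at z within S. f z = f w"
    by eventually_elim (use assms(3) in auto)
qed

section \<open>Invariance under homeomorphisms\<close>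

lemma closure_homeo:
  fixes g :: "complex \<Rightarrow> complex"
  assumes h: "homeomorphism UNIV UNIV g k"
  shows "closure (g ` A) = g ` closure A"
proof
  have cont: "continuous_on UNIV g" "continuous_on UNIV k"
    and gk: "\<And>x. g (k x) = x" "\<And>x. k (g x) = x"
    using h by (auto simp: homeomorphism_def)
  show "g ` closure A \<subseteq> closure (g ` A)"
    by (rule image_closure_subset[OF continuous_on_subset[OF cont(1)]]) (auto simp: closure_subset)
  have "k ` closure (g ` A) \<subseteq> closure (k ` g ` A)"
    by (rule image_closure_subset[OF continuous_on_subset[OF cont(2)]]) (auto simp: closure_subset)
  also have "k ` g ` A = A"
    by (auto simp: gk image_image)
  finally have *: "k ` closure (g ` A) \<subseteq> closure A" .
  show "closure (g ` A) \<subseteq> g ` closure A"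
  proof
    fix x assume "x \<in> closure (g ` A)"
    then have "k x \<in> closure A" using * by auto
    then show "x \<in> g ` closure A" using gk(1)[of x] by (metis imageI)
  qed
qed

lemma locally_constant_compose:
  assumes f: "locally_constant_off C f" and g: "continuous_on UNIV g"
  shows "locally_constant_off (g -` C) (f \<circ> g)"
  unfolding locally_constant_off_def comp_def
proof (intro allI impI)
  fix z assume "z \<notin> g -` C"
  then have "\<forall>\<^sub>F w in nhds (g z). w \<notin> C \<longrightarrow> f w = f (g z)"
    using f by (simp add: locally_constant_off_def)
  moreover have "(g \<longlongrightarrow> g z) (nhds z)"
    using g by (simp add: continuous_on_eq_continuous_at isCont_def tendsto_at_iff_tendsto_nhds)
  ultimately have "\<forall>\<^sub>F w in nhds z. g w \<notin> C \<longrightarrow> f (g w) = f (g z)"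
    by (rule eventually_compose_filterlim)
  then show "\<forall>\<^sub>F w in nhds z. w \<notin> g -` C \<longrightarrow> f (g w) = f (g z)" by simp
qed

lemma mem_image_homeo:
  assumes "homeomorphism UNIV UNIV g k"
  shows "z \<in> g ` A \<longleftrightarrow> k z \<in> A"
proof -
  have "\<And>x. g (k x) = x" "\<And>x. k (g x) = x" using assms by (auto simp: homeomorphism_def)
  then show ?thesis by (metis imageE imageI)
qed

lemma closure_vimage_homeo:
  fixes g :: "complex \<Rightarrow> complex"
  assumes "homeomorphism UNIV UNIV g k"
  shows "z \<in> closure {z. P (k z)} \<longleftrightarrow> k z \<in> closure {z. P z}"
proof -
  have "g ` {z. P z} = {z. P (k z)}" by (rule set_eqI) (simp add: mem_image_homeo[OF assms])
  then have "closure {z. P (k z)} = g ` closure {z. P z}" using closure_homeo[OF assms, of "{z. P z}"] by simp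
  then show ?thesis by (simp add: mem_image_homeo[OF assms])
qed

lemma colours_at_homeo:
  assumes "homeomorphism UNIV UNIV g k"
  shows "colours_at (g ` C) (f \<circ> k) z = colours_at C f (k z)"
  unfolding colours_at_def mem_image_homeo[OF assms] comp_def
  using closure_vimage_homeo[OF assms, of z "\<lambda>w. w \<notin> C \<and> f w = c" for c] by simp

lemma locally_constant_homeo:
  assumes h: "homeomorphism UNIV UNIV g k" and f: "locally_constant_off C f"
  shows "locally_constant_off (g ` C) (f \<circ> k)"
proof -
  have "g ` C = k -` C" by (rule set_eqI) (simp add: mem_image_homeo[OF h])
  then show ?thesis using locally_constant_compose[OF f, of k] h by (simp add: homeomorphism_def)
qed

lemma rainbow_homeo:
  assumes h: "homeomorphism UNIV UNIV g k"
  shows "rainbow (g ` C) (g ` M) (f \<circ> k) = g ` rainbow C M f"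
proof -
  have *: "{z \<in> g ` M - g ` C. \<not> fst ((f \<circ> k) z)} = {z. k z \<in> M - C \<and> \<not> fst (f (k z))}"
    unfolding Diff_iff mem_image_homeo[OF h] comp_def by simp
  have clo: "z \<in> closure {z \<in> g ` M - g ` C. \<not> fst ((f \<circ> k) z)} \<longleftrightarrow>
      k z \<in> closure {z \<in> M - C. \<not> fst (f z)}" for z
    unfolding * by (rule closure_vimage_homeo[OF h, of z "\<lambda>w. w \<in> M - C \<and> \<not> fst (f w)"])
  show ?thesis
    by (rule set_eqI) (simp only: rainbow_def clo colours_at_homeo[OF h] mem_image_homeo[OF h] mem_Collect_eq)
qed

lemma odd_colourable_homeo:
  assumes h: "homeomorphism UNIV UNIV g k" and inv: "odd_colourable C M"
  shows "odd_colourable (g ` C) (g ` M)"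
proof -
  obtain f where f: "region_colouring C M f" "finite (rainbow C M f)" "odd (card (rainbow C M f))"
    using inv by (auto simp: odd_colourable_def)
  have cont: "continuous_on UNIV g" and gk: "\<And>x. g (k x) = x" "\<And>x. k (g x) = x"
    using h by (auto simp: homeomorphism_def)
  have inj: "inj g" using inj_on_inverseI[of UNIV k g] gk by simp
  note mem = mem_image_homeo[OF h] and col = colours_at_homeo[OF h]
  let ?f = "f \<circ> k"
  have "region_colouring (g ` C) (g ` M) ?f"
    unfolding region_colouring_def
  proof (intro conjI ballI)
    show "locally_constant_off (g ` C) ?f"
      by (rule locally_constant_homeo[OF h]) (use f(1) in \<open>simp add: region_colouring_def\<close>)
    show "fst ` colours_at (g ` C) ?f p = UNIV" if "p \<in> g ` C" for p
      using that f(1) unfolding col mem by (auto simp: region_colouring_def)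
    show "card (colours_at (g ` C) ?f p) \<noteq> 3" if "p \<in> g ` C - g ` M" for p
      using that f(1) unfolding col mem Diff_iff by (auto simp: region_colouring_def)
    have "bounded {z. z \<notin> C \<and> fst (f z)}"
      using f(1) by (simp add: region_colouring_def)
    then have "compact (closure {z. z \<notin> C \<and> fst (f z)})"
      by (simp add: compact_closure)
    then have "compact (g ` closure {z. z \<notin> C \<and> fst (f z)})"
      by (rule compact_continuous_image[OF continuous_on_subset[OF cont], rotated]) simp
    moreover have "{z. z \<notin> g ` C \<and> fst (?f z)} \<subseteq> g ` closure {z. z \<notin> C \<and> fst (f z)}"
    proof
      fix z assume "z \<in> {z. z \<notin> g ` C \<and> fst (?f z)}"
      then have "k z \<in> {z. z \<notin> C \<and> fst (f z)}" by (simp add: mem)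
      then show "z \<in> g ` closure {z. z \<notin> C \<and> fst (f z)}"
        unfolding mem by (rule subsetD[OF closure_subset])
    qed
    ultimately show "bounded {z. z \<notin> g ` C \<and> fst (?f z)}"
      using bounded_subset compact_imp_bounded by blast
  qed
  then show ?thesis
    using f(2,3) card_image[OF inj_on_subset[OF inj subset_UNIV], of "rainbow C M f"]
    unfolding odd_colourable_def by (intro exI[of _ ?f]) (simp add: rainbow_homeo[OF h])
qed

section \<open>Locality\<close>

text \<open>
  The locality of the invariant.  All conditions on a colouring, as well as being a rainbow vertex,
  depend only on a neighbourhood of a point; so if two diagrams and their colourings agree off a
  compact set \<open>K\<close>, only the points of \<open>K\<close> have to be inspected.  Compactness serves twice: the
  complement of \<open>K\<close> is open, and changing the shading in \<open>K\<close> keeps the shaded part bounded.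
\<close>

lemma odd_colourable_replace:
  assumes K: "compact K"
    and C: "C - K = C' - K" and M: "M - K = M' - K"
    and f: "region_colouring C M f" "finite (rainbow C M f)" "odd (card (rainbow C M f))"
    and f': "\<And>z. z \<notin> K \<Longrightarrow> z \<notin> C \<Longrightarrow> f' z = f z"
    and loc: "\<And>z. z \<in> K \<Longrightarrow> z \<notin> C' \<Longrightarrow> (\<forall>\<^sub>F w in nhds z. w \<notin> C' \<longrightarrow> f' w = f' z)"
    and chk: "\<And>p. p \<in> K \<Longrightarrow> p \<in> C' \<Longrightarrow> fst ` colours_at C' f' p = UNIV"
    and crs: "\<And>p. p \<in> K \<Longrightarrow> p \<in> C' \<Longrightarrow> p \<notin> M' \<Longrightarrow> card (colours_at C' f' p) \<noteq> 3"
    and fin: "finite (rainbow C' M' f' \<inter> K)"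
    and par: "odd (card (rainbow C M f \<inter> K)) \<longleftrightarrow> odd (card (rainbow C' M' f' \<inter> K))"
  shows "odd_colourable C' M'"
proof -
  have op: "open (- K)" using K by (simp add: compact_imp_closed open_Compl)
  have C_iff: "p \<in> C' \<longleftrightarrow> p \<in> C" and M_iff: "p \<in> M' \<longleftrightarrow> p \<in> M" if "p \<notin> K" for p
    using set_eq_iff[THEN iffD1, OF C, THEN spec, of p] set_eq_iff[THEN iffD1, OF M, THEN spec, of p] that
    by simp_all
  have CN: "C \<inter> - K = C' \<inter> - K" using C by (simp only: Diff_eq)
  have ff: "\<And>z. z \<in> - K \<Longrightarrow> z \<notin> C \<Longrightarrow> f z = f' z" using f' by auto
  have col: "colours_at C f p = colours_at C' f' p" if "p \<notin> K" for p
    by (rule colours_at_local[OF op _ CN ff]) (use that in auto)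
  have "region_colouring C' M' f'"
    unfolding region_colouring_def
  proof (intro conjI ballI)
    show "locally_constant_off C' f'"
      unfolding locally_constant_off_def
    proof (intro allI impI)
      fix z assume z: "z \<notin> C'"
      show "\<forall>\<^sub>F w in nhds z. w \<notin> C' \<longrightarrow> f' w = f' z"
      proof (cases "z \<in> K")
        case False
        have "\<forall>\<^sub>F w in nhds z. w \<notin> C \<longrightarrow> f w = f z"
          using f(1) z C_iff[OF False] by (auto simp: region_colouring_def locally_constant_off_def)
        moreover have "\<forall>\<^sub>F w in nhds z. w \<in> - K"
          by (rule eventually_nhds_in_open[OF op]) (use False in simp)
        ultimately show ?thesis
          proof eventually_elim
            case (elim w)
            then show ?case using C_iff[of w] C_iff[OF False] f'[of w] f'[OF False] z by simp
          qed
      next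
      case True
      then show ?thesis using loc[OF _ z] by blast
    qed
    qed
    show "fst ` colours_at C' f' p = UNIV" if "p \<in> C'" for p
    proof (cases "p \<in> K")
      case False
      then show ?thesis using f(1) that C_iff[OF False] by (simp add: col[symmetric] region_colouring_def)
    qed (use chk that in auto)
    show "card (colours_at C' f' p) \<noteq> 3" if "p \<in> C' - M'" for p
    proof (cases "p \<in> K")
      case False
      then show ?thesis using f(1) that C_iff[OF False] M_iff[OF False]
        by (auto simp: col[symmetric] region_colouring_def)
    qed (use crs that in auto)
    have "{z. z \<notin> C' \<and> fst (f' z)} \<subseteq> {z. z \<notin> C \<and> fst (f z)} \<union> K"
    proof
      fix z assume z: "z \<in> {z. z \<notin> C' \<and> fst (f' z)}"
      then show "z \<in> {z. z \<notin> C \<and> fst (f z)} \<union> K"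
        using C_iff[of z] f'[of z] by (cases "z \<in> K") auto
    qed
    moreover have "bounded ({z. z \<notin> C \<and> fst (f z)} \<union> K)"
      using f(1) compact_imp_bounded[OF K] by (simp add: region_colouring_def)
    ultimately show "bounded {z. z \<notin> C' \<and> fst (f' z)}"
      using bounded_subset by blast
  qed
  moreover have out: "rainbow C' M' f' - K = rainbow C M f - K"
  proof -
    have "{z \<in> M - C. \<not> fst (f z)} \<inter> - K = {z \<in> M' - C'. \<not> fst (f' z)} \<inter> - K"
    proof (rule set_eqI)
      fix z
      show "z \<in> {z \<in> M - C. \<not> fst (f z)} \<inter> - K \<longleftrightarrow> z \<in> {z \<in> M' - C'. \<not> fst (f' z)} \<inter> - K"
        using C_iff[of z] M_iff[of z] f'[of z] by auto
    qed
    then have clo: "p \<in> closure {z \<in> M - C. \<not> fst (f z)} \<longleftrightarrow> p \<in> closure {z \<in> M' - C'. \<not> fst (f' z)}"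
      if "p \<in> - K" for p
      using closure_local[OF op that] by blast
    show ?thesis
    proof (rule set_eqI)
      fix p
      show "p \<in> rainbow C' M' f' - K \<longleftrightarrow> p \<in> rainbow C M f - K"
        using clo[of p] col[of p] M_iff[of p] by (cases "p \<in> K") (simp_all add: rainbow_def)
    qed
  qed
  moreover have fin': "finite (rainbow C' M' f')"
  proof -
    have "finite ((rainbow C' M' f' - K) \<union> (rainbow C' M' f' \<inter> K))"
      using fin f(2) out by simp
    then show ?thesis by (simp only: Un_Diff_Int)
  qed
  moreover have "odd (card (rainbow C' M' f'))"
  proof -
    have card_split: "card X = card (X - K) + card (X \<inter> K)" if "finite X" for X :: "complex set"
    proof -
      have "card ((X - K) \<union> (X \<inter> K)) = card (X - K) + card (X \<inter> K)"
        by (rule card_Un_disjoint) (use that in auto)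
      then show ?thesis by (simp add: Un_Diff_Int)
    qed
    show ?thesis
      using card_split[OF f(2)] card_split[OF fin'] f(3) par out by simp
  qed
  ultimately show ?thesis
    unfolding odd_colourable_def by blast
qed

section \<open>Reading off the colours at a point\<close>

lemma mem_closure_ray:
  fixes p d :: complex
  assumes "e > 0" "\<And>t. 0 < t \<Longrightarrow> t < e \<Longrightarrow> p + of_real t * d \<in> S"
  shows "p \<in> closure S"
proof (rule closure_sequential[THEN iffD2], intro exI conjI allI)
  let ?s = "\<lambda>n. p + of_real (e / (real n + 2)) * d"
  show "?s n \<in> S" for n
    by (rule assms(2)) (use \<open>e > 0\<close> in \<open>auto simp: field_simps intro: add_pos_nonneg\<close>)
  have "(\<lambda>n. e / (real n + 2)) \<longlonglongrightarrow> 0"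
    using LIMSEQ_ignore_initial_segment[OF lim_const_over_n[of e], of 2] by (simp add: add.commute)
  then have "?s \<longlonglongrightarrow> p + of_real 0 * d"
    by (intro tendsto_intros)
  then show "?s \<longlonglongrightarrow> p" by simp
qed

lemma mem_closure_ray_xy:
  assumes "e > 0" "\<And>t. 0 < t \<Longrightarrow> t < e \<Longrightarrow> Complex (u + t * a) (v + t * b) \<in> S"
  shows "Complex u v \<in> closure S"
proof (rule mem_closure_ray[of e _ "Complex a b"])
  fix t :: real assume "0 < t" "t < e"
  moreover have "Complex u v + of_real t * Complex a b = Complex (u + t * a) (v + t * b)"
    by (simp add: complex_eq_iff)
  ultimately show "Complex u v + of_real t * Complex a b \<in> S" using assms(2) by metis
qed (rule assms(1))

lemma mem_closure_sign:
  fixes \<phi> :: "complex \<Rightarrow> real"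
  assumes "e > 0"
  shows "(\<And>t. 0 < t \<Longrightarrow> t < e \<Longrightarrow> \<phi> (Complex (u + t * a) (v + t * b)) > 0) \<Longrightarrow> Complex u v \<in> closure {z. \<phi> z > 0}"
    and "(\<And>t. 0 < t \<Longrightarrow> t < e \<Longrightarrow> \<phi> (Complex (u + t * a) (v + t * b)) < 0) \<Longrightarrow> Complex u v \<in> closure {z. \<phi> z < 0}"
  by (rule mem_closure_ray_xy[of e u a v b]; use assms in simp)+

lemmas mem_closure_pos = mem_closure_sign[of 1, OF zero_less_one]

lemma closure_Int_open:
  assumes "open N" "p \<in> N" "p \<in> closure S"
  shows "p \<in> closure (N \<inter> S)"
  using open_Int_closure_subset[OF assms(1), of S] assms(2,3) by blast

lemma colours_at_subset:
  assumes "open N" "p \<in> N" "\<And>z. z \<in> N \<Longrightarrow> z \<notin> C \<Longrightarrow> f z \<in> A"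
  shows "colours_at C f p \<subseteq> A"
proof
  fix c assume "c \<in> colours_at C f p"
  then have "p \<in> closure (N \<inter> {z. z \<notin> C \<and> f z = c})"
    by (simp add: colours_at_def closure_Int_open assms(1,2))
  then have "N \<inter> {z. z \<notin> C \<and> f z = c} \<noteq> {}" by auto
  then show "c \<in> A" using assms(3) by blast
qed

lemma colours_at_mem:
  assumes "open N" "p \<in> N" "p \<in> closure S" "\<And>z. z \<in> N \<Longrightarrow> z \<in> S \<Longrightarrow> z \<notin> C \<and> f z = c"
  shows "c \<in> colours_at C f p"
proof -
  have "p \<in> closure (N \<inter> S)" by (rule closure_Int_open[OF assms(1-3)])
  then show ?thesis
    unfolding colours_at_def
    using closure_mono[of "N \<inter> S" "{z. z \<notin> C \<and> f z = c}"] assms(4) by (simp add: subset_iff)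
qed

text \<open>
  Near an interior point of an edge that is the zero set of \<open>\<phi>\<close>, the two sides are given by the sign
  of \<open>\<phi>\<close>.
\<close>

lemma colours_at_wall:
  fixes \<phi> :: "complex \<Rightarrow> real"
  assumes N: "open N" "p \<in> N"
    and C: "\<And>z. z \<in> N \<Longrightarrow> z \<in> C \<longleftrightarrow> \<phi> z = 0"
    and f: "\<And>z. z \<in> N \<Longrightarrow> \<phi> z \<noteq> 0 \<Longrightarrow> f z = G (\<phi> z > 0)"
    and pos: "p \<in> closure {z. \<phi> z > 0}" and neg: "p \<in> closure {z. \<phi> z < 0}"
  shows "colours_at C f p = {G True, G False}"
proof
  show "colours_at C f p \<subseteq> {G True, G False}"
  proof (rule colours_at_subset[OF N])
    fix z assume "z \<in> N" "z \<notin> C"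
    then show "f z \<in> {G True, G False}" using C[of z] f[of z] by (cases "\<phi> z > 0") simp_all
  qed
  have "G True \<in> colours_at C f p"
  proof (rule colours_at_mem[OF N pos])
    fix z assume "z \<in> N" "z \<in> {z. \<phi> z > 0}"
    then show "z \<notin> C \<and> f z = G True" using C[of z] f[of z] by simp
  qed
  moreover have "G False \<in> colours_at C f p"
  proof (rule colours_at_mem[OF N neg])
    fix z assume "z \<in> N" "z \<in> {z. \<phi> z < 0}"
    then show "z \<notin> C \<and> f z = G False" using C[of z] f[of z] by simp
  qed
  ultimately show "{G True, G False} \<subseteq> colours_at C f p" by simp
qed

lemma open_box_xy: "open {z. \<bar>Re z - u\<bar> < e \<and> \<bar>Im z - v\<bar> < e}"
  by (intro open_Collect_conj open_Collect_less continuous_intros)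

text \<open>
  A linear equation defines the edge here; in the next lemmas two of them define a crossing.  The
  versions with a function \<open>G\<close> of the signs carry the proofs, those with explicit colours are used
  for reading colours off a picture.
\<close>

lemma colours_at_edge_sign:
  assumes e: "e > 0" and ab: "a \<noteq> 0 \<or> b \<noteq> 0"
    and C: "\<And>x y. \<bar>x - u\<bar> < e \<Longrightarrow> \<bar>y - v\<bar> < e \<Longrightarrow> Complex x y \<in> C \<longleftrightarrow> a * (x - u) + b * (y - v) = 0"
    and f: "\<And>x y. \<bar>x - u\<bar> < e \<Longrightarrow> \<bar>y - v\<bar> < e \<Longrightarrow> a * (x - u) + b * (y - v) \<noteq> 0 \<Longrightarrow>
              f (Complex x y) = G (a * (x - u) + b * (y - v) > 0)"
  shows "colours_at C f (Complex u v) = {G True, G False}"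
proof (rule colours_at_wall[OF open_box_xy[of u e v], where \<phi> = "\<lambda>z. a * (Re z - u) + b * (Im z - v)"])
  have pos: "a * a + b * b > 0" using ab sum_squares_gt_zero_iff[of a b] by simp
  have *: "a * (u + t * a - u) + b * (v + t * b - v) = t * (a * a + b * b)" for t
    by (simp add: algebra_simps)
  show "Complex u v \<in> closure {z. 0 < a * (Re z - u) + b * (Im z - v)}"
    by (rule mem_closure_ray_xy[of 1 u a v b]) (use pos * in simp_all)
  show "Complex u v \<in> closure {z. a * (Re z - u) + b * (Im z - v) < 0}"
  proof (rule mem_closure_ray_xy[of 1 u "-a" v "-b"])
    fix t :: real assume "0 < t"
    then have "t * (a * a + b * b) > 0" using pos by simp
    then show "Complex (u + t * - a) (v + t * - b) \<in> {z. a * (Re z - u) + b * (Im z - v) < 0}"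
      by (simp add: algebra_simps)
  qed simp
  show "z \<in> C \<longleftrightarrow> a * (Re z - u) + b * (Im z - v) = 0"
    if "z \<in> {z. \<bar>Re z - u\<bar> < e \<and> \<bar>Im z - v\<bar> < e}" for z
    using C[of "Re z" "Im z"] that by simp
  show "f z = G (0 < a * (Re z - u) + b * (Im z - v))"
    if "z \<in> {z. \<bar>Re z - u\<bar> < e \<and> \<bar>Im z - v\<bar> < e}" "a * (Re z - u) + b * (Im z - v) \<noteq> 0" for z
    using f[of "Re z" "Im z"] that by simp
qed (use e in simp)

lemma colours_at_edge:
  assumes e: "e > 0" and ab: "a \<noteq> 0 \<or> b \<noteq> 0"
    and C: "\<And>x y. \<bar>x - u\<bar> < e \<Longrightarrow> \<bar>y - v\<bar> < e \<Longrightarrow> Complex x y \<in> C \<longleftrightarrow> a * (x - u) + b * (y - v) = 0"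
    and f: "\<And>x y. \<bar>x - u\<bar> < e \<Longrightarrow> \<bar>y - v\<bar> < e \<Longrightarrow> a * (x - u) + b * (y - v) > 0 \<Longrightarrow> f (Complex x y) = c1"
      "\<And>x y. \<bar>x - u\<bar> < e \<Longrightarrow> \<bar>y - v\<bar> < e \<Longrightarrow> a * (x - u) + b * (y - v) < 0 \<Longrightarrow> f (Complex x y) = c2"
  shows "colours_at C f (Complex u v) = {c1, c2}"
proof -
  have "colours_at C f (Complex u v) = {if True then c1 else c2, if False then c1 else c2}"
  proof (rule colours_at_edge_sign[OF e ab C, where G = "\<lambda>b. if b then c1 else c2"])
    fix x y assume xy: "\<bar>x - u\<bar> < e" "\<bar>y - v\<bar> < e" and "a * (x - u) + b * (y - v) \<noteq> 0"
    then consider "a * (x - u) + b * (y - v) > 0" | "a * (x - u) + b * (y - v) < 0" by linarith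
    then show "f (Complex x y) = (if a * (x - u) + b * (y - v) > 0 then c1 else c2)"
      by cases (simp_all add: f[OF xy])
  qed
  then show ?thesis by simp
qed

lemma colours_at_vertical_edge:
  assumes e: "e > 0"
    and C: "\<And>x y. \<bar>x - u\<bar> < e \<Longrightarrow> \<bar>y - v\<bar> < e \<Longrightarrow> Complex x y \<in> C \<longleftrightarrow> x = u"
    and f: "\<And>x y. \<bar>x - u\<bar> < e \<Longrightarrow> \<bar>y - v\<bar> < e \<Longrightarrow> x > u \<Longrightarrow> f (Complex x y) = c1"
      "\<And>x y. \<bar>x - u\<bar> < e \<Longrightarrow> \<bar>y - v\<bar> < e \<Longrightarrow> x < u \<Longrightarrow> f (Complex x y) = c2"
  shows "colours_at C f (Complex u v) = {c1, c2}"
  by (rule colours_at_edge[of e 1 0, OF e]) (use C f in simp_all)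

lemma colours_at_crossing_signs:
  assumes e: "e > 0" and det: "a * d - b * c \<noteq> 0"
    and C: "\<And>x y. \<bar>x - u\<bar> < e \<Longrightarrow> \<bar>y - v\<bar> < e \<Longrightarrow>
       Complex x y \<in> C \<longleftrightarrow> a * (x - u) + b * (y - v) = 0 \<or> c * (x - u) + d * (y - v) = 0"
    and f: "\<And>x y. \<bar>x - u\<bar> < e \<Longrightarrow> \<bar>y - v\<bar> < e \<Longrightarrow>
       a * (x - u) + b * (y - v) \<noteq> 0 \<Longrightarrow> c * (x - u) + d * (y - v) \<noteq> 0 \<Longrightarrow>
       f (Complex x y) = G (a * (x - u) + b * (y - v) > 0) (c * (x - u) + d * (y - v) > 0)"
  shows "colours_at C f (Complex u v) = {G True True, G True False, G False True, G False False}"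
proof
  let ?N = "{z. \<bar>Re z - u\<bar> < e \<and> \<bar>Im z - v\<bar> < e}"
  have p: "Complex u v \<in> ?N" using e by simp
  show "colours_at C f (Complex u v) \<subseteq> {G True True, G True False, G False True, G False False}"
  proof (rule colours_at_subset[OF open_box_xy p])
    fix z assume "z \<in> ?N" "z \<notin> C"
    then have "f z = G (a * (Re z - u) + b * (Im z - v) > 0) (c * (Re z - u) + d * (Im z - v) > 0)"
      using C[of "Re z" "Im z"] f[of "Re z" "Im z"] by simp
    then show "f z \<in> {G True True, G True False, G False True, G False False}"
      by (cases "a * (Re z - u) + b * (Im z - v) > 0"; cases "c * (Re z - u) + d * (Im z - v) > 0") simp_all
  qed
  have "G (s > 0) (t > 0) \<in> colours_at C f (Complex u v)" if "s \<noteq> 0" "t \<noteq> 0" for s t :: real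
  proof (rule colours_at_mem[OF open_box_xy p])
    let ?S = "{z. sgn (a * (Re z - u) + b * (Im z - v)) = sgn s \<and>
                  sgn (c * (Re z - u) + d * (Im z - v)) = sgn t}"
    let ?D = "a * d - b * c"
    \<comment> \<open>By Cramer's rule, the two linear forms grow at the rates \<open>s\<close> and \<open>t\<close> in this direction.\<close>
    show "Complex u v \<in> closure ?S"
    proof (rule mem_closure_ray_xy[of 1 u "(s * d - t * b) / ?D" v "(t * a - s * c) / ?D"])
      fix r :: real assume r: "0 < r"
      have "a * (r * ((s * d - t * b) / ?D)) + b * (r * ((t * a - s * c) / ?D)) = r * s"
        "c * (r * ((s * d - t * b) / ?D)) + d * (r * ((t * a - s * c) / ?D)) = r * t"
        using det by (simp_all add: divide_simps) (simp_all add: algebra_simps)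
      then show "Complex (u + r * ((s * d - t * b) / ?D)) (v + r * ((t * a - s * c) / ?D)) \<in> ?S"
        using r by (simp add: sgn_mult)
    qed simp
    show "z \<notin> C \<and> f z = G (0 < s) (0 < t)" if z: "z \<in> ?N" "z \<in> ?S" for z
    proof -
      have "a * (Re z - u) + b * (Im z - v) \<noteq> 0" "c * (Re z - u) + d * (Im z - v) \<noteq> 0"
        "(a * (Re z - u) + b * (Im z - v) > 0) = (s > 0)" "(c * (Re z - u) + d * (Im z - v) > 0) = (t > 0)"
        using z \<open>s \<noteq> 0\<close> \<open>t \<noteq> 0\<close> by (auto simp: sgn_if split: if_splits)
      then show ?thesis
        using C[of "Re z" "Im z"] f[of "Re z" "Im z"] z(1) by simp
    qed
  qed
  from this[of 1 1] this[of 1 "-1"] this[of "-1" 1] this[of "-1" "-1"]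
  show "{G True True, G True False, G False True, G False False} \<subseteq> colours_at C f (Complex u v)"
    by simp
qed

lemma colours_at_crossing:
  assumes e: "e > 0" and det: "a * d - b * c \<noteq> 0"
    and C: "\<And>x y. \<bar>x - u\<bar> < e \<Longrightarrow> \<bar>y - v\<bar> < e \<Longrightarrow>
       Complex x y \<in> C \<longleftrightarrow> a * (x - u) + b * (y - v) = 0 \<or> c * (x - u) + d * (y - v) = 0"
    and f: "\<And>x y. \<bar>x - u\<bar> < e \<Longrightarrow> \<bar>y - v\<bar> < e \<Longrightarrow>
       a * (x - u) + b * (y - v) > 0 \<Longrightarrow> c * (x - u) + d * (y - v) > 0 \<Longrightarrow> f (Complex x y) = c1"
      "\<And>x y. \<bar>x - u\<bar> < e \<Longrightarrow> \<bar>y - v\<bar> < e \<Longrightarrow>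
       a * (x - u) + b * (y - v) > 0 \<Longrightarrow> c * (x - u) + d * (y - v) < 0 \<Longrightarrow> f (Complex x y) = c2"
      "\<And>x y. \<bar>x - u\<bar> < e \<Longrightarrow> \<bar>y - v\<bar> < e \<Longrightarrow>
       a * (x - u) + b * (y - v) < 0 \<Longrightarrow> c * (x - u) + d * (y - v) > 0 \<Longrightarrow> f (Complex x y) = c3"
      "\<And>x y. \<bar>x - u\<bar> < e \<Longrightarrow> \<bar>y - v\<bar> < e \<Longrightarrow>
       a * (x - u) + b * (y - v) < 0 \<Longrightarrow> c * (x - u) + d * (y - v) < 0 \<Longrightarrow> f (Complex x y) = c4"
  shows "colours_at C f (Complex u v) = {c1, c2, c3, c4}"
proof -
  let ?G = "\<lambda>s t. if s then (if t then c1 else c2) else (if t then c3 else c4)"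
  have "colours_at C f (Complex u v) = {?G True True, ?G True False, ?G False True, ?G False False}"
  proof (rule colours_at_crossing_signs[OF e det C, where G = ?G])
    fix x y assume xy: "\<bar>x - u\<bar> < e" "\<bar>y - v\<bar> < e"
      and "a * (x - u) + b * (y - v) \<noteq> 0" "c * (x - u) + d * (y - v) \<noteq> 0"
    then consider "a * (x - u) + b * (y - v) > 0" "c * (x - u) + d * (y - v) > 0"
      | "a * (x - u) + b * (y - v) > 0" "c * (x - u) + d * (y - v) < 0"
      | "a * (x - u) + b * (y - v) < 0" "c * (x - u) + d * (y - v) > 0"
      | "a * (x - u) + b * (y - v) < 0" "c * (x - u) + d * (y - v) < 0" by linarith
    then show "f (Complex x y) = ?G (a * (x - u) + b * (y - v) > 0) (c * (x - u) + d * (y - v) > 0)"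
      by cases (simp_all add: f[OF xy])
  qed
  then show ?thesis by simp
qed

text \<open>
  When the marker near \<open>v\<close> lies in a single shading \<open>w\<close>, the closure condition in \<open>rainbow\<close> is just
  \<open>w\<close>.
\<close>

lemma marker_weight:
  assumes "open N" "v \<in> N" "v \<in> closure (M - C)" "\<And>z. z \<in> N \<Longrightarrow> z \<in> M - C \<Longrightarrow> fst (f z) = w"
  shows "v \<notin> closure {z \<in> M - C. \<not> fst (f z)} \<longleftrightarrow> w"
proof (cases w)
  case True
  have "v \<notin> closure {z \<in> M - C. \<not> fst (f z)}"
  proof
    assume "v \<in> closure {z \<in> M - C. \<not> fst (f z)}"
    then have "v \<in> closure (N \<inter> {z \<in> M - C. \<not> fst (f z)})" using closure_Int_open assms(1,2) by blast
    then have "N \<inter> {z \<in> M - C. \<not> fst (f z)} \<noteq> {}" by auto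
    then show False using assms(4) True by blast
  qed
  then show ?thesis using True by simp
next
  case False
  have "v \<in> closure (N \<inter> (M - C))" using closure_Int_open assms(1-3) by blast
  moreover have "N \<inter> (M - C) \<subseteq> {z \<in> M - C. \<not> fst (f z)}" using assms(4) False by blast
  ultimately have "v \<in> closure {z \<in> M - C. \<not> fst (f z)}"
    using closure_mono[of "N \<inter> (M - C)" "{z \<in> M - C. \<not> fst (f z)}"] by (simp add: subset_iff)
  then show ?thesis using False by simp
qed

section \<open>Monochromatic regions\<close>

text \<open>
  This is how connectedness of regions enters: the set between two graphs over an interval is the
  image of an open rectangle, hence connected, hence monochromatic if it misses the curve.  All
  regions below are unions of a few such sets.
\<close>

lemma constant_between_xgraphs:
  assumes f: "locally_constant_off C f"
    and l: "continuous_on {a<..<b} l" and u: "continuous_on {a<..<b} u"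
    and lu: "\<And>y. a < y \<Longrightarrow> y < b \<Longrightarrow> l y < u y"
    and C: "\<And>x y. a < y \<Longrightarrow> y < b \<Longrightarrow> l y < x \<Longrightarrow> x < u y \<Longrightarrow> Complex x y \<notin> C"
  shows "\<exists>c. \<forall>x y. a < y \<longrightarrow> y < b \<longrightarrow> l y < x \<longrightarrow> x < u y \<longrightarrow> f (Complex x y) = c"
proof -
  let ?h = "\<lambda>(y, t). Complex ((1 - t) * l y + t * u y) y"
  let ?S = "?h ` ({a<..<b} \<times> {0<..<1})"
  have "continuous_on ({a<..<b} \<times> {0<..<1::real}) (\<lambda>p. l (fst p))"
    "continuous_on ({a<..<b} \<times> {0<..<1::real}) (\<lambda>p. u (fst p))"
    by (auto intro!: continuous_on_compose2[OF l] continuous_on_compose2[OF u] continuous_intros)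
  then have "continuous_on ({a<..<b} \<times> {0<..<1}) ?h"
    unfolding case_prod_unfold Complex_eq by (intro continuous_intros)
  then have conn: "connected ?S"
    by (rule connected_continuous_image) (intro connected_Times connected_Ioo)
  have S: "Complex x y \<in> ?S" if "a < y" "y < b" "l y < x" "x < u y" for x y
  proof (rule image_eqI[of _ _ "(y, (x - l y) / (u y - l y))"])
    have "(1 - r) * l y + r * u y = l y + r * (u y - l y)" for r
      by (simp add: algebra_simps)
    then have "(1 - (x - l y) / (u y - l y)) * l y + (x - l y) / (u y - l y) * u y =
        l y + (x - l y) / (u y - l y) * (u y - l y)"
      by blast
    also have "\<dots> = x" using that by simp
    finally have "(1 - (x - l y) / (u y - l y)) * l y + (x - l y) / (u y - l y) * u y = x" .
    then show "Complex x y = ?h (y, (x - l y) / (u y - l y))" by simp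
    show "(y, (x - l y) / (u y - l y)) \<in> {a<..<b} \<times> {0<..<1}"
      using that by (auto simp: field_simps)
  qed
  have "?S \<inter> C = {}"
  proof -
    have "l y < (1 - t) * l y + t * u y \<and> (1 - t) * l y + t * u y < u y"
      if "a < y" "y < b" "0 < t" "t < 1" for y t
    proof -
      have "t * (u y - l y) > 0" "(1 - t) * (u y - l y) > 0" using lu[OF that(1,2)] that by auto
      then show ?thesis by (simp add: algebra_simps)
    qed
    then show ?thesis using C by auto
  qed
  then have "f z = f w" if "z \<in> ?S" "w \<in> ?S" for z w
    using constant_on_connected[OF f conn] that by blast
  then have "\<exists>c. \<forall>z\<in>?S. f z = c" by blast
  then obtain c where "\<forall>z\<in>?S. f z = c" ..
  then show ?thesis using S by (intro exI[of _ c]) blast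
qed

lemma constant_between_ygraphs:
  assumes f: "locally_constant_off C f"
    and l: "continuous_on {a<..<b} l" and u: "continuous_on {a<..<b} u"
    and lu: "\<And>x. a < x \<Longrightarrow> x < b \<Longrightarrow> l x < u x"
    and C: "\<And>x y. a < x \<Longrightarrow> x < b \<Longrightarrow> l x < y \<Longrightarrow> y < u x \<Longrightarrow> Complex x y \<notin> C"
  shows "\<exists>c. \<forall>x y. a < x \<longrightarrow> x < b \<longrightarrow> l x < y \<longrightarrow> y < u x \<longrightarrow> f (Complex x y) = c"
proof -
  let ?g = "\<lambda>z. Complex (Im z) (Re z)"
  have "continuous_on UNIV ?g" unfolding Complex_eq by (intro continuous_intros)
  from constant_between_xgraphs[OF locally_constant_compose[OF f this] l u lu] C
  obtain c where "\<forall>x y. a < y \<longrightarrow> y < b \<longrightarrow> l y < x \<longrightarrow> x < u y \<longrightarrow> f (Complex y x) = c"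
    by auto
  then show ?thesis by blast
qed

section \<open>The pictures in coordinates\<close>

text \<open>
  Segments as linear conditions on coordinates, so that linear arithmetic can decide membership in
  the polygonal pictures.
\<close>

lemma closed_segment_Complex:
  "Complex x y \<in> closed_segment (Complex a b) (Complex c d) \<longleftrightarrow>
     (x - a) * (d - b) = (y - b) * (c - a) \<and>
     min a c \<le> x \<and> x \<le> max a c \<and> min b d \<le> y \<and> y \<le> max b d" (is "?L \<longleftrightarrow> ?R")
proof -
  have L: "?L \<longleftrightarrow> (\<exists>t. 0 \<le> t \<and> t \<le> 1 \<and> x = a + t * (c - a) \<and> y = b + t * (d - b))"
    by (auto simp: in_segment complex_eq_iff algebra_simps)
  show ?thesis
  proof
    have "min p q \<le> p + t * (q - p) \<and> p + t * (q - p) \<le> max p q" if "0 \<le> t" "t \<le> 1" for p q t :: real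
    proof (cases "p \<le> q")
      case True
      then have "0 \<le> t * (q - p)" "t * (q - p) \<le> 1 * (q - p)"
        using that mult_right_mono[of t 1 "q - p"] by auto
      then show ?thesis using True by simp
    next
      case False
      then have "0 \<le> t * (p - q)" "t * (p - q) \<le> 1 * (p - q)"
        using that mult_right_mono[of t 1 "p - q"] by auto
      then show ?thesis using False by (simp add: algebra_simps)
    qed
    then show ?R if ?L using that unfolding L by force
  next
    assume R: ?R
    show ?L
    proof (cases "a = c")
      case False
      then have "y = b + (x - a) / (c - a) * (d - b)"
        using R by (simp add: field_simps)
      moreover have "0 \<le> (x - a) / (c - a)" "(x - a) / (c - a) \<le> 1"
        using R False by (auto simp: divide_simps min_def max_def split: if_splits)
      ultimately show ?thesis unfolding L using False by (intro exI[of _ "(x - a) / (c - a)"]) simp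
    next
      case True
      then have "x = a" using R by simp
      show ?thesis
      proof (cases "b = d")
        case False
        then have "0 \<le> (y - b) / (d - b)" "(y - b) / (d - b) \<le> 1"
          using R by (auto simp: divide_simps min_def max_def split: if_splits)
        then show ?thesis unfolding L using False True \<open>x = a\<close>
          by (intro exI[of _ "(y - b) / (d - b)"]) simp
      next
        case eq: True
        then have "y = b" using R by simp
        then show ?thesis unfolding L using True eq \<open>x = a\<close> by (intro exI[of _ 0]) simp
      qed
    qed
  qed
qed

lemma disk_Complex: "Complex x y \<in> disk \<longleftrightarrow> \<bar>x\<bar> \<le> 8 \<and> \<bar>y\<bar> \<le> 8"
  by (auto simp: disk_def in_cbox_complex_iff)

text \<open>
  The pictures of the moves consist of graphs of piecewise linear functions of one coordinate.  Most
  strands are diagonal in the middle of the disk and vertical near its top and bottom: their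
  abscissa is, up to sign and translation, the ordinate clamped to an interval.
\<close>

definition clamp_to :: "real \<Rightarrow> real \<Rightarrow> real" where
  "clamp_to m t = max (- m) (min m t)"

lemma continuous_on_clamp [continuous_intros]:
  "continuous_on A f \<Longrightarrow> continuous_on A (\<lambda>z. clamp_to m (f z))"
  unfolding clamp_to_def by (intro continuous_intros)

text \<open>
  The kink consists of two walls that touch at the crossing: one around the region on the left, one
  around the loop on the right.  The two functions that define them also separate the regions.
\<close>

lemma kink_Complex:
  "Complex x y \<in> kink \<longleftrightarrow> \<bar>x\<bar> \<le> 8 \<and> \<bar>y\<bar> \<le> 8 \<and>
     (max (\<bar>y\<bar> - 4) (\<bar>y\<bar> + x) = 0 \<or> max (\<bar>y\<bar> - x) (x - 4) = 0)"
  by (simp add: kink_def drawn_def closed_segment_Complex) argo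

lemma simple_arc_Complex:
  "Complex x y \<in> curve simple_arc \<longleftrightarrow> \<bar>x\<bar> \<le> 8 \<and> \<bar>y\<bar> \<le> 8 \<and> max (\<bar>y\<bar> - 4) (x + 4) = 0"
  by (simp add: simple_arc_def drawn_def closed_segment_Complex) argo

lemma left_\<Omega>2_Complex:
  "Complex x y \<in> curve (left_side \<Omega>2) \<longleftrightarrow> \<bar>x\<bar> \<le> 8 \<and> \<bar>y\<bar> \<le> 8 \<and> \<bar>x\<bar> = \<bar>2 - min \<bar>y\<bar> 6\<bar>"
  by (simp add: drawn_def closed_segment_Complex) argo

lemma right_\<Omega>2_Complex:
  "Complex x y \<in> curve (right_side \<Omega>2) \<longleftrightarrow> \<bar>x\<bar> \<le> 8 \<and> \<bar>y\<bar> \<le> 8 \<and> \<bar>x\<bar> = 4"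
  by (simp add: drawn_def closed_segment_Complex) argo

lemma curve_\<Omega>5_Complex:
  "Complex x y \<in> curve_\<Omega>5 \<longleftrightarrow> \<bar>x\<bar> \<le> 8 \<and> \<bar>y\<bar> \<le> 8 \<and> \<bar>y\<bar> = \<bar>3 - min \<bar>x\<bar> 6\<bar>"
  by (simp add: curve_\<Omega>5_def drawn_def closed_segment_Complex) argo

lemma strand_SW_NE_Complex:
  "Complex x y \<in> strand_SW_NE \<longleftrightarrow> \<bar>y\<bar> \<le> 8 \<and> x = clamp_to 6 y"
  by (simp add: strand_SW_NE_def clamp_to_def drawn_def closed_segment_Complex) argo

lemma strand_NW_SE_Complex:
  "Complex x y \<in> strand_NW_SE \<longleftrightarrow> \<bar>y\<bar> \<le> 8 \<and> x = - clamp_to 6 y"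
  by (simp add: strand_NW_SE_def clamp_to_def drawn_def closed_segment_Complex) argo

text \<open>
  The graph of \<open>bump\<close> is the strand \<open>H\<close> in its upper position.
\<close>

definition bump :: "real \<Rightarrow> real" where
  "bump x = min 3 (max 0 (3/2 * (7 - \<bar>x\<bar>)))"

lemma continuous_on_bump [continuous_intros]:
  "continuous_on A f \<Longrightarrow> continuous_on A (\<lambda>z. bump (f z))"
  unfolding bump_def by (intro continuous_intros)

lemma strand_H_below_Complex:
  "Complex x y \<in> strand_H_below \<longleftrightarrow> \<bar>x\<bar> \<le> 8 \<and> y = - bump x"
  by (simp add: strand_H_below_def bump_def drawn_def closed_segment_Complex) argo

lemma strand_H_above_Complex:
  "Complex x y \<in> strand_H_above \<longleftrightarrow> \<bar>x\<bar> \<le> 8 \<and> y = bump x"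
  by (simp add: strand_H_above_def bump_def drawn_def closed_segment_Complex) argo

lemma left_\<Omega>7_Complex:
  "Complex x y \<in> curve (left_side \<Omega>7) \<longleftrightarrow> \<bar>y\<bar> \<le> 8 \<and>
     (x = clamp_to 4 y \<or> x = - 2 - clamp_to 2 (y + 2) \<or> x = 2 - clamp_to 2 (y - 2))"
  by (simp add: clamp_to_def drawn_def closed_segment_Complex) argo

lemma set_eq_Complex: "(\<And>x y. Complex x y \<in> A \<longleftrightarrow> Complex x y \<in> B) \<Longrightarrow> A = B"
  by (metis complex.collapse set_eqI)

lemma tick_Complex:
  "tick (Complex a b) (u, v) =
     closed_segment (Complex (u - a / 2) (v - b / 2)) (Complex (u + a / 2) (v + b / 2))"
proof -
  have "Complex a b / 2 = Complex (a / 2) (b / 2)" by (simp add: complex_eq_iff)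
  then show ?thesis
    unfolding tick_def case_prod_conv by (intro arg_cong2[of _ _ _ _ closed_segment]) (simp_all add: complex_eq_iff)
qed

lemma tick_i: "Complex x y \<in> tick \<i> (u, v) \<longleftrightarrow> x = u \<and> \<bar>y - v\<bar> \<le> 1/2"
proof -
  have "tick \<i> (u, v) = tick (Complex 0 1) (u, v)" by (simp add: i_complex_of_real[symmetric] complex_eq_iff Complex_eq)
  then show ?thesis by (simp add: tick_Complex closed_segment_Complex) argo
qed

lemma tick_1: "Complex x y \<in> tick 1 (u, v) \<longleftrightarrow> y = v \<and> \<bar>x - u\<bar> \<le> 1/2"
proof -
  have "tick 1 (u, v) = tick (Complex 1 0) (u, v)" by (simp add: one_complex.code)
  then show ?thesis by (simp add: tick_Complex closed_segment_Complex) argo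
qed

section \<open>Recolouring inside a disk\<close>

text \<open>
  The two sides of a move agree outside the core, so a colouring of one side, restricted to the
  collar between core and boundary of the disk, has to be continued over the other side.
\<close>

definition disk_interior :: "complex set" where
  "disk_interior = {z. \<bar>Re z\<bar> < 8 \<and> \<bar>Im z\<bar> < 8}"

definition disk_core :: "complex set" where
  "disk_core = {z. \<bar>Re z\<bar> \<le> 7 \<and> \<bar>Im z\<bar> \<le> 7}"

lemma disk_interior_Complex [simp]: "Complex x y \<in> disk_interior \<longleftrightarrow> \<bar>x\<bar> < 8 \<and> \<bar>y\<bar> < 8"
  by (simp add: disk_interior_def)

lemma disk_core_Complex [simp]: "Complex x y \<in> disk_core \<longleftrightarrow> \<bar>x\<bar> \<le> 7 \<and> \<bar>y\<bar> \<le> 7"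
  by (simp add: disk_core_def)

lemma open_disk_interior: "open disk_interior"
  unfolding disk_interior_def by (intro open_Collect_conj open_Collect_less continuous_intros)

lemma disk_core_subset_interior: "disk_core \<subseteq> disk_interior" and disk_interior_subset_disk: "disk_interior \<subseteq> disk"
  by (auto simp: disk_core_def disk_interior_def disk_def in_cbox_complex_iff)

lemma compact_disk_core: "compact disk_core"
proof -
  have "disk_core = cbox (Complex (-7) (-7)) (Complex 7 7)"
    by (auto simp: disk_core_def in_cbox_complex_iff)
  then show ?thesis using compact_cbox[of "Complex (-7) (-7)" "Complex 7 7"] by (simp only:)
qed

text \<open>
  Odd colourability passes from every diagram with the first picture in the disk to the diagram in
  which the second picture replaces it.
\<close>

definition transfers :: "complex set \<Rightarrow> complex set \<Rightarrow> complex set \<Rightarrow> complex set \<Rightarrow> bool" where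
  "transfers C1 M1 C2 M2 \<longleftrightarrow> (\<forall>C M C' M'.
     C \<inter> disk = C1 \<longrightarrow> M \<inter> disk = M1 \<longrightarrow> C' \<inter> disk = C2 \<longrightarrow> M' \<inter> disk = M2 \<longrightarrow>
     C - disk = C' - disk \<longrightarrow> M - disk = M' - disk \<longrightarrow> odd_colourable C M \<longrightarrow> odd_colourable C' M')"

lemma transfersD:
  assumes "transfers C1 M1 C2 M2" "C \<inter> disk = C1" "M \<inter> disk = M1" "C' \<inter> disk = C2" "M' \<inter> disk = M2"
    "C - disk = C' - disk" "M - disk = M' - disk" "odd_colourable C M"
  shows "odd_colourable C' M'"
  using assms unfolding transfers_def by blast

text \<open>
  The part of \<open>region_colouring\<close> that can be seen inside the disk.  Adding the complement of the open
  disk to the curve restricts local constancy to the inside.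
\<close>

definition disk_colouring :: "complex set \<Rightarrow> complex set \<Rightarrow> (complex \<Rightarrow> bool \<times> bool) \<Rightarrow> bool" where
  "disk_colouring C M f \<longleftrightarrow> locally_constant_off (C \<union> - disk_interior) f \<and>
     (\<forall>p\<in>C \<inter> disk_interior. fst ` colours_at C f p = UNIV) \<and>
     (\<forall>p\<in>C \<inter> disk_interior - M. card (colours_at C f p) \<noteq> 3)"

text \<open>
  The colouring \<open>g\<close> of the second picture continues the colouring \<open>f\<close> of the first one from the
  collar, with the same parity of rainbow vertices.
\<close>

definition recolours ::
  "complex set \<Rightarrow> complex set \<Rightarrow> (complex \<Rightarrow> bool \<times> bool) \<Rightarrow>
   complex set \<Rightarrow> complex set \<Rightarrow> (complex \<Rightarrow> bool \<times> bool) \<Rightarrow> bool" where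
  "recolours C1 M1 f C2 M2 g \<longleftrightarrow>
     (\<forall>x y. \<bar>x\<bar> < 8 \<longrightarrow> \<bar>y\<bar> < 8 \<longrightarrow> \<not> (\<bar>x\<bar> \<le> 7 \<and> \<bar>y\<bar> \<le> 7) \<longrightarrow> Complex x y \<notin> C2 \<longrightarrow>
        g (Complex x y) = f (Complex x y)) \<and>
     disk_colouring C2 M2 g \<and> finite (rainbow C2 M2 g) \<and>
     (odd (card (rainbow C1 M1 f)) \<longleftrightarrow> odd (card (rainbow C2 M2 g)))"

text \<open>
  Gluing: outside the core, keep the given colouring, and inside it use \<open>g\<close>.  On the collar the two
  agree, so every point has a neighbourhood on which the new colouring is one of the two, and
  \<open>odd_colourable_replace\<close> applies with the core as compact set.
\<close>

lemma transfersI: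
  assumes CK: "\<And>x y. \<not> (\<bar>x\<bar> \<le> 7 \<and> \<bar>y\<bar> \<le> 7) \<Longrightarrow> Complex x y \<in> C1 \<longleftrightarrow> Complex x y \<in> C2"
    and marks: "\<And>x y. Complex x y \<in> M1 \<union> M2 \<Longrightarrow> \<bar>x\<bar> \<le> 7 \<and> \<bar>y\<bar> \<le> 7"
    and step: "\<And>f. disk_colouring C1 M1 f \<Longrightarrow> \<exists>g. recolours C1 M1 f C2 M2 g"
  shows "transfers C1 M1 C2 M2"
  unfolding transfers_def
proof (intro allI impI)
  have "z \<in> disk_core" if "z \<in> M1 \<union> M2" for z
    using that marks[of "Re z" "Im z"] by (simp add: disk_core_def)
  then have MK: "M1 \<subseteq> disk_core" "M2 \<subseteq> disk_core" by blast+
  fix C M C' M'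
  assume C: "C \<inter> disk = C1" "C' \<inter> disk = C2" "C - disk = C' - disk"
    and M: "M \<inter> disk = M1" "M' \<inter> disk = M2" "M - disk = M' - disk"
    and "odd_colourable C M"
  then obtain f where f: "region_colouring C M f" "finite (rainbow C M f)" "odd (card (rainbow C M f))"
    by (auto simp: odd_colourable_def)
  have CK': "z \<in> C \<longleftrightarrow> z \<in> C'" if "z \<notin> disk_core" for z
  proof (cases "z \<in> disk")
    case True
    then have "z \<in> C \<longleftrightarrow> z \<in> C1" "z \<in> C' \<longleftrightarrow> z \<in> C2" by (simp_all add: C(1,2)[symmetric])
    then show ?thesis using that CK[of "Re z" "Im z"] by (simp add: disk_core_def)
  next
    case False
    then show ?thesis using set_eq_iff[THEN iffD1, OF C(3), THEN spec, of z] by simp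
  qed
  have MK': "z \<in> M \<longleftrightarrow> z \<in> M'" if "z \<notin> disk_core" for z
  proof (cases "z \<in> disk")
    case True
    then have "z \<in> M \<longleftrightarrow> z \<in> M1" "z \<in> M' \<longleftrightarrow> z \<in> M2" by (simp_all add: M(1,2)[symmetric])
    then show ?thesis using that MK by blast
  next
    case False
    then show ?thesis using set_eq_iff[THEN iffD1, OF M(3), THEN spec, of z] by simp
  qed
  have CW: "z \<in> C \<longleftrightarrow> z \<in> C1" "z \<in> C' \<longleftrightarrow> z \<in> C2" "z \<in> M \<longleftrightarrow> z \<in> M1" "z \<in> M' \<longleftrightarrow> z \<in> M2"
    if "z \<in> disk_interior" for z
    using subsetD[OF disk_interior_subset_disk that] by (simp_all add: C(1,2)[symmetric] M(1,2)[symmetric])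
  have colL: "colours_at C f p = colours_at C1 f p" if "p \<in> disk_interior" for p
    by (rule colours_at_local[OF open_disk_interior that]) (use CW in blast)+
  have lc: "locally_constant_off (C1 \<union> - disk_interior) f"
    unfolding locally_constant_off_def
  proof (intro allI impI)
    fix z assume z: "z \<notin> C1 \<union> - disk_interior"
    then have "\<forall>\<^sub>F w in nhds z. w \<notin> C \<longrightarrow> f w = f z"
      using f(1) CW by (simp add: region_colouring_def locally_constant_off_def)
    then show "\<forall>\<^sub>F w in nhds z. w \<notin> C1 \<union> - disk_interior \<longrightarrow> f w = f z"
    proof (rule eventually_mono)
      fix w assume "w \<notin> C \<longrightarrow> f w = f z"
      then show "w \<notin> C1 \<union> - disk_interior \<longrightarrow> f w = f z" using CW[of w] by simp
    qed
  qed
  have "disk_colouring C1 M1 f"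
    unfolding disk_colouring_def
  proof (intro conjI ballI lc)
    show "fst ` colours_at C1 f p = UNIV" if "p \<in> C1 \<inter> disk_interior" for p
      using f(1) that CW[of p] colL[of p, symmetric] by (simp add: region_colouring_def)
    show "card (colours_at C1 f p) \<noteq> 3" if "p \<in> C1 \<inter> disk_interior - M1" for p
      using f(1) that CW[of p] colL[of p, symmetric] by (simp add: region_colouring_def)
  qed
  then obtain g where "recolours C1 M1 f C2 M2 g" using step by blast
  then have g: "\<And>x y. \<bar>x\<bar> < 8 \<Longrightarrow> \<bar>y\<bar> < 8 \<Longrightarrow> \<not> (\<bar>x\<bar> \<le> 7 \<and> \<bar>y\<bar> \<le> 7) \<Longrightarrow> Complex x y \<notin> C2 \<Longrightarrow>
              g (Complex x y) = f (Complex x y)"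
    "locally_constant_off (C2 \<union> - disk_interior) g"
    "\<And>p. p \<in> C2 \<Longrightarrow> p \<in> disk_interior \<Longrightarrow> fst ` colours_at C2 g p = UNIV"
    "\<And>p. p \<in> C2 \<Longrightarrow> p \<in> disk_interior \<Longrightarrow> p \<notin> M2 \<Longrightarrow> card (colours_at C2 g p) \<noteq> 3"
    "finite (rainbow C2 M2 g)"
    "odd (card (rainbow C1 M1 f)) \<longleftrightarrow> odd (card (rainbow C2 M2 g))"
    by (simp_all add: recolours_def disk_colouring_def)
  define f' where "f' z = (if z \<in> disk_core then g z else f z)" for z
  have f'g: "f' z = g z" if "z \<in> disk_interior" "z \<notin> C2" for z
    using g(1)[of "Re z" "Im z"] that by (auto simp: f'_def disk_core_def disk_interior_def)
  have colR: "colours_at C' f' p = colours_at C2 g p" if "p \<in> disk_interior" for p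
  proof (rule colours_at_local[OF open_disk_interior that])
    show "C' \<inter> disk_interior = C2 \<inter> disk_interior" using CW by blast
    show "f' z = g z" if "z \<in> disk_interior" "z \<notin> C'" for z using f'g CW that by simp
  qed
  have rb: "rainbow C M f \<inter> disk_core = rainbow C1 M1 f" 
    and rb': "rainbow C' M' f' \<inter> disk_core = rainbow C2 M2 g"
  proof -
    have "v \<in> closure {z \<in> M - C. \<not> fst (f z)} \<longleftrightarrow> v \<in> closure {z \<in> M1 - C1. \<not> fst (f z)}"
      "v \<in> closure {z \<in> M' - C'. \<not> fst (f' z)} \<longleftrightarrow> v \<in> closure {z \<in> M2 - C2. \<not> fst (g z)}"
      if "v \<in> disk_interior" for v
    proof (rule_tac [!] closure_local[OF open_disk_interior that])
      show "{z \<in> M - C. \<not> fst (f z)} \<inter> disk_interior = {z \<in> M1 - C1. \<not> fst (f z)} \<inter> disk_interior"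
        using CW by blast
      have "z \<in> {z \<in> M' - C'. \<not> fst (f' z)} \<inter> disk_interior \<longleftrightarrow> z \<in> {z \<in> M2 - C2. \<not> fst (g z)} \<inter> disk_interior" for z
        using CW[of z] f'g[of z] by (cases "z \<in> disk_interior") auto
      then show "{z \<in> M' - C'. \<not> fst (f' z)} \<inter> disk_interior = {z \<in> M2 - C2. \<not> fst (g z)} \<inter> disk_interior"
        by blast
    qed
    then have *: "v \<in> rainbow C M f \<longleftrightarrow> v \<in> rainbow C1 M1 f"
      "v \<in> rainbow C' M' f' \<longleftrightarrow> v \<in> rainbow C2 M2 g" if "v \<in> disk_interior" for v
      using that CW colL colR by (auto simp: rainbow_def)
    have "rainbow C1 M1 f \<subseteq> disk_core" "rainbow C2 M2 g \<subseteq> disk_core" using MK by (auto simp: rainbow_def)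
    then show "rainbow C M f \<inter> disk_core = rainbow C1 M1 f" "rainbow C' M' f' \<inter> disk_core = rainbow C2 M2 g"
      using * disk_core_subset_interior by blast+
  qed
  show "odd_colourable C' M'"
  proof (rule odd_colourable_replace[OF compact_disk_core _ _ f])
    show "C - disk_core = C' - disk_core" "M - disk_core = M' - disk_core" using CK' MK' by blast+
    show "f' z = f z" if "z \<notin> disk_core" for z using that by (simp add: f'_def)
    show "\<forall>\<^sub>F w in nhds z. w \<notin> C' \<longrightarrow> f' w = f' z" if "z \<in> disk_core" "z \<notin> C'" for z
    proof -
      have z: "z \<in> disk_interior" "z \<notin> C2" using that disk_core_subset_interior CW by auto
      then have "\<forall>\<^sub>F w in nhds z. w \<notin> C2 \<union> - disk_interior \<longrightarrow> g w = g z"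
        using g(2) by (simp add: locally_constant_off_def)
      moreover have "\<forall>\<^sub>F w in nhds z. w \<in> disk_interior"
        by (rule eventually_nhds_in_open[OF open_disk_interior z(1)])
      ultimately show ?thesis
      proof eventually_elim
        case (elim w)
        then show ?case using CW[of w] f'g[of w] f'g[OF z] by simp
      qed
    qed
    show "fst ` colours_at C' f' p = UNIV" if "p \<in> disk_core" "p \<in> C'" for p
    proof -
      have "p \<in> disk_interior" using that disk_core_subset_interior by blast
      then show ?thesis using that CW colR g(3) by simp
    qed
    show "card (colours_at C' f' p) \<noteq> 3" if "p \<in> disk_core" "p \<in> C'" "p \<notin> M'" for p
    proof -
      have "p \<in> disk_interior" using that disk_core_subset_interior by blast
      then show ?thesis using that CW colR g(4) by simp
    qed
    show "finite (rainbow C' M' f' \<inter> disk_core)" using g(5) rb' by simp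
    show "odd (card (rainbow C M f \<inter> disk_core)) \<longleftrightarrow> odd (card (rainbow C' M' f' \<inter> disk_core))"
      using g(6) rb rb' by simp
  qed
qed

text \<open>
  A symmetry of the disk carries the transfer for one move to that for its mirror image.  It thereby
  yields the reverse direction of the moves whose sides are mirror images of each other.
\<close>

lemma transfers_homeo:
  assumes h: "homeomorphism UNIV UNIV g k" and disk: "g ` disk = disk" and t: "transfers C1 M1 C2 M2"
  shows "transfers (g ` C1) (g ` M1) (g ` C2) (g ` M2)"
  unfolding transfers_def
proof (intro allI impI)
  fix C M C' M'
  assume C: "C \<inter> disk = g ` C1" "C' \<inter> disk = g ` C2" "C - disk = C' - disk"
    and M: "M \<inter> disk = g ` M1" "M' \<inter> disk = g ` M2" "M - disk = M' - disk"
    and inv: "odd_colourable C M"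
  have gk: "\<And>x. g (k x) = x" "\<And>x. k (g x) = x" using h by (auto simp: homeomorphism_def)
  have injk: "inj k" using inj_on_inverseI[of UNIV g k] gk by simp
  have kd: "k ` disk = disk" using arg_cong[OF disk, of "\<lambda>A. k ` A"] by (simp add: image_image gk)
  have kg: "k ` g ` A = A" "g ` k ` A = A" for A by (simp_all add: image_image gk)
  have kI: "k ` A \<inter> disk = k ` (A \<inter> disk)" "k ` A - disk = k ` (A - disk)" for A
    using image_Int[OF injk, of A disk] image_set_diff[OF injk, of A disk] kd by simp_all
  have h': "homeomorphism UNIV UNIV k g" using h by (rule homeomorphism_symD)
  have "odd_colourable (k ` C') (k ` M')"
    by (rule transfersD[OF t _ _ _ _ _ _ odd_colourable_homeo[OF h' inv]])
      (simp_all add: kI C M kg)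
  from odd_colourable_homeo[OF h this] show "odd_colourable C' M'" by (simp add: kg)
qed

section \<open>Counting colours\<close>

lemma card_colours: "card (UNIV :: (bool \<times> bool) set) = 4"
  by (simp add: UNIV_bool UNIV_Times_UNIV[symmetric] del: UNIV_Times_UNIV)

lemma fst_image_UNIV:
  fixes c d :: "bool \<times> 'b"
  assumes "c \<in> A" "d \<in> A" "fst c \<noteq> fst d"
  shows "fst ` A = UNIV"
proof (rule UNIV_eq_I[symmetric])
  fix b
  have "fst c \<in> fst ` A" "fst d \<in> fst ` A" using assms(1,2) by (auto intro: imageI)
  then show "b \<in> fst ` A" using assms(3) by (cases b; cases "fst c"; simp)
qed

lemma fst_image_UNIV_D:
  fixes c d :: "bool \<times> 'b"
  assumes "A = {c, d}" "fst ` A = UNIV"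
  shows "fst c \<noteq> fst d"
proof -
  have "(\<not> fst c) \<in> fst ` A" by (simp only: assms(2) UNIV_I)
  then show ?thesis using assms(1) by auto
qed

lemma two_colours:
  fixes c d :: "bool \<times> bool"
  shows "card {c, d} \<noteq> 3" "{c, d} \<noteq> UNIV"
proof -
  have "card {c, d} \<le> 2" by (simp add: card_insert_if)
  moreover have "card (UNIV :: (bool \<times> bool) set) = 4" by (rule card_colours)
  ultimately show "card {c, d} \<noteq> 3" "{c, d} \<noteq> UNIV" by auto
qed

lemma three_colours:
  fixes a b c :: "bool \<times> bool"
  shows "{a, b, c} \<noteq> UNIV"
proof -
  have "card {a, b, c} \<le> 3" by (simp add: card_insert_if)
  moreover have "card (UNIV :: (bool \<times> bool) set) = 4" by (rule card_colours)
  ultimately show ?thesis by auto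
qed

text \<open>
  Here \<open>a\<close>, \<open>d\<close> and \<open>b\<close>, \<open>c\<close> are the colours of opposite sectors.  If both
  pairs agree in \<open>\<beta>\<close>, all edges or none are active; if both disagree, exactly one strand is active; and if
  a single pair disagrees, the active edges turn.
\<close>

lemma card_crossing_iff:
  fixes a b c d :: "bool \<times> bool"
  assumes "fst a = fst d" "fst b = fst c" "fst a \<noteq> fst b"
  shows "card {a, b, c, d} \<noteq> 3 \<longleftrightarrow> (snd a = snd d \<longleftrightarrow> snd b = snd c)"
  using assms by (cases a; cases b; cases c; cases d) (auto simp: card_insert_if)

lemma rainbow_crossing_iff:
  fixes a b c d :: "bool \<times> bool"
  assumes "fst a = fst d" "fst b = fst c" "fst a \<noteq> fst b"
  shows "{a, b, c, d} = UNIV \<longleftrightarrow> snd a \<noteq> snd d \<and> snd b \<noteq> snd c"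
proof -
  have "{a, b, c, d} = UNIV \<longleftrightarrow> card {a, b, c, d} = 4"
  proof -
    have "card (UNIV :: (bool \<times> bool) set) = 4" by (rule card_colours)
    then show ?thesis by (metis card_subset_eq finite subset_UNIV)
  qed
  also have "\<dots> \<longleftrightarrow> snd a \<noteq> snd d \<and> snd b \<noteq> snd c"
    using assms by (cases a; cases b; cases c; cases d) (auto simp: card_insert_if)
  finally show ?thesis .
qed

section \<open>Colourings given by the signs of functions\<close>

text \<open>
  The curves recoloured below are, inside the disk, zero sets of at most three continuous functions,
  and the colourings constructed for them depend only on the signs.  With fewer functions, the constant 1
  fills up the list.
\<close>

lemma locally_constant_signs:
  fixes \<phi> \<psi> \<theta> :: "complex \<Rightarrow> real"
  assumes cont: "continuous_on UNIV \<phi>" "continuous_on UNIV \<psi>" "continuous_on UNIV \<theta>"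
    and nz: "\<And>z. z \<notin> C \<Longrightarrow> \<phi> z \<noteq> 0 \<and> \<psi> z \<noteq> 0 \<and> \<theta> z \<noteq> 0"
    and g: "\<And>z. z \<notin> C \<Longrightarrow> g z = G (\<phi> z > 0) (\<psi> z > 0) (\<theta> z > 0)"
  shows "locally_constant_off C g"
  unfolding locally_constant_off_def
proof (intro allI impI)
  fix z assume z: "z \<notin> C"
  have sgn: "\<forall>\<^sub>F w in nhds z. (\<phi>' w > 0) = (\<phi>' z > 0)" if c: "continuous_on UNIV \<phi>'" and "\<phi>' z \<noteq> 0"
    for \<phi>' :: "complex \<Rightarrow> real"
  proof -
    have "open {w. \<phi>' w > 0}" "open {w. \<phi>' w < 0}"
      using c by (auto intro!: open_Collect_less continuous_intros)
    then consider "\<forall>\<^sub>F w in nhds z. w \<in> {w. \<phi>' w > 0}" "\<phi>' z > 0" | "\<forall>\<^sub>F w in nhds z. w \<in> {w. \<phi>' w < 0}" "\<phi>' z < 0"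
      using \<open>\<phi>' z \<noteq> 0\<close> eventually_nhds_in_open[of "{w. \<phi>' w > 0}" z] eventually_nhds_in_open[of "{w. \<phi>' w < 0}" z]
      by force
    then show ?thesis by cases (auto elim!: eventually_mono)
  qed
  from sgn[OF cont(1)] sgn[OF cont(2)] sgn[OF cont(3)] nz[OF z]
  have "\<forall>\<^sub>F w in nhds z. (\<phi> w > 0) = (\<phi> z > 0)" "\<forall>\<^sub>F w in nhds z. (\<psi> w > 0) = (\<psi> z > 0)"
    "\<forall>\<^sub>F w in nhds z. (\<theta> w > 0) = (\<theta> z > 0)" by blast+
  then show "\<forall>\<^sub>F w in nhds z. w \<notin> C \<longrightarrow> g w = g z"
    by eventually_elim (simp add: g z)
qed

text \<open>
  At a simple zero of \<open>\<phi>\<close> the other signs are constant, so the two colours differ in the first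
  argument of \<open>G\<close>.
\<close>

lemma colours_at_wall3:
  fixes \<phi> \<psi> \<theta> :: "complex \<Rightarrow> real"
  assumes cont: "continuous_on UNIV \<phi>" "continuous_on UNIV \<psi>" "continuous_on UNIV \<theta>"
    and C: "\<And>z. z \<in> disk_interior \<Longrightarrow> z \<in> C \<longleftrightarrow> \<phi> z = 0 \<or> \<psi> z = 0 \<or> \<theta> z = 0"
    and g: "\<And>z. z \<in> disk_interior \<Longrightarrow> z \<notin> C \<Longrightarrow> g z = G (\<phi> z > 0) (\<psi> z > 0) (\<theta> z > 0)"
    and p: "p \<in> disk_interior" "\<psi> p \<noteq> 0" "\<theta> p \<noteq> 0"
    and cl: "p \<in> closure {z. \<phi> z > 0}" "p \<in> closure {z. \<phi> z < 0}"
  shows "colours_at C g p = {G True (\<psi> p > 0) (\<theta> p > 0), G False (\<psi> p > 0) (\<theta> p > 0)}"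
proof -
  define N where "N = disk_interior \<inter> {z. \<psi> p * \<psi> z > 0} \<inter> {z. \<theta> p * \<theta> z > 0}"
  have N: "open N" "p \<in> N"
    unfolding N_def using cont p
    by (intro open_Int open_disk_interior open_Collect_less continuous_intros, simp_all)
      (simp add: zero_less_mult_iff, linarith)
  have sgn: "(\<psi> z > 0) = (\<psi> p > 0)" "(\<theta> z > 0) = (\<theta> p > 0)" "\<psi> z \<noteq> 0" "\<theta> z \<noteq> 0" "z \<in> disk_interior" if "z \<in> N" for z
    using that by (auto simp: N_def zero_less_mult_iff)
  show ?thesis
  proof (rule colours_at_wall[OF N _ _ cl, where G = "\<lambda>b. G b (\<psi> p > 0) (\<theta> p > 0)"])
    fix z assume z: "z \<in> N"
    show C': "z \<in> C \<longleftrightarrow> \<phi> z = 0" using C[OF sgn(5)[OF z]] sgn(3,4)[OF z] by blast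
    show "g z = G (\<phi> z > 0) (\<psi> p > 0) (\<theta> p > 0)" if "\<phi> z \<noteq> 0"
      using g[OF sgn(5)[OF z]] C' that sgn(1,2)[OF z] by simp
  qed
qed

lemma colours_at_off:
  assumes "locally_constant_off (C \<union> - disk_interior) f" "z \<in> disk_interior" "z \<notin> C"
  shows "colours_at C f z \<subseteq> {f z}"
proof -
  have "\<forall>\<^sub>F w in nhds z. w \<notin> C \<union> - disk_interior \<longrightarrow> f w = f z"
    using assms by (simp add: locally_constant_off_def)
  moreover have "\<forall>\<^sub>F w in nhds z. w \<in> disk_interior" by (rule eventually_nhds_in_open[OF open_disk_interior assms(2)])
  ultimately have "\<forall>\<^sub>F w in nhds z. w \<notin> C \<longrightarrow> f w = f z" by eventually_elim simp
  then obtain N where "open N" "z \<in> N" "\<And>w. w \<in> N \<Longrightarrow> w \<notin> C \<Longrightarrow> f w = f z"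
    unfolding eventually_nhds by blast
  then show ?thesis by (intro colours_at_subset[of N]) auto
qed

lemma off_not_rainbow:
  assumes "locally_constant_off (C \<union> - disk_interior) f" "z \<in> disk_interior" "z \<notin> C"
  shows "colours_at C f z \<noteq> UNIV"
  using colours_at_off[OF assms] two_colours(2)[of "f z" "f z"] by auto

lemma rainbow_mem:
  assumes "p \<in> M" "open N" "p \<in> N" "p \<in> closure (M - C)" "\<And>z. z \<in> N \<Longrightarrow> z \<in> M - C \<Longrightarrow> fst (f z) = w"
  shows "p \<in> rainbow C M f \<longleftrightarrow> colours_at C f p = UNIV \<and> w"
  using marker_weight[OF assms(2-5)] assms(1) by (simp add: rainbow_def)

lemma rainbow_subset:
  assumes "disk_colouring C M f" "M \<subseteq> disk_interior"
  shows "rainbow C M f \<subseteq> M \<inter> C"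
  using assms off_not_rainbow[of C f] unfolding rainbow_def disk_colouring_def by blast

section \<open>Adding or removing a kink\<close>

text \<open>
  The regions of the kink: the left one \<open>cL\<close>, the loop \<open>cP\<close>, and the rest \<open>cO\<close>, which occupies two
  opposite sectors of the crossing.
\<close>

definition kink_coloured :: "(complex \<Rightarrow> 'a) \<Rightarrow> 'a \<Rightarrow> 'a \<Rightarrow> 'a \<Rightarrow> bool" where
  "kink_coloured f cL cP cO \<longleftrightarrow> (\<forall>x y. \<bar>x\<bar> < 8 \<longrightarrow> \<bar>y\<bar> < 8 \<longrightarrow>
     (max (\<bar>y\<bar> - 4) (\<bar>y\<bar> + x) < 0 \<longrightarrow> f (Complex x y) = cL) \<and>
     (max (\<bar>y\<bar> - x) (x - 4) < 0 \<longrightarrow> f (Complex x y) = cP) \<and>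
     (max (\<bar>y\<bar> - 4) (\<bar>y\<bar> + x) > 0 \<and> max (\<bar>y\<bar> - x) (x - 4) > 0 \<longrightarrow> f (Complex x y) = cO))"

lemma kink_colouredD:
  assumes "kink_coloured f cL cP cO" "\<bar>x\<bar> < 8" "\<bar>y\<bar> < 8"
  shows "max (\<bar>y\<bar> - 4) (\<bar>y\<bar> + x) < 0 \<Longrightarrow> f (Complex x y) = cL"
    "max (\<bar>y\<bar> - x) (x - 4) < 0 \<Longrightarrow> f (Complex x y) = cP"
    "max (\<bar>y\<bar> - 4) (\<bar>y\<bar> + x) > 0 \<Longrightarrow> max (\<bar>y\<bar> - x) (x - 4) > 0 \<Longrightarrow> f (Complex x y) = cO"
  using assms unfolding kink_coloured_def by blast+

lemma kink_regions:
  assumes "locally_constant_off (kink \<union> - disk_interior) f"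
  obtains cL cP cO where "kink_coloured f cL cP cO"
proof -
  have "\<exists>c. \<forall>x y. -8 < x \<longrightarrow> x < 0 \<longrightarrow> max (-4) x < y \<longrightarrow> y < min 4 (-x) \<longrightarrow> f (Complex x y) = c"
    by (rule constant_between_ygraphs[OF assms]; (intro continuous_intros | simp add: kink_Complex; argo))
  then obtain cL where L: "\<And>x y. -8 < x \<Longrightarrow> x < 0 \<Longrightarrow> max (-4) x < y \<Longrightarrow> y < min 4 (-x) \<Longrightarrow> f (Complex x y) = cL"
    by blast
  have "\<exists>c. \<forall>x y. 0 < x \<longrightarrow> x < 4 \<longrightarrow> -x < y \<longrightarrow> y < x \<longrightarrow> f (Complex x y) = c"
    by (rule constant_between_ygraphs[OF assms]; (intro continuous_intros | simp add: kink_Complex; argo))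
  then obtain cP where P: "\<And>x y. 0 < x \<Longrightarrow> x < 4 \<Longrightarrow> -x < y \<Longrightarrow> y < x \<Longrightarrow> f (Complex x y) = cP"
    by blast
  have "\<exists>c. \<forall>x y. -8 < x \<longrightarrow> x < 8 \<longrightarrow> min 4 \<bar>x\<bar> < y \<longrightarrow> y < 8 \<longrightarrow> f (Complex x y) = c"
    by (rule constant_between_ygraphs[OF assms]; (intro continuous_intros | simp add: kink_Complex; argo))
  then obtain c1 where O1: "\<And>x y. -8 < x \<Longrightarrow> x < 8 \<Longrightarrow> min 4 \<bar>x\<bar> < y \<Longrightarrow> y < 8 \<Longrightarrow> f (Complex x y) = c1"
    by blast
  have "\<exists>c. \<forall>x y. -8 < x \<longrightarrow> x < 8 \<longrightarrow> -8 < y \<longrightarrow> y < - min 4 \<bar>x\<bar> \<longrightarrow> f (Complex x y) = c"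
    by (rule constant_between_ygraphs[OF assms]; (intro continuous_intros | simp add: kink_Complex; argo))
  then obtain c2 where O2: "\<And>x y. -8 < x \<Longrightarrow> x < 8 \<Longrightarrow> -8 < y \<Longrightarrow> y < - min 4 \<bar>x\<bar> \<Longrightarrow> f (Complex x y) = c2"
    by blast
  have "\<exists>c. \<forall>x y. 4 < x \<longrightarrow> x < 8 \<longrightarrow> -8 < y \<longrightarrow> y < 8 \<longrightarrow> f (Complex x y) = c"
    by (rule constant_between_ygraphs[OF assms]; (intro continuous_intros | simp add: kink_Complex; argo))
  then obtain c3 where O3: "\<And>x y. 4 < x \<Longrightarrow> x < 8 \<Longrightarrow> -8 < y \<Longrightarrow> y < 8 \<Longrightarrow> f (Complex x y) = c3"
    by blast
  have eq: "c2 = c1" "c3 = c1"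
    using O1[of 5 5] O2[of 5 "-5"] O3[of 5 5] O3[of 5 "-5"] by simp_all
  show ?thesis
  proof (rule that[of cL cP c1], unfold kink_coloured_def, intro allI impI conjI; (elim conjE)?)
    fix x y :: real assume xy: "\<bar>x\<bar> < 8" "\<bar>y\<bar> < 8"
    show "f (Complex x y) = cL" if "max (\<bar>y\<bar> - 4) (\<bar>y\<bar> + x) < 0" using L[of x y] xy that by argo
    show "f (Complex x y) = cP" if "max (\<bar>y\<bar> - x) (x - 4) < 0" using P[of x y] xy that by argo
    show "f (Complex x y) = c1" if "max (\<bar>y\<bar> - 4) (\<bar>y\<bar> + x) > 0" "max (\<bar>y\<bar> - x) (x - 4) > 0"
      using O1[of x y] O2[of x y] O3[of x y] xy that unfolding eq by argo
  qed
qed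

lemma kink_L_O:
  assumes col: "kink_coloured f cL cP cO"
  shows "colours_at kink f (Complex (-2) 2) = {cO, cL}"
proof (rule colours_at_edge[where a = 1 and b = 1 and e = 1])
  note F = kink_colouredD[OF col]
  fix x y :: real assume xy: "\<bar>x - (-2)\<bar> < 1" "\<bar>y - 2\<bar> < 1"
  show "Complex x y \<in> kink \<longleftrightarrow> 1 * (x - (-2)) + 1 * (y - 2) = 0"
    using xy unfolding kink_Complex by argo
  show "f (Complex x y) = cO" if "1 * (x - (-2)) + 1 * (y - 2) > 0"
    by (rule F(3); use xy that in argo)
  show "f (Complex x y) = cL" if "1 * (x - (-2)) + 1 * (y - 2) < 0"
    by (rule F(1); use xy that in argo)
qed simp_all

lemma kink_crossing:
  assumes col: "kink_coloured f cL cP cO"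
  shows "colours_at kink f (Complex 0 0) = {cO, cL, cP}"
proof -
  note F = kink_colouredD[OF col]
  have "colours_at kink f (Complex 0 0) = {cO, cL, cP, cO}"
  proof (rule colours_at_crossing[where a = "-1" and b = 1 and c = 1 and d = 1 and e = 1])
    fix x y :: real assume xy: "\<bar>x - 0\<bar> < 1" "\<bar>y - 0\<bar> < 1"
    show "Complex x y \<in> kink \<longleftrightarrow> -1 * (x - 0) + 1 * (y - 0) = 0 \<or> 1 * (x - 0) + 1 * (y - 0) = 0"
      using xy unfolding kink_Complex by argo
    show "f (Complex x y) = cO" if "-1 * (x - 0) + 1 * (y - 0) > 0" "1 * (x - 0) + 1 * (y - 0) > 0"
      by (rule F(3); use xy that in argo)
    show "f (Complex x y) = cL" if "-1 * (x - 0) + 1 * (y - 0) > 0" "1 * (x - 0) + 1 * (y - 0) < 0"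
      by (rule F(1); use xy that in argo)
    show "f (Complex x y) = cP" if "-1 * (x - 0) + 1 * (y - 0) < 0" "1 * (x - 0) + 1 * (y - 0) > 0"
      by (rule F(2); use xy that in argo)
    show "f (Complex x y) = cO" if "-1 * (x - 0) + 1 * (y - 0) < 0" "1 * (x - 0) + 1 * (y - 0) < 0"
      by (rule F(3); use xy that in argo)
  qed simp_all
  then show ?thesis by auto
qed

definition arc_coloured :: "(complex \<Rightarrow> 'a) \<Rightarrow> 'a \<Rightarrow> 'a \<Rightarrow> bool" where
  "arc_coloured f cL cO \<longleftrightarrow> (\<forall>x y. \<bar>x\<bar> < 8 \<longrightarrow> \<bar>y\<bar> < 8 \<longrightarrow>
     (max (\<bar>y\<bar> - 4) (x + 4) < 0 \<longrightarrow> f (Complex x y) = cL) \<and>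
     (max (\<bar>y\<bar> - 4) (x + 4) > 0 \<longrightarrow> f (Complex x y) = cO))"

lemma arc_colouredD:
  assumes "arc_coloured f cL cO" "\<bar>x\<bar> < 8" "\<bar>y\<bar> < 8"
  shows "max (\<bar>y\<bar> - 4) (x + 4) < 0 \<Longrightarrow> f (Complex x y) = cL"
    "max (\<bar>y\<bar> - 4) (x + 4) > 0 \<Longrightarrow> f (Complex x y) = cO"
  using assms unfolding arc_coloured_def by blast+

lemma simple_arc_regions:
  assumes "locally_constant_off (curve simple_arc \<union> - disk_interior) f"
  obtains cL cO where "arc_coloured f cL cO"
proof -
  have "\<exists>c. \<forall>x y. -8 < x \<longrightarrow> x < -4 \<longrightarrow> -4 < y \<longrightarrow> y < 4 \<longrightarrow> f (Complex x y) = c"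
    by (rule constant_between_ygraphs[OF assms]; (intro continuous_intros | simp add: simple_arc_Complex; argo))
  then obtain cL where L: "\<And>x y. -8 < x \<Longrightarrow> x < -4 \<Longrightarrow> -4 < y \<Longrightarrow> y < 4 \<Longrightarrow> f (Complex x y) = cL"
    by blast
  have "\<exists>c. \<forall>x y. -8 < x \<longrightarrow> x < 8 \<longrightarrow> 4 < y \<longrightarrow> y < 8 \<longrightarrow> f (Complex x y) = c"
    by (rule constant_between_ygraphs[OF assms]; (intro continuous_intros | simp add: simple_arc_Complex; argo))
  then obtain c1 where O1: "\<And>x y. -8 < x \<Longrightarrow> x < 8 \<Longrightarrow> 4 < y \<Longrightarrow> y < 8 \<Longrightarrow> f (Complex x y) = c1"
    by blast
  have "\<exists>c. \<forall>x y. -8 < x \<longrightarrow> x < 8 \<longrightarrow> -8 < y \<longrightarrow> y < -4 \<longrightarrow> f (Complex x y) = c"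
    by (rule constant_between_ygraphs[OF assms]; (intro continuous_intros | simp add: simple_arc_Complex; argo))
  then obtain c2 where O2: "\<And>x y. -8 < x \<Longrightarrow> x < 8 \<Longrightarrow> -8 < y \<Longrightarrow> y < -4 \<Longrightarrow> f (Complex x y) = c2"
    by blast
  have "\<exists>c. \<forall>x y. -4 < x \<longrightarrow> x < 8 \<longrightarrow> -8 < y \<longrightarrow> y < 8 \<longrightarrow> f (Complex x y) = c"
    by (rule constant_between_ygraphs[OF assms]; (intro continuous_intros | simp add: simple_arc_Complex; argo))
  then obtain c3 where O3: "\<And>x y. -4 < x \<Longrightarrow> x < 8 \<Longrightarrow> -8 < y \<Longrightarrow> y < 8 \<Longrightarrow> f (Complex x y) = c3"
    by blast
  have eq: "c2 = c1" "c3 = c1"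
    using O1[of 5 5] O2[of 5 "-5"] O3[of 5 5] O3[of 5 "-5"] by simp_all
  show ?thesis
  proof (rule that[of cL c1], unfold arc_coloured_def, intro allI impI conjI)
    fix x y :: real assume xy: "\<bar>x\<bar> < 8" "\<bar>y\<bar> < 8"
    show "f (Complex x y) = cL" if "max (\<bar>y\<bar> - 4) (x + 4) < 0" using L[of x y] xy that by argo
    show "f (Complex x y) = c1" if "max (\<bar>y\<bar> - 4) (x + 4) > 0"
      using O1[of x y] O2[of x y] O3[of x y] xy that unfolding eq by argo
  qed
qed

lemma simple_arc_L_O:
  assumes col: "arc_coloured f cL cO"
  shows "colours_at (curve simple_arc) f (Complex (-4) 0) = {cO, cL}"
proof (rule colours_at_edge[where a = 1 and b = 0 and e = 1])
  note F = arc_colouredD[OF col]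
  fix x y :: real assume xy: "\<bar>x - (-4)\<bar> < 1" "\<bar>y - 0\<bar> < 1"
  show "Complex x y \<in> curve simple_arc \<longleftrightarrow> 1 * (x - (-4)) + 0 * (y - 0) = 0"
    using xy unfolding simple_arc_Complex by argo
  show "f (Complex x y) = cO" if "1 * (x - (-4)) + 0 * (y - 0) > 0"
    by (rule F(2); use xy that in argo)
  show "f (Complex x y) = cL" if "1 * (x - (-4)) + 0 * (y - 0) < 0"
    by (rule F(1); use xy that in argo)
qed simp_all

text \<open>
  The moves \<open>\<Omega>1\<close>, \<open>\<Omega>6\<close> and \<open>\<Omega>6'\<close> from left to right; they differ in the set of markers \<open>M1\<close> only.
  Forget the colour of the loop.
\<close>

lemma transfers_unkink:
  assumes M: "\<And>x y. Complex x y \<in> M1 \<Longrightarrow> \<bar>x\<bar> \<le> 7 \<and> \<bar>y\<bar> \<le> 7 \<and> (Complex x y \<in> kink \<longrightarrow> x = 0 \<and> y = 0)"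
  shows "transfers kink M1 (curve simple_arc) {}"
proof (rule transfersI)
  show "\<bar>x\<bar> \<le> 7 \<and> \<bar>y\<bar> \<le> 7" if "Complex x y \<in> M1 \<union> {}" for x y using M[of x y] that by simp
  show "Complex x y \<in> kink \<longleftrightarrow> Complex x y \<in> curve simple_arc" if "\<not> (\<bar>x\<bar> \<le> 7 \<and> \<bar>y\<bar> \<le> 7)" for x y
    using that unfolding kink_Complex simple_arc_Complex by argo
  fix f
  assume f: "disk_colouring kink M1 f"
  then have lc: "locally_constant_off (kink \<union> - disk_interior) f"
    and 1: "\<And>p. p \<in> kink \<Longrightarrow> p \<in> disk_interior \<Longrightarrow> fst ` colours_at kink f p = UNIV"
    by (simp_all add: disk_colouring_def)
  obtain cL cP cO where col: "kink_coloured f cL cP cO" using kink_regions[OF lc] by blast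
  note F = kink_colouredD[OF col]
  have LO: "fst cO \<noteq> fst cL"
    by (rule fst_image_UNIV_D[OF kink_L_O[OF col]], rule 1) (simp_all add: kink_Complex)
  \<comment> \<open>The arc bounds the rectangle on its left, where this function is negative.\<close>
  define \<phi> where "\<phi> z = max (\<bar>Im z\<bar> - 4) (Re z + 4)" for z
  define G :: "bool \<Rightarrow> bool \<Rightarrow> bool \<Rightarrow> bool \<times> bool" where "G = (\<lambda>s _ _. if s then cO else cL)"
  define g where "g z = G (\<phi> z > 0) (1 > (0::real)) (1 > (0::real))" for z
  have cont: "continuous_on UNIV \<phi>" unfolding \<phi>_def by (intro continuous_intros)
  have arc: "z \<in> curve simple_arc \<longleftrightarrow> \<phi> z = 0" if "z \<in> disk_interior" for z
    using that simple_arc_Complex[of "Re z" "Im z"] by (auto simp: disk_interior_def \<phi>_def)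
  have lcg: "locally_constant_off (curve simple_arc \<union> - disk_interior) g"
    by (rule locally_constant_signs[where \<phi> = \<phi> and \<psi> = "\<lambda>_. 1" and \<theta> = "\<lambda>_. 1" and G = G])
      (use cont arc in \<open>auto simp: g_def\<close>)
  have colg: "colours_at (curve simple_arc) g p = {cO, cL}" if p: "p \<in> curve simple_arc" "p \<in> disk_interior" for p
  proof -
    obtain u v where uv: "p = Complex u v" by (cases p)
    have z: "max (\<bar>v\<bar> - 4) (u + 4) = 0" using arc[OF p(2)] p(1) by (simp add: uv \<phi>_def)
    define s :: real where "s = (if v \<ge> 0 then 1 else -1)"
    have s: "v \<ge> 0 \<and> s = 1 \<or> v < 0 \<and> s = -1" by (simp add: s_def)
    \<comment> \<open>Moving diagonally away from the rectangle, respectively into it, works on all its sides and corners.\<close>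
    have "colours_at (curve simple_arc) g p = {G True (1 > (0::real)) (1 > (0::real)), G False (1 > (0::real)) (1 > (0::real))}"
    proof (rule colours_at_wall3[where \<phi> = \<phi> and \<psi> = "\<lambda>_. 1" and \<theta> = "\<lambda>_. 1"])
      show "p \<in> closure {z. \<phi> z > 0}" unfolding uv
        by (rule mem_closure_pos(1)[where a = 1 and b = s]) (use z s in \<open>auto simp: \<phi>_def\<close>)
      show "p \<in> closure {z. \<phi> z < 0}" unfolding uv
        by (rule mem_closure_pos(2)[where a = "-1" and b = "-s"]) (use z s in \<open>auto simp: \<phi>_def\<close>)
    qed (use cont arc p in \<open>auto simp: g_def\<close>)
    then show ?thesis by (simp add: G_def)
  qed
  \<comment> \<open>At the double point only the colours of the three regions meet.\<close>
  have "rainbow kink M1 f = {}"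
  proof -
    have "colours_at kink f v \<noteq> UNIV" if "v \<in> M1" for v
    proof (cases "v \<in> kink")
      case True
      then have "v = Complex 0 0" using M[of "Re v" "Im v"] that by (simp add: complex_eq_iff)
      then show ?thesis using kink_crossing[OF col] three_colours by simp
    next
      case False
      have "v \<in> disk_interior" using M[of "Re v" "Im v"] that by (simp add: disk_interior_def)
      then show ?thesis using off_not_rainbow[OF lc] False by blast
    qed
    then show ?thesis by (auto simp: rainbow_def)
  qed
  moreover have "rainbow (curve simple_arc) {} g = {}" by (simp add: rainbow_def)
  moreover have "g (Complex x y) = f (Complex x y)"
    if "\<bar>x\<bar> < 8" "\<bar>y\<bar> < 8" "\<not> (\<bar>x\<bar> \<le> 7 \<and> \<bar>y\<bar> \<le> 7)" "Complex x y \<notin> curve simple_arc" for x y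
  proof -
    have "max (\<bar>y\<bar> - 4) (x + 4) \<noteq> 0"
      using that(1,2,4) by (simp add: simple_arc_Complex)
    then have "max (\<bar>y\<bar> - 4) (x + 4) > 0 \<or> max (\<bar>y\<bar> - 4) (x + 4) < 0" by linarith
    then show ?thesis
    proof
      assume *: "max (\<bar>y\<bar> - 4) (x + 4) > 0"
      have "f (Complex x y) = cO" by (rule F(3); use that(1-3) * in argo)
      then show ?thesis using * by (simp add: g_def G_def \<phi>_def)
    next
      assume *: "max (\<bar>y\<bar> - 4) (x + 4) < 0"
      have "f (Complex x y) = cL" by (rule F(1); use that(1-3) * in argo)
      moreover have "\<not> max (\<bar>y\<bar> - 4) (x + 4) > 0" using * by linarith
      ultimately show ?thesis by (simp only: g_def G_def \<phi>_def complex.sel if_False)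
    qed
  qed
  moreover have "disk_colouring (curve simple_arc) {} g"
    using lcg colg two_colours(1) fst_image_UNIV[OF _ _ LO, of "{cO, cL}"]
    by (simp add: disk_colouring_def)
  ultimately show "\<exists>g. recolours kink M1 f (curve simple_arc) {} g"
    by (intro exI[of _ g]) (simp add: recolours_def)
qed

text \<open>
  The other direction: give the loop the colour of the region on the left of the arc.  Then only two
  colours meet at the double point, whether it is a crossing or a marked vertex.
\<close>

lemma transfers_kink:
  assumes M: "\<And>x y. Complex x y \<in> M2 \<Longrightarrow> \<bar>x\<bar> \<le> 7 \<and> \<bar>y\<bar> \<le> 7"
  shows "transfers (curve simple_arc) {} kink M2"
proof (rule transfersI)
  show "\<bar>x\<bar> \<le> 7 \<and> \<bar>y\<bar> \<le> 7" if "Complex x y \<in> {} \<union> M2" for x y using M[of x y] that by simp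
  show "Complex x y \<in> curve simple_arc \<longleftrightarrow> Complex x y \<in> kink" if "\<not> (\<bar>x\<bar> \<le> 7 \<and> \<bar>y\<bar> \<le> 7)" for x y
    using that unfolding kink_Complex simple_arc_Complex by argo
  fix f
  assume f: "disk_colouring (curve simple_arc) {} f"
  then have lc: "locally_constant_off (curve simple_arc \<union> - disk_interior) f"
    and 1: "\<And>p. p \<in> curve simple_arc \<Longrightarrow> p \<in> disk_interior \<Longrightarrow> fst ` colours_at (curve simple_arc) f p = UNIV"
    by (simp_all add: disk_colouring_def)
  obtain cL cO where col: "arc_coloured f cL cO" using simple_arc_regions[OF lc] by blast
  note F = arc_colouredD[OF col]
  have LO: "fst cO \<noteq> fst cL"
    by (rule fst_image_UNIV_D[OF simple_arc_L_O[OF col]], rule 1) (simp_all add: simple_arc_Complex)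
  define \<phi> where "\<phi> z = max (\<bar>Im z\<bar> - 4) (\<bar>Im z\<bar> + Re z)" for z
  define \<psi> where "\<psi> z = max (\<bar>Im z\<bar> - Re z) (Re z - 4)" for z
  define G :: "bool \<Rightarrow> bool \<Rightarrow> bool \<Rightarrow> bool \<times> bool" where "G = (\<lambda>s t _. if s \<and> t then cO else cL)"
  define g where "g z = G (\<phi> z > 0) (\<psi> z > 0) (1 > (0::real))" for z
  have cont: "continuous_on UNIV \<phi>" "continuous_on UNIV \<psi>"
    unfolding \<phi>_def \<psi>_def by (intro continuous_intros)+
  have knk: "z \<in> kink \<longleftrightarrow> \<phi> z = 0 \<or> \<psi> z = 0" if "z \<in> disk_interior" for z
    using that kink_Complex[of "Re z" "Im z"] by (auto simp: disk_interior_def \<phi>_def \<psi>_def)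
  have lcg: "locally_constant_off (kink \<union> - disk_interior) g"
    by (rule locally_constant_signs[where \<phi> = \<phi> and \<psi> = \<psi> and \<theta> = "\<lambda>_. 1" and G = G])
      (use cont knk in \<open>auto simp: g_def\<close>)
  have g: "g (Complex x y) = (if max (\<bar>y\<bar> - 4) (\<bar>y\<bar> + x) > 0 \<and> max (\<bar>y\<bar> - x) (x - 4) > 0 then cO else cL)" for x y
    by (simp add: g_def G_def \<phi>_def \<psi>_def)
  have colg: "colours_at kink g p = {cO, cL}" if p: "p \<in> kink" "p \<in> disk_interior" for p
  proof -
    obtain u v where uv: "p = Complex u v" by (cases p)
    define s :: real where "s = (if v \<ge> 0 then 1 else -1)"
    have s: "v \<ge> 0 \<and> s = 1 \<or> v < 0 \<and> s = -1" by (simp add: s_def)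
    consider "u = 0" "v = 0" | "(u, v) \<noteq> (0, 0)" "max (\<bar>v\<bar> - 4) (\<bar>v\<bar> + u) = 0"
      | "(u, v) \<noteq> (0, 0)" "max (\<bar>v\<bar> - u) (u - 4) = 0"
      using knk[OF p(2)] p(1) by (auto simp: uv \<phi>_def \<psi>_def)
    then show ?thesis
    proof cases
      case 1
      have "kink_coloured g cL cL cO" unfolding kink_coloured_def g by auto
      then show ?thesis using kink_crossing 1 uv by fastforce
    next
      case 2
      have v: "\<psi> p > 0" "\<bar>v\<bar> > 0" using 2 by (auto simp: uv \<psi>_def)
      have "colours_at kink g p = {G True (\<psi> p > 0) (1 > (0::real)), G False (\<psi> p > 0) (1 > (0::real))}"
      proof (rule colours_at_wall3[where \<phi> = \<phi> and \<psi> = \<psi> and \<theta> = "\<lambda>_. 1"])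
        show "p \<in> closure {z. \<phi> z > 0}" unfolding uv
          by (rule mem_closure_pos(1)[where a = 0 and b = s]) (use 2 s in \<open>auto simp: \<phi>_def\<close>)
        show "p \<in> closure {z. \<phi> z < 0}" unfolding uv
        proof (rule mem_closure_pos(2)[where a = "-1" and b = "-s"])
          fix t :: real assume "0 < t" "t < 1"
          then show "\<phi> (Complex (u + t * -1) (v + t * -s)) < 0"
            using s 2(2) v(2) by (elim disjE conjE; simp add: \<phi>_def; argo)
        qed
      qed (use cont knk p v in \<open>auto simp: g_def\<close>)
      then show ?thesis using v by (simp add: G_def)
    next
      case 3
      have v: "\<phi> p > 0" "u > 0" using 3 by (auto simp: uv \<phi>_def)
      have "colours_at kink g p = {G (\<phi> p > 0) True (1 > (0::real)), G (\<phi> p > 0) False (1 > (0::real))}"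
      proof (rule colours_at_wall3[where \<phi> = \<psi> and \<psi> = \<phi> and \<theta> = "\<lambda>_. 1" and G = "\<lambda>t s r. G s t r"])
        show "p \<in> closure {z. \<psi> z > 0}" unfolding uv
        proof (rule mem_closure_pos(1)[where a = 1 and b = "2 * s"])
          fix t :: real assume "0 < t" "t < 1"
          then show "\<psi> (Complex (u + t * 1) (v + t * (2 * s))) > 0"
            using s 3(2) by (elim disjE conjE; simp add: \<psi>_def; argo)
        qed
        show "p \<in> closure {z. \<psi> z < 0}"
        proof (cases "v = 0")
          case True
          then show ?thesis unfolding uv
            by (intro mem_closure_pos(2)[where a = "-1" and b = 0]) (use 3 v in \<open>auto simp: \<psi>_def\<close>)
        next
          case False
          then have "\<bar>v\<bar> > 0" by simp
          then show ?thesis unfolding uv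
          proof (rule mem_closure_sign(2)[where a = "-1/2" and b = "-s"])
            fix t :: real assume "0 < t" "t < \<bar>v\<bar>"
            then show "\<psi> (Complex (u + t * (-1/2)) (v + t * -s)) < 0"
              using s 3(2) by (elim disjE conjE; simp add: \<psi>_def; argo)
          qed
        qed
      qed (use cont knk p v in \<open>auto simp: g_def\<close>)
      then show ?thesis using v by (simp add: G_def)
    qed
  qed
  have "rainbow kink M2 g = {}"
  proof -
    have "colours_at kink g v \<noteq> UNIV" if "v \<in> M2" for v
    proof (cases "v \<in> kink")
      case True
      have "v \<in> disk_interior" using M[of "Re v" "Im v"] that by (simp add: disk_interior_def)
      then show ?thesis using colg True two_colours(2) by simp
    next
      case False
      have "v \<in> disk_interior" using M[of "Re v" "Im v"] that by (simp add: disk_interior_def)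
      then show ?thesis using off_not_rainbow[OF lcg] False by blast
    qed
    then show ?thesis by (auto simp: rainbow_def)
  qed
  moreover have "rainbow (curve simple_arc) {} f = {}" by (simp add: rainbow_def)
  moreover have "g (Complex x y) = f (Complex x y)"
    if "\<bar>x\<bar> < 8" "\<bar>y\<bar> < 8" "\<not> (\<bar>x\<bar> \<le> 7 \<and> \<bar>y\<bar> \<le> 7)" "Complex x y \<notin> kink" for x y
  proof (cases "max (\<bar>y\<bar> - 4) (\<bar>y\<bar> + x) > 0 \<and> max (\<bar>y\<bar> - x) (x - 4) > 0")
    case True
    then have "f (Complex x y) = cO" by (intro F(2)) (use that kink_Complex[of x y] in argo)+
    then show ?thesis by (simp only: g True if_True simp_thms)
  next
    case False
    then have "f (Complex x y) = cL" by (intro F(1)) (use that kink_Complex[of x y] in argo)+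
    then show ?thesis by (simp only: g False if_False)
  qed
  moreover have "disk_colouring kink M2 g"
    using lcg colg two_colours(1) fst_image_UNIV[OF _ _ LO, of "{cO, cL}"]
    by (simp add: disk_colouring_def)
  ultimately show "\<exists>g. recolours (curve simple_arc) {} f kink M2 g"
    by (intro exI[of _ g]) (simp add: recolours_def)
qed

section \<open>Bigons\<close>

text \<open>
  Two mirror-symmetric strands that cross at heights \<open>k\<close> and \<open>-k\<close> and bound a bigon in between.  For
  \<open>k = 2\<close> this is the left side of \<open>\<Omega>2\<close>; for \<open>k = 3\<close> it is the curve of \<open>\<Omega>5\<close> with the coordinates
  interchanged.
\<close>

definition bigon :: "real \<Rightarrow> complex set" where
  "bigon k = {z. \<bar>Re z\<bar> \<le> 8 \<and> \<bar>Im z\<bar> \<le> 8 \<and> \<bar>Re z\<bar> = \<bar>k - min \<bar>Im z\<bar> 6\<bar>}"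

lemma bigon_Complex:
  "Complex x y \<in> bigon k \<longleftrightarrow> \<bar>x\<bar> \<le> 8 \<and> \<bar>y\<bar> \<le> 8 \<and> \<bar>x\<bar> = \<bar>k - min \<bar>y\<bar> 6\<bar>"
  by (simp add: bigon_def)

text \<open>
  The regions left and right of the strands, the bigon, and the regions on top and at the bottom
  (\<open>cD\<close>, for down).
\<close>

definition bigon_coloured :: "real \<Rightarrow> (complex \<Rightarrow> 'a) \<Rightarrow> 'a \<Rightarrow> 'a \<Rightarrow> 'a \<Rightarrow> 'a \<Rightarrow> 'a \<Rightarrow> bool" where
  "bigon_coloured k f cL cR cB cT cD \<longleftrightarrow> (\<forall>x y. \<bar>x\<bar> < 8 \<longrightarrow> \<bar>y\<bar> < 8 \<longrightarrow>
     (x < - \<bar>k - min \<bar>y\<bar> 6\<bar> \<longrightarrow> f (Complex x y) = cL) \<and>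
     (\<bar>k - min \<bar>y\<bar> 6\<bar> < x \<longrightarrow> f (Complex x y) = cR) \<and>
     (\<bar>x\<bar> < k - \<bar>y\<bar> \<longrightarrow> f (Complex x y) = cB) \<and>
     (\<bar>x\<bar> < min y 6 - k \<longrightarrow> f (Complex x y) = cT) \<and>
     (\<bar>x\<bar> < min (- y) 6 - k \<longrightarrow> f (Complex x y) = cD))"

lemma bigon_colouredD:
  assumes "bigon_coloured k f cL cR cB cT cD" "\<bar>x\<bar> < 8" "\<bar>y\<bar> < 8"
  shows "x < - \<bar>k - min \<bar>y\<bar> 6\<bar> \<Longrightarrow> f (Complex x y) = cL"
    "\<bar>k - min \<bar>y\<bar> 6\<bar> < x \<Longrightarrow> f (Complex x y) = cR"
    "\<bar>x\<bar> < k - \<bar>y\<bar> \<Longrightarrow> f (Complex x y) = cB"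
    "\<bar>x\<bar> < min y 6 - k \<Longrightarrow> f (Complex x y) = cT"
    "\<bar>x\<bar> < min (- y) 6 - k \<Longrightarrow> f (Complex x y) = cD"
  using assms unfolding bigon_coloured_def by blast+

text \<open>
  The value of \<open>k\<close> is restricted only to keep the inequalities linear and the crossings inside the part
  where the strands are diagonal.
\<close>

lemma bigon_regions:
  assumes f: "locally_constant_off (bigon k \<union> - disk_interior) f" and k: "k = 2 \<or> k = 3"
  obtains cL cR cB cT cD where "bigon_coloured k f cL cR cB cT cD"
proof -
  note const = constant_between_xgraphs[OF f]
  have "\<exists>c. \<forall>x y. -8 < y \<longrightarrow> y < 8 \<longrightarrow> -8 < x \<longrightarrow> x < - \<bar>k - min \<bar>y\<bar> 6\<bar> \<longrightarrow> f (Complex x y) = c"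
    by (rule const; (intro continuous_intros | (use k in argo) | simp add: bigon_Complex; use k in argo))
  then obtain cL where L: "\<And>x y. -8 < y \<Longrightarrow> y < 8 \<Longrightarrow> -8 < x \<Longrightarrow> x < - \<bar>k - min \<bar>y\<bar> 6\<bar> \<Longrightarrow> f (Complex x y) = cL"
    by blast
  have "\<exists>c. \<forall>x y. -8 < y \<longrightarrow> y < 8 \<longrightarrow> \<bar>k - min \<bar>y\<bar> 6\<bar> < x \<longrightarrow> x < 8 \<longrightarrow> f (Complex x y) = c"
    by (rule const; (intro continuous_intros | (use k in argo) | simp add: bigon_Complex; use k in argo))
  then obtain cR where R: "\<And>x y. -8 < y \<Longrightarrow> y < 8 \<Longrightarrow> \<bar>k - min \<bar>y\<bar> 6\<bar> < x \<Longrightarrow> x < 8 \<Longrightarrow> f (Complex x y) = cR"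
    by blast
  have "\<exists>c. \<forall>x y. -k < y \<longrightarrow> y < k \<longrightarrow> \<bar>y\<bar> - k < x \<longrightarrow> x < k - \<bar>y\<bar> \<longrightarrow> f (Complex x y) = c"
    by (rule const; (intro continuous_intros | (use k in argo) | simp add: bigon_Complex; use k in argo))
  then obtain cB where B: "\<And>x y. -k < y \<Longrightarrow> y < k \<Longrightarrow> \<bar>y\<bar> - k < x \<Longrightarrow> x < k - \<bar>y\<bar> \<Longrightarrow> f (Complex x y) = cB"
    by blast
  have "\<exists>c. \<forall>x y. k < y \<longrightarrow> y < 8 \<longrightarrow> k - min y 6 < x \<longrightarrow> x < min y 6 - k \<longrightarrow> f (Complex x y) = c"
    by (rule const; (intro continuous_intros | (use k in argo) | simp add: bigon_Complex; use k in argo))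
  then obtain cT where T: "\<And>x y. k < y \<Longrightarrow> y < 8 \<Longrightarrow> k - min y 6 < x \<Longrightarrow> x < min y 6 - k \<Longrightarrow> f (Complex x y) = cT"
    by blast
  have "\<exists>c. \<forall>x y. -8 < y \<longrightarrow> y < -k \<longrightarrow> k - min (- y) 6 < x \<longrightarrow> x < min (- y) 6 - k \<longrightarrow> f (Complex x y) = c"
    by (rule const; (intro continuous_intros | (use k in argo) | simp add: bigon_Complex; use k in argo))
  then obtain cD where D: "\<And>x y. -8 < y \<Longrightarrow> y < -k \<Longrightarrow> k - min (- y) 6 < x \<Longrightarrow> x < min (- y) 6 - k \<Longrightarrow> f (Complex x y) = cD"
    by blast
  have "bigon_coloured k f cL cR cB cT cD"
    unfolding bigon_coloured_def
  proof (intro allI impI conjI)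
    fix x y :: real assume xy: "\<bar>x\<bar> < 8" "\<bar>y\<bar> < 8"
    show "f (Complex x y) = cL" if "x < - \<bar>k - min \<bar>y\<bar> 6\<bar>" by (rule L; use xy that k in argo)
    show "f (Complex x y) = cR" if "\<bar>k - min \<bar>y\<bar> 6\<bar> < x" by (rule R; use xy that k in argo)
    show "f (Complex x y) = cB" if "\<bar>x\<bar> < k - \<bar>y\<bar>" by (rule B; use xy that k in argo)
    show "f (Complex x y) = cT" if "\<bar>x\<bar> < min y 6 - k" by (rule T; use xy that k in argo)
    show "f (Complex x y) = cD" if "\<bar>x\<bar> < min (- y) 6 - k" by (rule D; use xy that k in argo)
  qed
  then show ?thesis using that by blast
qed

lemma bigon_top:
  assumes "bigon_coloured k f cL cR cB cT cD" and k: "k = 2 \<or> k = 3"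
  shows "colours_at (bigon k) f (Complex 0 k) = {cR, cT, cB, cL}"
proof (rule colours_at_crossing[where a = 1 and b = 1 and c = 1 and d = "-1" and e = 1])
  note F = bigon_colouredD[OF assms(1)]
  fix x y :: real assume xy: "\<bar>x - 0\<bar> < 1" "\<bar>y - k\<bar> < 1"
  show "Complex x y \<in> bigon k \<longleftrightarrow> 1 * (x - 0) + 1 * (y - k) = 0 \<or> 1 * (x - 0) + -1 * (y - k) = 0"
    using xy k unfolding bigon_Complex by argo
  show "f (Complex x y) = cR" if "1 * (x - 0) + 1 * (y - k) > 0" "1 * (x - 0) + -1 * (y - k) > 0"
    by (rule F(2); use xy k that in argo)
  show "f (Complex x y) = cT" if "1 * (x - 0) + 1 * (y - k) > 0" "1 * (x - 0) + -1 * (y - k) < 0"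
    by (rule F(4); use xy k that in argo)
  show "f (Complex x y) = cB" if "1 * (x - 0) + 1 * (y - k) < 0" "1 * (x - 0) + -1 * (y - k) > 0"
    by (rule F(3); use xy k that in argo)
  show "f (Complex x y) = cL" if "1 * (x - 0) + 1 * (y - k) < 0" "1 * (x - 0) + -1 * (y - k) < 0"
    by (rule F(1); use xy k that in argo)
qed simp_all

lemma bigon_bottom:
  assumes "bigon_coloured k f cL cR cB cT cD" and k: "k = 2 \<or> k = 3"
  shows "colours_at (bigon k) f (Complex 0 (-k)) = {cR, cB, cD, cL}"
proof (rule colours_at_crossing[where a = 1 and b = 1 and c = 1 and d = "-1" and e = 1])
  note F = bigon_colouredD[OF assms(1)]
  fix x y :: real assume xy: "\<bar>x - 0\<bar> < 1" "\<bar>y - -k\<bar> < 1"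
  show "Complex x y \<in> bigon k \<longleftrightarrow> 1 * (x - 0) + 1 * (y - -k) = 0 \<or> 1 * (x - 0) + -1 * (y - -k) = 0"
    using xy k unfolding bigon_Complex by argo
  show "f (Complex x y) = cR" if "1 * (x - 0) + 1 * (y - -k) > 0" "1 * (x - 0) + -1 * (y - -k) > 0"
    by (rule F(2); use xy k that in argo)
  show "f (Complex x y) = cB" if "1 * (x - 0) + 1 * (y - -k) > 0" "1 * (x - 0) + -1 * (y - -k) < 0"
    by (rule F(3); use xy k that in argo)
  show "f (Complex x y) = cD" if "1 * (x - 0) + 1 * (y - -k) < 0" "1 * (x - 0) + -1 * (y - -k) > 0"
    by (rule F(5); use xy k that in argo)
  show "f (Complex x y) = cL" if "1 * (x - 0) + 1 * (y - -k) < 0" "1 * (x - 0) + -1 * (y - -k) < 0"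
    by (rule F(1); use xy k that in argo)
qed simp_all

lemma bigon_sides:
  assumes "bigon_coloured k f cL cR cB cT cD" and k: "k = 2 \<or> k = 3"
  shows "colours_at (bigon k) f (Complex (-1) (k + 1)) = {cT, cL}"
    "colours_at (bigon k) f (Complex 1 (k + 1)) = {cR, cT}"
    "colours_at (bigon k) f (Complex (-1) (k - 1)) = {cB, cL}"
    "colours_at (bigon k) f (Complex (-1) (- k - 1)) = {cD, cL}"
proof -
  note F = bigon_colouredD[OF assms(1)]
  show "colours_at (bigon k) f (Complex (-1) (k + 1)) = {cT, cL}"
  proof (rule colours_at_edge[where a = 1 and b = 1 and e = 1])
    fix x y :: real assume xy: "\<bar>x - -1\<bar> < 1" "\<bar>y - (k + 1)\<bar> < 1"
    show "Complex x y \<in> bigon k \<longleftrightarrow> 1 * (x - -1) + 1 * (y - (k + 1)) = 0"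
      using xy k unfolding bigon_Complex by argo
    show "f (Complex x y) = cT" if "1 * (x - -1) + 1 * (y - (k + 1)) > 0"
      by (rule F(4); use xy k that in argo)
    show "f (Complex x y) = cL" if "1 * (x - -1) + 1 * (y - (k + 1)) < 0"
      by (rule F(1); use xy k that in argo)
  qed simp_all
  show "colours_at (bigon k) f (Complex 1 (k + 1)) = {cR, cT}"
  proof (rule colours_at_edge[where a = 1 and b = "-1" and e = 1])
    fix x y :: real assume xy: "\<bar>x - 1\<bar> < 1" "\<bar>y - (k + 1)\<bar> < 1"
    show "Complex x y \<in> bigon k \<longleftrightarrow> 1 * (x - 1) + -1 * (y - (k + 1)) = 0"
      using xy k unfolding bigon_Complex by argo
    show "f (Complex x y) = cR" if "1 * (x - 1) + -1 * (y - (k + 1)) > 0"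
      by (rule F(2); use xy k that in argo)
    show "f (Complex x y) = cT" if "1 * (x - 1) + -1 * (y - (k + 1)) < 0"
      by (rule F(4); use xy k that in argo)
  qed simp_all
  show "colours_at (bigon k) f (Complex (-1) (k - 1)) = {cB, cL}"
  proof (rule colours_at_edge[where a = 1 and b = "-1" and e = 1])
    fix x y :: real assume xy: "\<bar>x - -1\<bar> < 1" "\<bar>y - (k - 1)\<bar> < 1"
    show "Complex x y \<in> bigon k \<longleftrightarrow> 1 * (x - -1) + -1 * (y - (k - 1)) = 0"
      using xy k unfolding bigon_Complex by argo
    show "f (Complex x y) = cB" if "1 * (x - -1) + -1 * (y - (k - 1)) > 0"
      by (rule F(3); use xy k that in argo)
    show "f (Complex x y) = cL" if "1 * (x - -1) + -1 * (y - (k - 1)) < 0"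
      by (rule F(1); use xy k that in argo)
  qed simp_all
  show "colours_at (bigon k) f (Complex (-1) (- k - 1)) = {cD, cL}"
  proof (rule colours_at_edge[where a = 1 and b = "-1" and e = 1])
    fix x y :: real assume xy: "\<bar>x - -1\<bar> < 1" "\<bar>y - (- k - 1)\<bar> < 1"
    show "Complex x y \<in> bigon k \<longleftrightarrow> 1 * (x - -1) + -1 * (y - (- k - 1)) = 0"
      using xy k unfolding bigon_Complex by argo
    show "f (Complex x y) = cD" if "1 * (x - -1) + -1 * (y - (- k - 1)) > 0"
      by (rule F(5); use xy k that in argo)
    show "f (Complex x y) = cL" if "1 * (x - -1) + -1 * (y - (- k - 1)) < 0"
      by (rule F(1); use xy k that in argo)
  qed simp_all
qed

text \<open>
  One point on each of four edges suffices to compare the shadings of the five regions.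
\<close>

lemma bigon_checker:
  fixes f :: "complex \<Rightarrow> bool \<times> bool"
  assumes col: "bigon_coloured k f cL cR cB cT cD" and k: "k = 2 \<or> k = 3"
    and f: "disk_colouring (bigon k) M f"
  shows "fst cR = fst cL" "fst cB = fst cT" "fst cD = fst cT" "fst cL \<noteq> fst cT"
proof -
  have 1: "fst ` colours_at (bigon k) f p = UNIV" if "p \<in> bigon k" "p \<in> disk_interior" for p
    using f that by (simp add: disk_colouring_def)
  have "fst cT \<noteq> fst cL" by (rule fst_image_UNIV_D[OF bigon_sides(1)[OF col k] 1]) (use k in \<open>auto simp: bigon_Complex\<close>)
  moreover have "fst cR \<noteq> fst cT" by (rule fst_image_UNIV_D[OF bigon_sides(2)[OF col k] 1]) (use k in \<open>auto simp: bigon_Complex\<close>)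
  moreover have "fst cB \<noteq> fst cL" by (rule fst_image_UNIV_D[OF bigon_sides(3)[OF col k] 1]) (use k in \<open>auto simp: bigon_Complex\<close>)
  moreover have "fst cD \<noteq> fst cL" by (rule fst_image_UNIV_D[OF bigon_sides(4)[OF col k] 1]) (use k in \<open>auto simp: bigon_Complex\<close>)
  ultimately show "fst cR = fst cL" "fst cB = fst cT" "fst cD = fst cT" "fst cL \<noteq> fst cT" by blast+
qed

lemma bigon_locally_constant:
  assumes col: "bigon_coloured k f cL cR cB cT cD" and k: "k = 2 \<or> k = 3"
  shows "locally_constant_off (bigon k \<union> - disk_interior) f"
proof (rule locally_constant_offI)
  note F = bigon_colouredD[OF col]
  fix z assume z: "z \<notin> bigon k \<union> - disk_interior"
  let ?g = "\<lambda>z. \<bar>k - min \<bar>Im z\<bar> 6\<bar>"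
  have op: "open (disk_interior \<inter> {z. Re z < - ?g z})" "open (disk_interior \<inter> {z. ?g z < Re z})"
    "open (disk_interior \<inter> {z. \<bar>Re z\<bar> < k - \<bar>Im z\<bar>})" "open (disk_interior \<inter> {z. \<bar>Re z\<bar> < min (Im z) 6 - k})"
    "open (disk_interior \<inter> {z. \<bar>Re z\<bar> < min (- Im z) 6 - k})"
    by (intro open_Int open_disk_interior open_Collect_less continuous_intros)+
  have cst: "f w = cL" if "w \<in> disk_interior \<inter> {z. Re z < - ?g z}" for w
    using F(1)[of "Re w" "Im w"] that by (auto simp: disk_interior_def)
  have cst2: "f w = cR" if "w \<in> disk_interior \<inter> {z. ?g z < Re z}" for w
    using F(2)[of "Re w" "Im w"] that by (auto simp: disk_interior_def)
  have cst3: "f w = cB" if "w \<in> disk_interior \<inter> {z. \<bar>Re z\<bar> < k - \<bar>Im z\<bar>}" for w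
    using F(3)[of "Re w" "Im w"] that by (auto simp: disk_interior_def)
  have cst4: "f w = cT" if "w \<in> disk_interior \<inter> {z. \<bar>Re z\<bar> < min (Im z) 6 - k}" for w
    using F(4)[of "Re w" "Im w"] that by (auto simp: disk_interior_def)
  have cst5: "f w = cD" if "w \<in> disk_interior \<inter> {z. \<bar>Re z\<bar> < min (- Im z) 6 - k}" for w
    using F(5)[of "Re w" "Im w"] that by (auto simp: disk_interior_def)
  have "Complex (Re z) (Im z) \<notin> bigon k" "z \<in> disk_interior" using z by simp_all
  then have "Re z < - ?g z \<or> ?g z < Re z \<or> \<bar>Re z\<bar> < k - \<bar>Im z\<bar> \<or>
      \<bar>Re z\<bar> < min (Im z) 6 - k \<or> \<bar>Re z\<bar> < min (- Im z) 6 - k"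
    using k unfolding bigon_Complex disk_interior_def mem_Collect_eq by argo
  then consider "z \<in> disk_interior \<inter> {z. Re z < - ?g z}" | "z \<in> disk_interior \<inter> {z. ?g z < Re z}"
    | "z \<in> disk_interior \<inter> {z. \<bar>Re z\<bar> < k - \<bar>Im z\<bar>}" | "z \<in> disk_interior \<inter> {z. \<bar>Re z\<bar> < min (Im z) 6 - k}"
    | "z \<in> disk_interior \<inter> {z. \<bar>Re z\<bar> < min (- Im z) 6 - k}" using \<open>z \<in> disk_interior\<close> by blast
  then show "\<exists>N. open N \<and> z \<in> N \<and> (\<forall>w\<in>N. w \<notin> bigon k \<union> - disk_interior \<longrightarrow> f w = f z)"
  proof cases
    case 1 then show ?thesis using op(1) cst by blast
  next
    case 2 then show ?thesis using op(2) cst2 by blast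
  next
    case 3 then show ?thesis using op(3) cst3 by blast
  next
    case 4 then show ?thesis using op(4) cst4 by blast
  next
    case 5 then show ?thesis using op(5) cst5 by blast
  qed
qed

text \<open>
  Reflecting in the vertical axis (the sign \<open>s\<close>) leaves three cases: \<open>p\<close> lies beside the bigon, above
  it or below it.  In each of them the edge is a graph over the ordinate, \<open>w\<close> being its distance from
  the axis.
\<close>

lemma bigon_edge_colours:
  assumes col: "bigon_coloured k f cL cR cB cT cD" and k: "k = 2 \<or> k = 3"
    and p: "p \<in> bigon k" "p \<in> disk_interior" "p \<noteq> Complex 0 k" "p \<noteq> Complex 0 (- k)"
  shows "\<exists>cX \<in> {cL, cR}. \<exists>cY \<in> {cB, cT, cD}. colours_at (bigon k) f p = {cX, cY}"
proof -
  note F = bigon_colouredD[OF col]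
  obtain u v where uv: "p = Complex u v" by (cases p)
  have P: "\<bar>u\<bar> < 8" "\<bar>v\<bar> < 8" "\<bar>u\<bar> = \<bar>k - min \<bar>v\<bar> 6\<bar>" "\<not> (u = 0 \<and> v = k)" "\<not> (u = 0 \<and> v = - k)"
    using p by (auto simp: uv bigon_Complex)
  define s :: real where "s = (if u > 0 then 1 else - 1)"
  define cX where "cX = (if u > 0 then cR else cL)"
  have s: "s * s = 1" "s = 1 \<or> s = -1" by (auto simp: s_def)
  have "u \<noteq> 0" using P k by argo
  then have su: "s * u = \<bar>u\<bar>" "\<bar>u\<bar> > 0" by (simp_all add: s_def)
  have outer: "f (Complex x y) = cX" if "\<bar>x\<bar> < 8" "\<bar>y\<bar> < 8" "\<bar>k - min \<bar>y\<bar> 6\<bar> < s * x" for x y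
  proof (cases "u > 0")
    case True
    then have "\<bar>k - min \<bar>y\<bar> 6\<bar> < x" using that(3) by (simp add: s_def)
    then show ?thesis using F(2)[OF that(1,2)] True by (simp add: cX_def)
  next
    case False
    then have "x < - \<bar>k - min \<bar>y\<bar> 6\<bar>" using that(3) by (simp add: s_def)
    then show ?thesis using F(1)[OF that(1,2)] False by (simp add: cX_def)
  qed
  have side: "colours_at (bigon k) f p = {cX, cY}"
    if Q: "Q v" "open {z. Q (Im z)}" and w: "continuous_on UNIV (\<lambda>z. w (Im z))"
      and shape: "\<And>y. \<bar>y\<bar> < 8 \<Longrightarrow> Q y \<Longrightarrow> \<bar>k - min \<bar>y\<bar> 6\<bar> = w y \<and> w y > 0"
      and inner: "\<And>x y. \<bar>x\<bar> < 8 \<Longrightarrow> \<bar>y\<bar> < 8 \<Longrightarrow> Q y \<Longrightarrow> \<bar>x\<bar> < w y \<Longrightarrow> f (Complex x y) = cY"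
    for Q w cY
  proof -
    let ?N = "disk_interior \<inter> {z. Q (Im z)} \<inter> {z. s * Re z > 0}"
    have "open ?N" by (intro open_Int open_disk_interior Q open_Collect_less continuous_intros)
    moreover have "p \<in> ?N" using p Q su by (simp add: uv)
    ultimately have "colours_at (bigon k) f p = {if True then cX else cY, if False then cX else cY}"
    proof (rule colours_at_wall[where \<phi> = "\<lambda>z. s * Re z - w (Im z)" and G = "\<lambda>b. if b then cX else cY"])
      fix z assume "z \<in> ?N"
      then have z: "\<bar>Re z\<bar> < 8" "\<bar>Im z\<bar> < 8" "Q (Im z)" "\<bar>Re z\<bar> = s * Re z"
        using s(2) by (auto simp: disk_interior_def)
      note sh = shape[OF z(2,3)]
      show "z \<in> bigon k \<longleftrightarrow> s * Re z - w (Im z) = 0"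
        using bigon_Complex[of "Re z" "Im z" k] z sh by simp
      show "f z = (if s * Re z - w (Im z) > 0 then cX else cY)" if "s * Re z - w (Im z) \<noteq> 0"
        using outer[OF z(1,2)] inner[OF z(1-3)] z(4) sh that by (cases "s * Re z > w (Im z)") simp_all
    next
      have "s * u = w v" using P(2,3) Q(1) shape[of v] su by simp
      then have *: "s * (u + t * s) - w v = t" "s * (u + t * (- s)) - w v = - t" for t
        using s(1) by (simp_all add: algebra_simps mult.assoc[symmetric])
      show "p \<in> closure {z. s * Re z - w (Im z) > 0}"
        unfolding uv by (rule mem_closure_pos(1)[where a = s and b = 0]) (use * in simp)
      show "p \<in> closure {z. s * Re z - w (Im z) < 0}"
        unfolding uv by (rule mem_closure_pos(2)[where a = "- s" and b = 0]) (use * in simp)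
    qed
    then show ?thesis by simp
  qed
  consider "\<bar>v\<bar> < k" | "k < v" | "k < - v" using P k by argo
  then have *: "\<exists>cY \<in> {cB, cT, cD}. colours_at (bigon k) f p = {cX, cY}"
  proof cases
    case 1
    have "colours_at (bigon k) f p = {cX, cB}"
    proof (rule side[of "\<lambda>y. \<bar>y\<bar> < k" "\<lambda>y. k - \<bar>y\<bar>"])
      show "\<bar>k - min \<bar>y\<bar> 6\<bar> = k - \<bar>y\<bar> \<and> k - \<bar>y\<bar> > 0" if "\<bar>y\<bar> < k" for y using k that by argo
    qed (use 1 F(3) in \<open>auto intro!: open_Collect_less continuous_intros\<close>)
    then show ?thesis by blast
  next
    case 2
    have "colours_at (bigon k) f p = {cX, cT}"
    proof (rule side[of "\<lambda>y. k < y" "\<lambda>y. min y 6 - k"])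
      show "\<bar>k - min \<bar>y\<bar> 6\<bar> = min y 6 - k \<and> min y 6 - k > 0" if "k < y" for y using k that by argo
    qed (use 2 F(4) in \<open>auto intro!: open_Collect_less continuous_intros\<close>)
    then show ?thesis by blast
  next
    case 3
    have "colours_at (bigon k) f p = {cX, cD}"
    proof (rule side[of "\<lambda>y. k < - y" "\<lambda>y. min (- y) 6 - k"])
      show "\<bar>k - min \<bar>y\<bar> 6\<bar> = min (- y) 6 - k \<and> min (- y) 6 - k > 0" if "k < - y" for y using k that by argo
    qed (use 3 F(5) in \<open>auto intro!: open_Collect_less continuous_intros\<close>)
    then show ?thesis by blast
  qed
  show ?thesis by (rule bexI[where x = cX], rule *) (simp add: cX_def)
qed

text \<open>
  Sufficient conditions for a colouring of the five regions to be admissible: the chequerboard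
  condition, and straightness of the active edges at the two double points unless they are marked.
\<close>

lemma bigon_disk_colouring:
  fixes f :: "complex \<Rightarrow> bool \<times> bool"
  assumes col: "bigon_coloured k f cL cR cB cT cD" and k: "k = 2 \<or> k = 3"
    and rho: "fst cR = fst cL" "fst cB = fst cT" "fst cD = fst cT" "fst cL \<noteq> fst cT"
    and top: "Complex 0 k \<notin> M \<Longrightarrow> (snd cR = snd cL \<longleftrightarrow> snd cT = snd cB)"
    and bottom: "Complex 0 (- k) \<notin> M \<Longrightarrow> (snd cR = snd cL \<longleftrightarrow> snd cB = snd cD)"
  shows "disk_colouring (bigon k) M f"
  unfolding disk_colouring_def
proof (intro conjI ballI)
  show "locally_constant_off (bigon k \<union> - disk_interior) f" by (rule bigon_locally_constant[OF col k])
  show "fst ` colours_at (bigon k) f p = UNIV" if "p \<in> bigon k \<inter> disk_interior" for p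
  proof -
    consider "p = Complex 0 k" | "p = Complex 0 (- k)" | "p \<noteq> Complex 0 k" "p \<noteq> Complex 0 (- k)" by blast
    then show ?thesis
    proof cases
      case 1
      show ?thesis unfolding 1 bigon_top[OF col k]
        by (rule fst_image_UNIV[of cL _ cT]) (use rho in auto)
    next
      case 2
      show ?thesis unfolding 2 bigon_bottom[OF col k]
        by (rule fst_image_UNIV[of cL _ cB]) (use rho in auto)
    next
      case 3
      have "\<exists>cX \<in> {cL, cR}. \<exists>cY \<in> {cB, cT, cD}. colours_at (bigon k) f p = {cX, cY}"
        by (rule bigon_edge_colours[OF col k _ _ 3]) (use that in simp_all)
      then obtain cX cY where "cX \<in> {cL, cR}" "cY \<in> {cB, cT, cD}" and eq: "colours_at (bigon k) f p = {cX, cY}"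
        by (elim bexE)
      then have "fst cX \<noteq> fst cY" using rho by auto
      then show ?thesis unfolding eq by (intro fst_image_UNIV[of cX _ cY]) auto
    qed
  qed
  show "card (colours_at (bigon k) f p) \<noteq> 3" if "p \<in> bigon k \<inter> disk_interior - M" for p
  proof -
    consider "p = Complex 0 k" | "p = Complex 0 (- k)" | "p \<noteq> Complex 0 k" "p \<noteq> Complex 0 (- k)" by blast
    then show ?thesis
    proof cases
      case 1
      show ?thesis unfolding 1 bigon_top[OF col k]
        by (rule iffD2[OF card_crossing_iff]) (use rho top that 1 in simp_all)
    next
      case 2
      show ?thesis unfolding 2 bigon_bottom[OF col k]
        by (rule iffD2[OF card_crossing_iff]) (use rho bottom that 2 in simp_all)
    next
      case 3
      have "\<exists>cX \<in> {cL, cR}. \<exists>cY \<in> {cB, cT, cD}. colours_at (bigon k) f p = {cX, cY}"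
        by (rule bigon_edge_colours[OF col k _ _ 3]) (use that in simp_all)
      then obtain cX cY where eq: "colours_at (bigon k) f p = {cX, cY}"
        by (elim bexE)
      show ?thesis unfolding eq by (rule two_colours)
    qed
  qed
qed

text \<open>
  The converse: what an admissible colouring satisfies at its crossings.
\<close>

lemma bigon_crossings:
  fixes f :: "complex \<Rightarrow> bool \<times> bool"
  assumes col: "bigon_coloured k f cL cR cB cT cD" and k: "k = 2 \<or> k = 3"
    and f: "disk_colouring (bigon k) M f"
  shows "Complex 0 k \<notin> M \<Longrightarrow> (snd cR = snd cL \<longleftrightarrow> snd cT = snd cB)"
    "Complex 0 (- k) \<notin> M \<Longrightarrow> (snd cR = snd cL \<longleftrightarrow> snd cB = snd cD)"
proof -
  note rho = bigon_checker[OF col k f]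
  have P: "Complex 0 k \<in> bigon k \<inter> disk_interior" "Complex 0 (- k) \<in> bigon k \<inter> disk_interior"
    using k by (auto simp: bigon_Complex)
  have 3: "card (colours_at (bigon k) f p) \<noteq> 3" if "p \<in> bigon k \<inter> disk_interior" "p \<notin> M" for p
    using f that by (simp add: disk_colouring_def)
  show "snd cR = snd cL \<longleftrightarrow> snd cT = snd cB" if "Complex 0 k \<notin> M"
    by (rule iffD1[OF card_crossing_iff 3[OF P(1) that, unfolded bigon_top[OF col k]]]) (use rho in simp_all)
  show "snd cR = snd cL \<longleftrightarrow> snd cB = snd cD" if "Complex 0 (- k) \<notin> M"
    by (rule iffD1[OF card_crossing_iff 3[OF P(2) that, unfolded bigon_bottom[OF col k]]]) (use rho in simp_all)
qed

section \<open>Separating two strands\<close>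

definition two_lines :: "complex set" where
  "two_lines = {z. \<bar>Re z\<bar> = 4 \<and> \<bar>Im z\<bar> \<le> 8}"

lemma two_lines_Complex: "Complex x y \<in> two_lines \<longleftrightarrow> \<bar>x\<bar> = 4 \<and> \<bar>y\<bar> \<le> 8"
  by (simp add: two_lines_def)

lemma \<Omega>2_curves: "curve (left_side \<Omega>2) = bigon 2" "curve (right_side \<Omega>2) = two_lines"
  by (rule set_eq_Complex, simp only: left_\<Omega>2_Complex bigon_Complex)
    (rule set_eq_Complex, unfold right_\<Omega>2_Complex two_lines_Complex, argo)

text \<open>
  At both crossings, the bigon agrees in \<open>\<beta>\<close> with the adjacent outer region iff \<open>cR\<close> agrees with \<open>cL\<close>.
  So the regions on top and at the bottom have equal colours and can be joined.
\<close>

lemma transfers_\<Omega>2: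
  "transfers (bigon 2) {} two_lines {}"
proof (rule transfersI)
  have k: "(2::real) = 2 \<or> (2::real) = 3" by simp
  show "Complex x y \<in> bigon 2 \<longleftrightarrow> Complex x y \<in> two_lines" if "\<not> (\<bar>x\<bar> \<le> 7 \<and> \<bar>y\<bar> \<le> 7)" for x y
    using that unfolding bigon_Complex two_lines_Complex by argo
  fix f assume f: "disk_colouring (bigon 2) {} f"
  obtain cL cR cB cT cD where col: "bigon_coloured 2 f cL cR cB cT cD"
    using bigon_regions[OF _ k] f unfolding disk_colouring_def by blast
  note F = bigon_colouredD[OF col]
  note rho = bigon_checker[OF col k f]
  have "snd cT = snd cD" using bigon_crossings[OF col k f] by auto
  then have TD: "cD = cT" using rho by (simp add: prod_eq_iff)
  define \<phi> where "\<phi> z = Re z + 4" for z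
  define \<psi> where "\<psi> z = Re z - 4" for z
  define G :: "bool \<Rightarrow> bool \<Rightarrow> bool \<Rightarrow> bool \<times> bool" where "G = (\<lambda>s t _. if s then if t then cR else cT else cL)"
  define g where "g z = G (\<phi> z > 0) (\<psi> z > 0) (1 > (0::real))" for z
  have cont: "continuous_on UNIV \<phi>" "continuous_on UNIV \<psi>"
    unfolding \<phi>_def \<psi>_def by (intro continuous_intros)+
  have lns: "z \<in> two_lines \<longleftrightarrow> \<phi> z = 0 \<or> \<psi> z = 0" if "z \<in> disk_interior" for z
    using that by (auto simp: disk_interior_def \<phi>_def \<psi>_def two_lines_def)
  have lcg: "locally_constant_off (two_lines \<union> - disk_interior) g"
    by (rule locally_constant_signs[where \<phi> = \<phi> and \<psi> = \<psi> and \<theta> = "\<lambda>_. 1" and G = G])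
      (use cont lns in \<open>auto simp: g_def\<close>)
  have col2: "\<exists>c. fst c \<noteq> fst cT \<and> colours_at two_lines g p = {c, cT}" if p: "p \<in> two_lines" "p \<in> disk_interior" for p
  proof -
    obtain u v where uv: "p = Complex u v" by (cases p)
    have "\<bar>u\<bar> = 4" using p by (simp add: uv two_lines_Complex)
    then consider "u = -4" | "u = 4" by argo
    then show ?thesis
    proof cases
      case 1
      have "colours_at two_lines g p = {G True (\<psi> p > 0) (1 > (0::real)), G False (\<psi> p > 0) (1 > (0::real))}"
      proof (rule colours_at_wall3[where \<phi> = \<phi> and \<psi> = \<psi> and \<theta> = "\<lambda>_. 1"])
        show "p \<in> closure {z. \<phi> z > 0}" unfolding uv
          by (rule mem_closure_pos(1)[where a = 1 and b = 0]) (use 1 in \<open>auto simp: \<phi>_def\<close>)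
        show "p \<in> closure {z. \<phi> z < 0}" unfolding uv
          by (rule mem_closure_pos(2)[where a = "-1" and b = 0]) (use 1 in \<open>auto simp: \<phi>_def\<close>)
      qed (use cont lns p 1 uv in \<open>auto simp: g_def \<psi>_def\<close>)
      then have "colours_at two_lines g p = {cL, cT}" using 1 by (auto simp: G_def uv \<psi>_def)
      then show ?thesis using rho by blast
    next
      case 2
      have "colours_at two_lines g p = {G (\<phi> p > 0) True (1 > (0::real)), G (\<phi> p > 0) False (1 > (0::real))}"
      proof (rule colours_at_wall3[where \<phi> = \<psi> and \<psi> = \<phi> and \<theta> = "\<lambda>_. 1" and G = "\<lambda>t s r. G s t r"])
        show "p \<in> closure {z. \<psi> z > 0}" unfolding uv
          by (rule mem_closure_pos(1)[where a = 1 and b = 0]) (use 2 in \<open>auto simp: \<psi>_def\<close>)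
        show "p \<in> closure {z. \<psi> z < 0}" unfolding uv
          by (rule mem_closure_pos(2)[where a = "-1" and b = 0]) (use 2 in \<open>auto simp: \<psi>_def\<close>)
      qed (use cont lns p 2 uv in \<open>auto simp: g_def \<phi>_def\<close>)
      then have "colours_at two_lines g p = {cR, cT}" using 2 by (auto simp: G_def uv \<phi>_def)
      then show ?thesis using rho by metis
    qed
  qed
  have "disk_colouring two_lines {} g"
    unfolding disk_colouring_def
  proof (intro conjI ballI lcg)
    show "fst ` colours_at two_lines g p = UNIV" if p: "p \<in> two_lines \<inter> disk_interior" for p
    proof -
      obtain c where "fst c \<noteq> fst cT" "colours_at two_lines g p = {c, cT}" using col2 p by blast
      then show ?thesis by (intro fst_image_UNIV[of c _ cT]) auto
    qed
    show "card (colours_at two_lines g p) \<noteq> 3" if p: "p \<in> two_lines \<inter> disk_interior - {}" for p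
    proof -
      obtain c where eq: "colours_at two_lines g p = {c, cT}" using col2 p by blast
      show ?thesis unfolding eq by (rule two_colours)
    qed
  qed
  moreover have "g (Complex x y) = f (Complex x y)"
    if "\<bar>x\<bar> < 8" "\<bar>y\<bar> < 8" "\<not> (\<bar>x\<bar> \<le> 7 \<and> \<bar>y\<bar> \<le> 7)" "Complex x y \<notin> two_lines" for x y
  proof -
    have x: "\<bar>x\<bar> \<noteq> 4" using that(2,4) by (auto simp: two_lines_Complex)
    consider "x < -4" | "-4 < x" "x < 4" | "x > 4" using x by argo
    then show ?thesis
    proof cases
      case 1
      have "f (Complex x y) = cL" by (rule F(1); use that(1-3) 1 in argo)
      then show ?thesis using 1 by (simp add: g_def G_def \<phi>_def)
    next
      case 2
      have "f (Complex x y) = cT"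
      proof (cases "y > 0")
        case True
        show ?thesis by (rule F(4); use that(1-3) 2 True in argo)
      next
        case False
        have "f (Complex x y) = cD" by (rule F(5); use that(1-3) 2 False in argo)
        then show ?thesis using TD by simp
      qed
      then show ?thesis using 2 by (simp add: g_def G_def \<phi>_def \<psi>_def)
    next
      case 3
      have "f (Complex x y) = cR" by (rule F(2); use that(1-3) 3 in argo)
      then show ?thesis using 3 by (simp add: g_def G_def \<phi>_def \<psi>_def)
    qed
  qed
  ultimately show "\<exists>g. recolours (bigon 2) {} f two_lines {} g"
    by (intro exI[of _ g]) (simp add: recolours_def rainbow_def)
qed simp

text \<open>
  The new bigon takes the only colour \<open>cB\<close> that makes the crossings straight: \<open>\<beta>\<close> is that of the
  middle region, changed if the outer regions differ.
\<close>

lemma transfers_\<Omega>2_back: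
  "transfers two_lines {} (bigon 2) {}"
proof (rule transfersI)
  have k: "(2::real) = 2 \<or> (2::real) = 3" by simp
  show "Complex x y \<in> two_lines \<longleftrightarrow> Complex x y \<in> bigon 2" if "\<not> (\<bar>x\<bar> \<le> 7 \<and> \<bar>y\<bar> \<le> 7)" for x y
    using that unfolding bigon_Complex two_lines_Complex by argo
  fix f assume f: "disk_colouring two_lines {} f"
  note const = constant_between_xgraphs[of "two_lines \<union> - disk_interior" f]
  have lc: "locally_constant_off (two_lines \<union> - disk_interior) f" using f by (simp add: disk_colouring_def)
  have "\<exists>c. \<forall>x y. -8 < y \<longrightarrow> y < 8 \<longrightarrow> -8 < x \<longrightarrow> x < -4 \<longrightarrow> f (Complex x y) = c"
    by (rule const[OF lc]; (intro continuous_intros | simp add: two_lines_Complex))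
  then obtain cL where L: "\<And>x y. -8 < y \<Longrightarrow> y < 8 \<Longrightarrow> -8 < x \<Longrightarrow> x < -4 \<Longrightarrow> f (Complex x y) = cL"
    by blast
  have "\<exists>c. \<forall>x y. -8 < y \<longrightarrow> y < 8 \<longrightarrow> -4 < x \<longrightarrow> x < 4 \<longrightarrow> f (Complex x y) = c"
    by (rule const[OF lc]; (intro continuous_intros | simp add: two_lines_Complex; argo))
  then obtain cM where M: "\<And>x y. -8 < y \<Longrightarrow> y < 8 \<Longrightarrow> -4 < x \<Longrightarrow> x < 4 \<Longrightarrow> f (Complex x y) = cM"
    by blast
  have "\<exists>c. \<forall>x y. -8 < y \<longrightarrow> y < 8 \<longrightarrow> 4 < x \<longrightarrow> x < 8 \<longrightarrow> f (Complex x y) = c"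
    by (rule const[OF lc]; (intro continuous_intros | simp add: two_lines_Complex))
  then obtain cR where R: "\<And>x y. -8 < y \<Longrightarrow> y < 8 \<Longrightarrow> 4 < x \<Longrightarrow> x < 8 \<Longrightarrow> f (Complex x y) = cR"
    by blast
  have 1: "fst ` colours_at two_lines f p = UNIV" if "p \<in> two_lines" "p \<in> disk_interior" for p
    using f that by (simp add: disk_colouring_def)
  have "colours_at two_lines f (Complex (-4) 0) = {cM, cL}"
  proof (rule colours_at_edge[where a = 1 and b = 0 and e = 1])
    fix x y :: real assume xy: "\<bar>x - -4\<bar> < 1" "\<bar>y - 0\<bar> < 1"
    show "Complex x y \<in> two_lines \<longleftrightarrow> 1 * (x - -4) + 0 * (y - 0) = 0"
      using xy unfolding two_lines_Complex by argo
    show "f (Complex x y) = cM" if "1 * (x - -4) + 0 * (y - 0) > 0" by (rule M; use xy that in argo)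
    show "f (Complex x y) = cL" if "1 * (x - -4) + 0 * (y - 0) < 0" by (rule L; use xy that in argo)
  qed simp_all
  then have LM: "fst cM \<noteq> fst cL" by (rule fst_image_UNIV_D) (rule 1; simp add: two_lines_Complex)
  have "colours_at two_lines f (Complex 4 0) = {cR, cM}"
  proof (rule colours_at_edge[where a = 1 and b = 0 and e = 1])
    fix x y :: real assume xy: "\<bar>x - 4\<bar> < 1" "\<bar>y - 0\<bar> < 1"
    show "Complex x y \<in> two_lines \<longleftrightarrow> 1 * (x - 4) + 0 * (y - 0) = 0"
      using xy unfolding two_lines_Complex by argo
    show "f (Complex x y) = cR" if "1 * (x - 4) + 0 * (y - 0) > 0" by (rule R; use xy that in argo)
    show "f (Complex x y) = cM" if "1 * (x - 4) + 0 * (y - 0) < 0" by (rule M; use xy that in argo)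
  qed simp_all
  then have RM: "fst cR \<noteq> fst cM" by (rule fst_image_UNIV_D) (rule 1; simp add: two_lines_Complex)
  define cB where "cB = (fst cM, snd cM = (snd cR = snd cL))"
  define g where "g z = (if Re z < - \<bar>2 - min \<bar>Im z\<bar> 6\<bar> then cL else if \<bar>2 - min \<bar>Im z\<bar> 6\<bar> < Re z then cR
      else if \<bar>Re z\<bar> < 2 - \<bar>Im z\<bar> then cB else cM)" for z
  have col: "bigon_coloured 2 g cL cR cB cM cM"
    unfolding bigon_coloured_def g_def complex.sel
    by (intro allI impI conjI; (subst if_not_P, argo)+ | (subst if_P, argo) | rule refl)+
  have "disk_colouring (bigon 2) {} g"
    by (rule bigon_disk_colouring[OF col k]) (use LM RM in \<open>auto simp: cB_def\<close>)
  moreover have "g (Complex x y) = f (Complex x y)"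
    if "\<bar>x\<bar> < 8" "\<bar>y\<bar> < 8" "\<not> (\<bar>x\<bar> \<le> 7 \<and> \<bar>y\<bar> \<le> 7)" "Complex x y \<notin> bigon 2" for x y
  proof -
    note G = bigon_colouredD[OF col that(1,2)]
    have "x < -4 \<or> (-4 < x \<and> x < 4) \<or> x > 4" 
      using that unfolding bigon_Complex by argo
    then consider "x < -4" | "-4 < x" "x < 4" "y > 0" | "-4 < x" "x < 4" "y \<le> 0" | "x > 4" by linarith
    then show ?thesis
    proof cases
      case 1
      show ?thesis by (rule trans[OF G(1) L[symmetric]]; use that(1-3) 1 in argo)
    next
      case 2
      show ?thesis by (rule trans[OF G(4) M[symmetric]]; use that(1-3) 2 in argo)
    next
      case 3
      show ?thesis by (rule trans[OF G(5) M[symmetric]]; use that(1-3) 3 in argo)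
    next
      case 4
      show ?thesis by (rule trans[OF G(2) R[symmetric]]; use that(1-3) 4 in argo)
    qed
  qed
  ultimately show "\<exists>g. recolours two_lines {} f (bigon 2) {} g"
    by (intro exI[of _ g]) (simp add: recolours_def rainbow_def)
qed simp

section \<open>Moving a vertex past a crossing\<close>

text \<open>
  The marker is vertical, so it lies in the bigon and in the region on top or at the bottom.
\<close>

lemma rainbow_bigon:
  fixes f :: "complex \<Rightarrow> bool \<times> bool"
  assumes f: "disk_colouring (bigon 3) (tick \<i> (0, v)) f" and v: "v = 3 \<or> v = -3"
    and A: "colours_at (bigon 3) f (Complex 0 v) = A"
    and w: "\<And>y. \<bar>y - v\<bar> < 1 \<Longrightarrow> y \<noteq> v \<Longrightarrow> fst (f (Complex 0 y)) = w"
  shows "rainbow (bigon 3) (tick \<i> (0, v)) f = (if A = UNIV \<and> w then {Complex 0 v} else {})"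
proof -
  have "z = Complex 0 v" if "z \<in> tick \<i> (0, v) \<inter> bigon 3" for z
  proof -
    have "Re z = 0" "Im z = v" using that tick_i[of "Re z" "Im z"] bigon_Complex[of "Re z" "Im z" 3] v by auto
    then show ?thesis by (simp add: complex_eq_iff)
  qed
  moreover have "tick \<i> (0, v) \<subseteq> disk_interior"
  proof
    fix z assume "z \<in> tick \<i> (0, v)"
    then have "Re z = 0" "\<bar>Im z - v\<bar> \<le> 1/2" using tick_i[of "Re z" "Im z" 0 v] by simp_all
    then show "z \<in> disk_interior" using v unfolding disk_interior_def mem_Collect_eq by argo
  qed
  ultimately have "rainbow (bigon 3) (tick \<i> (0, v)) f \<subseteq> {Complex 0 v}"
    using rainbow_subset[OF f] by blast
  moreover have "Complex 0 v \<in> rainbow (bigon 3) (tick \<i> (0, v)) f \<longleftrightarrow> A = UNIV \<and> w"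
    unfolding A[symmetric]
  proof (rule rainbow_mem[where N = UNIV])
    show "Complex 0 v \<in> tick \<i> (0, v)" by (simp add: tick_i)
    show "Complex 0 v \<in> closure (tick \<i> (0, v) - bigon 3)"
      by (rule mem_closure_ray_xy[of "1/2" 0 0 v 1]) (use v in \<open>auto simp: tick_i bigon_Complex\<close>)
    fix z assume z: "z \<in> tick \<i> (0, v) - bigon 3"
    then have t: "Re z = 0" "\<bar>Im z - v\<bar> \<le> 1/2" using tick_i[of "Re z" "Im z" 0 v] by simp_all
    have "Im z \<noteq> v"
    proof
      assume "Im z = v"
      then have "z = Complex 0 v" using t(1) by (simp add: complex_eq_iff)
      moreover have "Complex 0 v \<in> bigon 3" using v by (auto simp: bigon_Complex)
      ultimately show False using z by simp
    qed
    moreover have "\<bar>Im z - v\<bar> < 1" using t by argo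
    ultimately have "fst (f (Complex 0 (Im z))) = w" by (intro w)
    moreover have "Complex 0 (Im z) = z" using t(1) by (simp add: complex_eq_iff)
    ultimately show "fst (f z) = w" by simp
  qed simp_all
  ultimately show ?thesis by auto
qed

text \<open>
  The curve stays, while the marker moves from the upper double point to the lower one, which
  becomes the vertex.  The bigon gets the colour \<open>cB'\<close> that is forced by the new crossing on top.  By
  the relation \<open>X\<close> at the old crossing, this colour disagrees with \<open>cD\<close> exactly if the old one
  disagreed with \<open>cT\<close>.
\<close>

lemma transfers_\<Omega>5_swapped:
  "transfers (bigon 3) (tick \<i> (0, 3)) (bigon 3) (tick \<i> (0, -3))"
proof (rule transfersI)
  have k: "(3::real) = 2 \<or> (3::real) = 3" by simp
  show "\<bar>x\<bar> \<le> 7 \<and> \<bar>y\<bar> \<le> 7" if "Complex x y \<in> tick \<i> (0, 3) \<union> tick \<i> (0, -3)" for x y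
    using that unfolding Un_iff tick_i by argo
  fix f assume f: "disk_colouring (bigon 3) (tick \<i> (0, 3)) f"
  obtain cL cR cB cT cD where col: "bigon_coloured 3 f cL cR cB cT cD"
    using bigon_regions[OF _ k] f unfolding disk_colouring_def by blast
  note F = bigon_colouredD[OF col]
  note rho = bigon_checker[OF col k f]
  have X: "snd cR = snd cL \<longleftrightarrow> snd cB = snd cD"
    using bigon_crossings(2)[OF col k f] by (simp add: tick_i)
  define cB' where "cB' = (fst cB, snd cT = (snd cR = snd cL))"
  define g where "g z = (if \<bar>Re z\<bar> < 3 - \<bar>Im z\<bar> then cB' else f z)" for z
  have colg: "bigon_coloured 3 g cL cR cB' cT cD"
    unfolding bigon_coloured_def
  proof (intro allI impI conjI)
    fix x y :: real assume xy: "\<bar>x\<bar> < 8" "\<bar>y\<bar> < 8"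
    have gf: "g (Complex x y) = f (Complex x y)" if "\<not> \<bar>x\<bar> < 3 - \<bar>y\<bar>" using that by (simp add: g_def)
    show "g (Complex x y) = cL" if "x < - \<bar>3 - min \<bar>y\<bar> 6\<bar>"
      by (subst gf, use that in argo, rule F(1); use that xy in argo)
    show "g (Complex x y) = cR" if "\<bar>3 - min \<bar>y\<bar> 6\<bar> < x"
      by (subst gf, use that in argo, rule F(2); use that xy in argo)
    show "g (Complex x y) = cB'" if "\<bar>x\<bar> < 3 - \<bar>y\<bar>" using that by (simp add: g_def)
    show "g (Complex x y) = cT" if "\<bar>x\<bar> < min y 6 - 3"
      by (subst gf, use that in argo, rule F(4); use that xy in argo)
    show "g (Complex x y) = cD" if "\<bar>x\<bar> < min (- y) 6 - 3"
      by (subst gf, use that in argo, rule F(5); use that xy in argo)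
  qed
  have g: "disk_colouring (bigon 3) (tick \<i> (0, -3)) g"
    by (rule bigon_disk_colouring[OF colg k]) (use rho in \<open>auto simp: cB'_def tick_i\<close>)
  have rf: "rainbow (bigon 3) (tick \<i> (0, 3)) f = (if {cR, cT, cB, cL} = UNIV \<and> fst cT then {Complex 0 3} else {})"
  proof (rule rainbow_bigon[OF f _ bigon_top[OF col k]])
    fix y :: real assume y: "\<bar>y - 3\<bar> < 1" "y \<noteq> 3"
    show "fst (f (Complex 0 y)) = fst cT"
    proof (cases "y > 3")
      case True
      have "f (Complex 0 y) = cT" by (rule F(4); use y True in argo)
      then show ?thesis by simp
    next
      case False
      have "f (Complex 0 y) = cB" by (rule F(3); use y False in argo)
      then show ?thesis using rho by simp
    qed
  qed simp
  note G = bigon_colouredD[OF colg]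
  have rg: "rainbow (bigon 3) (tick \<i> (0, -3)) g = (if {cR, cB', cD, cL} = UNIV \<and> fst cT then {Complex 0 (-3)} else {})"
  proof (rule rainbow_bigon[OF g _ bigon_bottom[OF colg k]])
    fix y :: real assume y: "\<bar>y - -3\<bar> < 1" "y \<noteq> -3"
    show "fst (g (Complex 0 y)) = fst cT"
    proof (cases "y > -3")
      case True
      have "g (Complex 0 y) = cB'" by (rule G(3); use y True in argo)
      then show ?thesis using rho by (simp add: cB'_def)
    next
      case False
      have "g (Complex 0 y) = cD" by (rule G(5); use y False in argo)
      then show ?thesis using rho by simp
    qed
  qed simp
  have "{cR, cT, cB, cL} = UNIV \<longleftrightarrow> {cR, cB', cD, cL} = UNIV"
  proof -
    have *: "{cR, cT, cB, cL} = UNIV \<longleftrightarrow> snd cR \<noteq> snd cL \<and> snd cT \<noteq> snd cB"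
      by (rule rainbow_crossing_iff) (use rho in simp_all)
    have **: "{cR, cB', cD, cL} = UNIV \<longleftrightarrow> snd cR \<noteq> snd cL \<and> snd cB' \<noteq> snd cD"
      by (rule rainbow_crossing_iff) (use rho in \<open>simp_all add: cB'_def\<close>)
    show ?thesis unfolding * ** using X by (auto simp: cB'_def)
  qed
  then have "odd (card (rainbow (bigon 3) (tick \<i> (0, 3)) f)) \<longleftrightarrow> odd (card (rainbow (bigon 3) (tick \<i> (0, -3)) g))"
    unfolding rf rg by simp
  moreover have "finite (rainbow (bigon 3) (tick \<i> (0, -3)) g)" unfolding rg by simp
  moreover have "g (Complex x y) = f (Complex x y)" if "\<not> (\<bar>x\<bar> \<le> 7 \<and> \<bar>y\<bar> \<le> 7)" for x y
  proof -
    have "\<not> \<bar>x\<bar> < 3 - \<bar>y\<bar>" using that by argo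
    then show ?thesis by (simp add: g_def)
  qed
  ultimately show "\<exists>g. recolours (bigon 3) (tick \<i> (0, 3)) f (bigon 3) (tick \<i> (0, -3)) g"
    using g unfolding recolours_def by blast
qed simp

section \<open>Moves between mirror images\<close>

lemma homeomorphism_cnj: "homeomorphism UNIV UNIV cnj cnj"
  by (auto simp: homeomorphism_def image_iff intro!: continuous_intros exI[of _ "cnj _"])

lemma cnj_image_Complex: "Complex x y \<in> cnj ` A \<longleftrightarrow> Complex x (- y) \<in> A"
  by (simp add: mem_image_homeo[OF homeomorphism_cnj] complex_cnj)

lemma disk_colouring_cnj:
  assumes f: "disk_colouring C M f"
  shows "disk_colouring (cnj ` C) (cnj ` M) (f \<circ> cnj)"
proof -
  note mem = mem_image_homeo[OF homeomorphism_cnj]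
  have int: "cnj z \<in> disk_interior \<longleftrightarrow> z \<in> disk_interior" for z by (simp add: disk_interior_def)
  have eq: "cnj ` (C \<union> - disk_interior) = cnj ` C \<union> - disk_interior" by (rule set_eqI) (simp add: mem int)
  have "locally_constant_off (cnj ` C \<union> - disk_interior) (f \<circ> cnj)"
    using locally_constant_homeo[OF homeomorphism_cnj, of "C \<union> - disk_interior" f] f
    by (simp only: eq disk_colouring_def)
  then show ?thesis
    using f by (simp add: disk_colouring_def colours_at_homeo[OF homeomorphism_cnj] mem int)
qed

text \<open>
  The two sides of \<open>\<Omega>3\<close> and of \<open>\<Omega>7\<close> are mirror images in the horizontal axis.  Instead of colouring
  the mirror image, colour the same picture so that the colours on the collar appear upside down;
  then a single analysis of the left side covers both sides.
\<close>

lemma transfers_reflect: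
  assumes sym: "\<And>x y. \<not> (\<bar>x\<bar> \<le> 7 \<and> \<bar>y\<bar> \<le> 7) \<Longrightarrow> Complex x y \<in> C \<longleftrightarrow> Complex x (- y) \<in> C"
    and M: "\<And>x y. Complex x y \<in> M \<Longrightarrow> \<bar>x\<bar> \<le> 7 \<and> \<bar>y\<bar> \<le> 7"
    and step: "\<And>f. disk_colouring C M f \<Longrightarrow>
       \<exists>g. (\<forall>x y. \<bar>x\<bar> < 8 \<longrightarrow> \<bar>y\<bar> < 8 \<longrightarrow> \<not> (\<bar>x\<bar> \<le> 7 \<and> \<bar>y\<bar> \<le> 7) \<longrightarrow> Complex x y \<notin> C \<longrightarrow>
              g (Complex x (- y)) = f (Complex x y)) \<and>
           disk_colouring C M g \<and> finite (rainbow C M g) \<and>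
           (odd (card (rainbow C M f)) \<longleftrightarrow> odd (card (rainbow C M g)))"
  shows "transfers C M (cnj ` C) (cnj ` M)"
proof (rule transfersI)
  show "Complex x y \<in> C \<longleftrightarrow> Complex x y \<in> cnj ` C" if "\<not> (\<bar>x\<bar> \<le> 7 \<and> \<bar>y\<bar> \<le> 7)" for x y
    using sym[OF that] by (simp add: cnj_image_Complex)
  show "\<bar>x\<bar> \<le> 7 \<and> \<bar>y\<bar> \<le> 7" if "Complex x y \<in> M \<union> cnj ` M" for x y
    using that M[of x y] M[of x "- y"] by (auto simp: cnj_image_Complex)
  fix f assume "disk_colouring C M f"
  from step[OF this] obtain g where g:
    "\<And>x y. \<bar>x\<bar> < 8 \<Longrightarrow> \<bar>y\<bar> < 8 \<Longrightarrow> \<not> (\<bar>x\<bar> \<le> 7 \<and> \<bar>y\<bar> \<le> 7) \<Longrightarrow> Complex x y \<notin> C \<Longrightarrow>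
              g (Complex x (- y)) = f (Complex x y)"
    "disk_colouring C M g" "finite (rainbow C M g)"
    "odd (card (rainbow C M f)) \<longleftrightarrow> odd (card (rainbow C M g))" by blast
  have "card (cnj ` rainbow C M g) = card (rainbow C M g)"
    by (rule card_image) (simp add: inj_on_def)
  moreover have "(g \<circ> cnj) (Complex x y) = f (Complex x y)"
    if "\<bar>x\<bar> < 8" "\<bar>y\<bar> < 8" "\<not> (\<bar>x\<bar> \<le> 7 \<and> \<bar>y\<bar> \<le> 7)" "Complex x y \<notin> cnj ` C" for x y
  proof -
    have "Complex x y \<notin> C" using that(4) sym[OF that(3)] by (simp add: cnj_image_Complex)
    then show ?thesis using g(1)[OF that(1-3)] by (simp add: complex_cnj)
  qed
  ultimately show "\<exists>g. recolours C M f (cnj ` C) (cnj ` M) g"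
    using g(3,4) disk_colouring_cnj[OF g(2)]
    by (intro exI[of _ "g \<circ> cnj"]) (simp add: recolours_def rainbow_homeo[OF homeomorphism_cnj])
qed

text \<open>
  The left side of \<open>\<Omega>7\<close>: the diagonal strand runs through both vertices, the lower strand crosses it
  at \<open>v = (-2, -2)\<close> and the upper one at \<open>v' = (2, 2)\<close>.
\<close>

definition curve_\<Omega>7 :: "complex set" where
  "curve_\<Omega>7 = {z. \<bar>Im z\<bar> \<le> 8 \<and> (Re z = clamp_to 4 (Im z) \<or> Re z = - 2 - clamp_to 2 (Im z + 2) \<or>
     Re z = 2 - clamp_to 2 (Im z - 2))}"

lemma curve_\<Omega>7_Complex:
  "Complex x y \<in> curve_\<Omega>7 \<longleftrightarrow> \<bar>y\<bar> \<le> 8 \<and> (x = clamp_to 4 y \<or> x = - 2 - clamp_to 2 (y + 2) \<or> x = 2 - clamp_to 2 (y - 2))"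
  by (simp add: curve_\<Omega>7_def)

text \<open>
  The six regions: \<open>cW\<close> on the left, \<open>cN1\<close> and \<open>cN2\<close> at the top of the disk, \<open>cE\<close> on the right, and \<open>cS2\<close>
  and \<open>cS1\<close> at the bottom.  The regions \<open>cN1\<close> and \<open>cS2\<close> are the ones that touch both vertices.
\<close>

definition \<Omega>7_coloured :: "(complex \<Rightarrow> 'a) \<Rightarrow> 'a \<Rightarrow> 'a \<Rightarrow> 'a \<Rightarrow> 'a \<Rightarrow> 'a \<Rightarrow> 'a \<Rightarrow> bool" where
  "\<Omega>7_coloured f cW cN1 cN2 cE cS2 cS1 \<longleftrightarrow> (\<forall>x y. \<bar>x\<bar> < 8 \<longrightarrow> \<bar>y\<bar> < 8 \<longrightarrow>
     (x < clamp_to 4 y \<and> x < - 2 - clamp_to 2 (y + 2) \<longrightarrow> f (Complex x y) = cW) \<and>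
     (x < clamp_to 4 y \<and> - 2 - clamp_to 2 (y + 2) < x \<and> x < 2 - clamp_to 2 (y - 2) \<longrightarrow> f (Complex x y) = cN1) \<and>
     (x < clamp_to 4 y \<and> 2 - clamp_to 2 (y - 2) < x \<longrightarrow> f (Complex x y) = cN2) \<and>
     (clamp_to 4 y < x \<and> 2 - clamp_to 2 (y - 2) < x \<longrightarrow> f (Complex x y) = cE) \<and>
     (clamp_to 4 y < x \<and> - 2 - clamp_to 2 (y + 2) < x \<and> x < 2 - clamp_to 2 (y - 2) \<longrightarrow> f (Complex x y) = cS2) \<and>
     (clamp_to 4 y < x \<and> x < - 2 - clamp_to 2 (y + 2) \<longrightarrow> f (Complex x y) = cS1))"

lemma \<Omega>7_colouredD:
  assumes "\<Omega>7_coloured f cW cN1 cN2 cE cS2 cS1" "\<bar>x\<bar> < 8" "\<bar>y\<bar> < 8"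
  shows "x < clamp_to 4 y \<Longrightarrow> x < - 2 - clamp_to 2 (y + 2) \<Longrightarrow> f (Complex x y) = cW"
    "x < clamp_to 4 y \<Longrightarrow> - 2 - clamp_to 2 (y + 2) < x \<Longrightarrow> x < 2 - clamp_to 2 (y - 2) \<Longrightarrow> f (Complex x y) = cN1"
    "x < clamp_to 4 y \<Longrightarrow> 2 - clamp_to 2 (y - 2) < x \<Longrightarrow> f (Complex x y) = cN2"
    "clamp_to 4 y < x \<Longrightarrow> 2 - clamp_to 2 (y - 2) < x \<Longrightarrow> f (Complex x y) = cE"
    "clamp_to 4 y < x \<Longrightarrow> - 2 - clamp_to 2 (y + 2) < x \<Longrightarrow> x < 2 - clamp_to 2 (y - 2) \<Longrightarrow> f (Complex x y) = cS2"
    "clamp_to 4 y < x \<Longrightarrow> x < - 2 - clamp_to 2 (y + 2) \<Longrightarrow> f (Complex x y) = cS1"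
  using assms unfolding \<Omega>7_coloured_def by blast+

lemma \<Omega>7_regions:
  assumes f: "locally_constant_off (curve_\<Omega>7 \<union> - disk_interior) f"
  obtains cW cN1 cN2 cE cS2 cS1 where "\<Omega>7_coloured f cW cN1 cN2 cE cS2 cS1"
proof -
  note const = constant_between_xgraphs[OF f]
  have "\<exists>c. \<forall>x y. -8 < y \<longrightarrow> y < 8 \<longrightarrow> -8 < x \<longrightarrow> x < min (clamp_to 4 y) (- 2 - clamp_to 2 (y + 2)) \<longrightarrow> f (Complex x y) = c"
    unfolding clamp_to_def
    by (rule const; (intro continuous_intros | argo | simp add: curve_\<Omega>7_Complex clamp_to_def; argo))
  then obtain cW where cW: "\<And>x y. -8 < y \<Longrightarrow> y < 8 \<Longrightarrow> -8 < x \<Longrightarrow> x < min (clamp_to 4 y) (- 2 - clamp_to 2 (y + 2)) \<Longrightarrow> f (Complex x y) = cW"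
    by blast
  have "\<exists>c. \<forall>x y. -2 < y \<longrightarrow> y < 8 \<longrightarrow> - 2 - clamp_to 2 (y + 2) < x \<longrightarrow> x < min (clamp_to 4 y) (2 - clamp_to 2 (y - 2)) \<longrightarrow> f (Complex x y) = c"
    unfolding clamp_to_def
    by (rule const; (intro continuous_intros | argo | simp add: curve_\<Omega>7_Complex clamp_to_def; argo))
  then obtain cN1 where cN1: "\<And>x y. -2 < y \<Longrightarrow> y < 8 \<Longrightarrow> - 2 - clamp_to 2 (y + 2) < x \<Longrightarrow> x < min (clamp_to 4 y) (2 - clamp_to 2 (y - 2)) \<Longrightarrow> f (Complex x y) = cN1"
    by blast
  have "\<exists>c. \<forall>x y. 2 < y \<longrightarrow> y < 8 \<longrightarrow> 2 - clamp_to 2 (y - 2) < x \<longrightarrow> x < clamp_to 4 y \<longrightarrow> f (Complex x y) = c"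
    unfolding clamp_to_def
    by (rule const; (intro continuous_intros | argo | simp add: curve_\<Omega>7_Complex clamp_to_def; argo))
  then obtain cN2 where cN2: "\<And>x y. 2 < y \<Longrightarrow> y < 8 \<Longrightarrow> 2 - clamp_to 2 (y - 2) < x \<Longrightarrow> x < clamp_to 4 y \<Longrightarrow> f (Complex x y) = cN2"
    by blast
  have "\<exists>c. \<forall>x y. -8 < y \<longrightarrow> y < 8 \<longrightarrow> max (clamp_to 4 y) (2 - clamp_to 2 (y - 2)) < x \<longrightarrow> x < 8 \<longrightarrow> f (Complex x y) = c"
    unfolding clamp_to_def
    by (rule const; (intro continuous_intros | argo | simp add: curve_\<Omega>7_Complex clamp_to_def; argo))
  then obtain cE where cE: "\<And>x y. -8 < y \<Longrightarrow> y < 8 \<Longrightarrow> max (clamp_to 4 y) (2 - clamp_to 2 (y - 2)) < x \<Longrightarrow> x < 8 \<Longrightarrow> f (Complex x y) = cE"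
    by blast
  have "\<exists>c. \<forall>x y. -8 < y \<longrightarrow> y < 2 \<longrightarrow> max (clamp_to 4 y) (- 2 - clamp_to 2 (y + 2)) < x \<longrightarrow> x < 2 - clamp_to 2 (y - 2) \<longrightarrow> f (Complex x y) = c"
    unfolding clamp_to_def
    by (rule const; (intro continuous_intros | argo | simp add: curve_\<Omega>7_Complex clamp_to_def; argo))
  then obtain cS2 where cS2: "\<And>x y. -8 < y \<Longrightarrow> y < 2 \<Longrightarrow> max (clamp_to 4 y) (- 2 - clamp_to 2 (y + 2)) < x \<Longrightarrow> x < 2 - clamp_to 2 (y - 2) \<Longrightarrow> f (Complex x y) = cS2"
    by blast
  have "\<exists>c. \<forall>x y. -8 < y \<longrightarrow> y < -2 \<longrightarrow> clamp_to 4 y < x \<longrightarrow> x < - 2 - clamp_to 2 (y + 2) \<longrightarrow> f (Complex x y) = c"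
    unfolding clamp_to_def
    by (rule const; (intro continuous_intros | argo | simp add: curve_\<Omega>7_Complex clamp_to_def; argo))
  then obtain cS1 where cS1: "\<And>x y. -8 < y \<Longrightarrow> y < -2 \<Longrightarrow> clamp_to 4 y < x \<Longrightarrow> x < - 2 - clamp_to 2 (y + 2) \<Longrightarrow> f (Complex x y) = cS1"
    by blast
  have "\<Omega>7_coloured f cW cN1 cN2 cE cS2 cS1"
    unfolding \<Omega>7_coloured_def
  proof (intro allI impI conjI; elim conjE)
    fix x y :: real assume xy: "\<bar>x\<bar> < 8" "\<bar>y\<bar> < 8"
    let ?A = "clamp_to 4 y" and ?B = "- 2 - clamp_to 2 (y + 2)" and ?C = "2 - clamp_to 2 (y - 2)"
    show "f (Complex x y) = cW" if "x < ?A" "x < ?B" by (rule cW; use xy that in argo)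
    show "f (Complex x y) = cN1" if "x < ?A" "?B < x" "x < ?C" by (rule cN1; use xy that in \<open>unfold clamp_to_def, argo\<close>)
    show "f (Complex x y) = cN2" if "x < ?A" "?C < x" by (rule cN2; use xy that in \<open>unfold clamp_to_def, argo\<close>)
    show "f (Complex x y) = cE" if "?A < x" "?C < x" by (rule cE; use xy that in argo)
    show "f (Complex x y) = cS2" if "?A < x" "?B < x" "x < ?C" by (rule cS2; use xy that in \<open>unfold clamp_to_def, argo\<close>)
    show "f (Complex x y) = cS1" if "?A < x" "x < ?B" by (rule cS1; use xy that in \<open>unfold clamp_to_def, argo\<close>)
  qed
  then show ?thesis using that by blast
qed

lemma \<Omega>7_vertices:
  assumes col: "\<Omega>7_coloured f cW cN1 cN2 cE cS2 cS1"
  shows "colours_at curve_\<Omega>7 f (Complex (-2) (-2)) = {cS2, cS1, cN1, cW}"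
    "colours_at curve_\<Omega>7 f (Complex 2 2) = {cE, cS2, cN2, cN1}"
proof -
  note F = \<Omega>7_colouredD[OF col, unfolded clamp_to_def]
  show "colours_at curve_\<Omega>7 f (Complex (-2) (-2)) = {cS2, cS1, cN1, cW}"
  proof (rule colours_at_crossing[where a = 1 and b = "-1" and c = 1 and d = 1 and e = 1])
    fix x y :: real assume xy: "\<bar>x - -2\<bar> < 1" "\<bar>y - -2\<bar> < 1"
    let ?s = "1 * (x - -2) + -1 * (y - -2)" and ?t = "1 * (x - -2) + 1 * (y - -2)"
    show "Complex x y \<in> curve_\<Omega>7 \<longleftrightarrow> ?s = 0 \<or> ?t = 0"
      using xy unfolding curve_\<Omega>7_Complex clamp_to_def by argo
    show "f (Complex x y) = cS2" if "?s > 0" "?t > 0" by (rule F(5); use xy that in argo)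
    show "f (Complex x y) = cS1" if "?s > 0" "?t < 0" by (rule F(6); use xy that in argo)
    show "f (Complex x y) = cN1" if "?s < 0" "?t > 0" by (rule F(2); use xy that in argo)
    show "f (Complex x y) = cW" if "?s < 0" "?t < 0" by (rule F(1); use xy that in argo)
  qed simp_all
  show "colours_at curve_\<Omega>7 f (Complex 2 2) = {cE, cS2, cN2, cN1}"
  proof (rule colours_at_crossing[where a = 1 and b = "-1" and c = 1 and d = 1 and e = 1])
    fix x y :: real assume xy: "\<bar>x - 2\<bar> < 1" "\<bar>y - 2\<bar> < 1"
    let ?s = "1 * (x - 2) + -1 * (y - 2)" and ?t = "1 * (x - 2) + 1 * (y - 2)"
    show "Complex x y \<in> curve_\<Omega>7 \<longleftrightarrow> ?s = 0 \<or> ?t = 0"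
      using xy unfolding curve_\<Omega>7_Complex clamp_to_def by argo
    show "f (Complex x y) = cE" if "?s > 0" "?t > 0" by (rule F(4); use xy that in argo)
    show "f (Complex x y) = cS2" if "?s > 0" "?t < 0" by (rule F(5); use xy that in argo)
    show "f (Complex x y) = cN2" if "?s < 0" "?t > 0" by (rule F(3); use xy that in argo)
    show "f (Complex x y) = cN1" if "?s < 0" "?t < 0" by (rule F(2); use xy that in argo)
  qed simp_all
qed

lemma \<Omega>7_checker:
  fixes f :: "complex \<Rightarrow> bool \<times> bool"
  assumes col: "\<Omega>7_coloured f cW cN1 cN2 cE cS2 cS1" and f: "disk_colouring curve_\<Omega>7 M f"
  shows "fst cN1 \<noteq> fst cW" "fst cN2 \<noteq> fst cN1" "fst cE \<noteq> fst cN2" "fst cE \<noteq> fst cS2" "fst cS2 \<noteq> fst cS1"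
proof -
  note F = \<Omega>7_colouredD[OF col, unfolded clamp_to_def]
  have 1: "fst ` colours_at curve_\<Omega>7 f p = UNIV" if "p \<in> curve_\<Omega>7" "p \<in> disk_interior" for p
    using f that by (simp add: disk_colouring_def)
  note sev = curve_\<Omega>7_Complex clamp_to_def
  have "colours_at curve_\<Omega>7 f (Complex (-4) 4) = {cN1, cW}"
  proof (rule colours_at_vertical_edge[of 1])
    fix x y :: real assume xy: "\<bar>x - -4\<bar> < 1" "\<bar>y - 4\<bar> < 1"
    show "Complex x y \<in> curve_\<Omega>7 \<longleftrightarrow> x = -4" using xy unfolding sev by argo
    show "f (Complex x y) = cN1" if "x > -4" by (rule F(2); use xy that in argo)
    show "f (Complex x y) = cW" if "x < -4" by (rule F(1); use xy that in argo)
  qed simp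
  then show "fst cN1 \<noteq> fst cW" by (rule fst_image_UNIV_D) (rule 1; simp add: sev)
  have "colours_at curve_\<Omega>7 f (Complex 0 6) = {cN2, cN1}"
  proof (rule colours_at_vertical_edge[of 1])
    fix x y :: real assume xy: "\<bar>x - 0\<bar> < 1" "\<bar>y - 6\<bar> < 1"
    show "Complex x y \<in> curve_\<Omega>7 \<longleftrightarrow> x = 0" using xy unfolding sev by argo
    show "f (Complex x y) = cN2" if "x > 0" by (rule F(3); use xy that in argo)
    show "f (Complex x y) = cN1" if "x < 0" by (rule F(2); use xy that in argo)
  qed simp
  then show "fst cN2 \<noteq> fst cN1" by (rule fst_image_UNIV_D) (rule 1; simp add: sev)
  have "colours_at curve_\<Omega>7 f (Complex 4 6) = {cE, cN2}"
  proof (rule colours_at_vertical_edge[of 1])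
    fix x y :: real assume xy: "\<bar>x - 4\<bar> < 1" "\<bar>y - 6\<bar> < 1"
    show "Complex x y \<in> curve_\<Omega>7 \<longleftrightarrow> x = 4" using xy unfolding sev by argo
    show "f (Complex x y) = cE" if "x > 4" by (rule F(4); use xy that in argo)
    show "f (Complex x y) = cN2" if "x < 4" by (rule F(3); use xy that in argo)
  qed simp
  then show "fst cE \<noteq> fst cN2" by (rule fst_image_UNIV_D) (rule 1; simp add: sev)
  have "colours_at curve_\<Omega>7 f (Complex 4 (-4)) = {cE, cS2}"
  proof (rule colours_at_vertical_edge[of 1])
    fix x y :: real assume xy: "\<bar>x - 4\<bar> < 1" "\<bar>y - -4\<bar> < 1"
    show "Complex x y \<in> curve_\<Omega>7 \<longleftrightarrow> x = 4" using xy unfolding sev by argo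
    show "f (Complex x y) = cE" if "x > 4" by (rule F(4); use xy that in argo)
    show "f (Complex x y) = cS2" if "x < 4" by (rule F(5); use xy that in argo)
  qed simp
  then show "fst cE \<noteq> fst cS2" by (rule fst_image_UNIV_D) (rule 1; simp add: sev)
  have "colours_at curve_\<Omega>7 f (Complex 0 (-6)) = {cS2, cS1}"
  proof (rule colours_at_vertical_edge[of 1])
    fix x y :: real assume xy: "\<bar>x - 0\<bar> < 1" "\<bar>y - -6\<bar> < 1"
    show "Complex x y \<in> curve_\<Omega>7 \<longleftrightarrow> x = 0" using xy unfolding sev by argo
    show "f (Complex x y) = cS2" if "x > 0" by (rule F(5); use xy that in argo)
    show "f (Complex x y) = cS1" if "x < 0" by (rule F(6); use xy that in argo)
  qed simp
  then show "fst cS2 \<noteq> fst cS1" by (rule fst_image_UNIV_D) (rule 1; simp add: sev)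
qed

text \<open>
  Both double points are marked, which leaves the chequerboard condition.
\<close>

lemma \<Omega>7_disk_colouring:
  fixes f :: "complex \<Rightarrow> bool \<times> bool"
  assumes col: "\<Omega>7_coloured f cW cN1 cN2 cE cS2 cS1"
    and rho: "fst cN1 \<noteq> fst cW" "fst cN2 \<noteq> fst cN1" "fst cE \<noteq> fst cN2" "fst cE \<noteq> fst cS2" "fst cS2 \<noteq> fst cS1"
    and M: "Complex (-2) (-2) \<in> M" "Complex 2 2 \<in> M"
  shows "disk_colouring curve_\<Omega>7 M f"
proof -
  define \<phi> where "\<phi> z = Re z - clamp_to 4 (Im z)" for z
  define \<psi> where "\<psi> z = Re z - (- 2 - clamp_to 2 (Im z + 2))" for z
  define \<theta> where "\<theta> z = Re z - (2 - clamp_to 2 (Im z - 2))" for z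
  have cont: "continuous_on UNIV \<phi>" "continuous_on UNIV \<psi>" "continuous_on UNIV \<theta>"
    unfolding \<phi>_def \<psi>_def \<theta>_def by (intro continuous_intros)+
  define G where "G s t r = (if s then if r then cE else if t then cS2 else cS1
    else if t then if r then cN2 else cN1 else cW)" for s t r :: bool
  have C: "z \<in> curve_\<Omega>7 \<longleftrightarrow> \<phi> z = 0 \<or> \<psi> z = 0 \<or> \<theta> z = 0" if "z \<in> disk_interior" for z
    using that by (auto simp: disk_interior_def curve_\<Omega>7_def \<phi>_def \<psi>_def \<theta>_def)
  \<comment> \<open>The lower strand runs to the left of the upper one, so not all sign patterns occur.\<close>
  have order: "\<psi> z > 0" if "\<theta> z > 0" for z
    using that unfolding \<psi>_def \<theta>_def clamp_to_def by argo
  have order': "\<theta> z < 0" if "\<psi> z = 0" for z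
    using that unfolding \<psi>_def \<theta>_def clamp_to_def by argo
  have order'': "\<psi> z > 0" if "\<theta> z = 0" for z
    using that unfolding \<psi>_def \<theta>_def clamp_to_def by argo
  have fG: "f z = G (\<phi> z > 0) (\<psi> z > 0) (\<theta> z > 0)" if "z \<in> disk_interior" "z \<notin> curve_\<Omega>7" for z
  proof -
    note F = \<Omega>7_colouredD[OF col, of "Re z" "Im z", simplified complex.collapse]
    have xy: "\<bar>Re z\<bar> < 8" "\<bar>Im z\<bar> < 8" using that(1) by (simp_all add: disk_interior_def)
    have nz: "\<phi> z \<noteq> 0" "\<psi> z \<noteq> 0" "\<theta> z \<noteq> 0" using C that by auto
    show ?thesis
      using F[OF xy] nz order[of z] unfolding G_def \<phi>_def \<psi>_def \<theta>_def
      by (auto simp: not_less_iff_gr_or_eq)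
  qed
  have lc: "locally_constant_off (curve_\<Omega>7 \<union> - disk_interior) f"
    by (rule locally_constant_signs[OF cont, where G = G]) (use C fG in auto)
  have edge: "\<exists>c d. fst c \<noteq> fst d \<and> colours_at curve_\<Omega>7 f p = {c, d}"
    if p: "p \<in> curve_\<Omega>7" "p \<in> disk_interior" "p \<noteq> Complex (-2) (-2)" "p \<noteq> Complex 2 2" for p
  proof -
    obtain u v where uv: "p = Complex u v" by (cases p)
    have cl: "p \<in> closure {z. \<xi> z > 0}" "p \<in> closure {z. \<xi> z < 0}"
      if "\<xi> p = 0" "\<And>z. \<xi> z = Re z - w (Im z)" for \<xi> w
    proof -
      show "p \<in> closure {z. \<xi> z > 0}" unfolding uv
        by (rule mem_closure_pos(1)[where a = 1 and b = 0]) (use that in \<open>simp add: uv\<close>)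
      show "p \<in> closure {z. \<xi> z < 0}" unfolding uv
        by (rule mem_closure_pos(2)[where a = "-1" and b = 0]) (use that in \<open>simp add: uv\<close>)
    qed
    have cl\<phi>: "p \<in> closure {z. \<phi> z > 0}" "p \<in> closure {z. \<phi> z < 0}" if "\<phi> p = 0"
      using cl[of \<phi>, OF that \<phi>_def] by blast+
    have cl\<psi>: "p \<in> closure {z. \<psi> z > 0}" "p \<in> closure {z. \<psi> z < 0}" if "\<psi> p = 0"
      using cl[of \<psi> "\<lambda>y. - 2 - clamp_to 2 (y + 2)", OF that \<psi>_def] by blast+
    have cl\<theta>: "p \<in> closure {z. \<theta> z > 0}" "p \<in> closure {z. \<theta> z < 0}" if "\<theta> p = 0"
      using cl[of \<theta> "\<lambda>y. 2 - clamp_to 2 (y - 2)", OF that \<theta>_def] by blast+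
    have P: "\<not> (u = -2 \<and> v = -2)" "\<not> (u = 2 \<and> v = 2)" using p by (auto simp: uv)
    have dbl: "\<not> (\<phi> p = 0 \<and> \<psi> p = 0)" "\<not> (\<phi> p = 0 \<and> \<theta> p = 0)"
      using P unfolding \<phi>_def \<psi>_def \<theta>_def uv complex.sel clamp_to_def by argo+
    consider "\<phi> p = 0" | "\<psi> p = 0" | "\<theta> p = 0" using C p by blast
    then show ?thesis
    proof cases
      case 1
      then have nz: "\<psi> p \<noteq> 0" "\<theta> p \<noteq> 0" using dbl by auto
      have "colours_at curve_\<Omega>7 f p = {G True (\<psi> p > 0) (\<theta> p > 0), G False (\<psi> p > 0) (\<theta> p > 0)}"
        by (rule colours_at_wall3[OF cont, where G = G])
          (use C fG p nz cl\<phi> 1 in auto)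
      moreover have "fst (G True (\<psi> p > 0) (\<theta> p > 0)) \<noteq> fst (G False (\<psi> p > 0) (\<theta> p > 0))"
        using rho order[of p] by (auto simp: G_def)
      ultimately show ?thesis by blast
    next
      case 2
      then have nz: "\<phi> p \<noteq> 0" "\<theta> p < 0" using dbl order' by auto
      have "colours_at curve_\<Omega>7 f p = {G (\<phi> p > 0) True (\<theta> p > 0), G (\<phi> p > 0) False (\<theta> p > 0)}"
        by (rule colours_at_wall3[OF cont(2) cont(1) cont(3), where G = "\<lambda>t s r. G s t r"])
          (use C fG p nz cl\<psi> 2 in auto)
      moreover have "fst (G (\<phi> p > 0) True (\<theta> p > 0)) \<noteq> fst (G (\<phi> p > 0) False (\<theta> p > 0))"
        using rho nz by (auto simp: G_def)
      ultimately show ?thesis by blast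
    next
      case 3
      then have nz: "\<phi> p \<noteq> 0" "\<psi> p > 0" using dbl order'' by auto
      have "colours_at curve_\<Omega>7 f p = {G (\<phi> p > 0) (\<psi> p > 0) True, G (\<phi> p > 0) (\<psi> p > 0) False}"
        by (rule colours_at_wall3[OF cont(3) cont(1) cont(2), where G = "\<lambda>r s t. G s t r"])
          (use C fG p nz cl\<theta> 3 in auto)
      moreover have "fst (G (\<phi> p > 0) (\<psi> p > 0) True) \<noteq> fst (G (\<phi> p > 0) (\<psi> p > 0) False)"
        using rho nz by (auto simp: G_def)
      ultimately show ?thesis by blast
    qed
  qed
  show ?thesis
    unfolding disk_colouring_def
  proof (intro conjI ballI lc)
    show "fst ` colours_at curve_\<Omega>7 f p = UNIV" if p: "p \<in> curve_\<Omega>7 \<inter> disk_interior" for p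
    proof -
      consider "p = Complex (-2) (-2)" | "p = Complex 2 2" | "p \<noteq> Complex (-2) (-2)" "p \<noteq> Complex 2 2" by blast
      then show ?thesis
      proof cases
        case 1
        show ?thesis unfolding 1 \<Omega>7_vertices[OF col]
          by (rule fst_image_UNIV[of cN1 _ cW]) (use rho in auto)
      next
        case 2
        show ?thesis unfolding 2 \<Omega>7_vertices[OF col]
          by (rule fst_image_UNIV[of cN2 _ cN1]) (use rho in auto)
      next
        case 3
        then obtain c d where "fst c \<noteq> fst d" and eq: "colours_at curve_\<Omega>7 f p = {c, d}"
          using edge[of p] p by auto
        then show ?thesis unfolding eq by (intro fst_image_UNIV[of c _ d]) auto
      qed
    qed
    show "card (colours_at curve_\<Omega>7 f p) \<noteq> 3" if p: "p \<in> curve_\<Omega>7 \<inter> disk_interior - M" for p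
    proof -
      have "p \<noteq> Complex (-2) (-2)" "p \<noteq> Complex 2 2" using p M by auto
      then obtain c d where eq: "colours_at curve_\<Omega>7 f p = {c, d}" using edge[of p] p by auto
      show ?thesis unfolding eq by (rule two_colours)
    qed
  qed
qed

text \<open>
  The marker of \<open>v\<close> is vertical, in \<open>cN1\<close> and \<open>cS1\<close>; that of \<open>v'\<close> is horizontal, in \<open>cN1\<close> and \<open>cE\<close>.
  All these regions have the same shading, which explains the common factor.
\<close>

lemma \<Omega>7_rainbow:
  fixes f :: "complex \<Rightarrow> bool \<times> bool"
  assumes col: "\<Omega>7_coloured f cW cN1 cN2 cE cS2 cS1" 
    and f: "disk_colouring curve_\<Omega>7 (tick \<i> (-2, -2) \<union> tick 1 (2, 2)) f"
  shows "finite (rainbow curve_\<Omega>7 (tick \<i> (-2, -2) \<union> tick 1 (2, 2)) f)"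
    "odd (card (rainbow curve_\<Omega>7 (tick \<i> (-2, -2) \<union> tick 1 (2, 2)) f)) \<longleftrightarrow>
       fst cN1 \<and> ((snd cS2 \<noteq> snd cW \<and> snd cS1 \<noteq> snd cN1) \<noteq> (snd cE \<noteq> snd cN1 \<and> snd cS2 \<noteq> snd cN2))"
proof -
  let ?M = "tick \<i> (-2, -2) \<union> tick 1 (2, 2)" and ?v = "Complex (-2) (-2)" and ?v' = "Complex 2 2"
  note F = \<Omega>7_colouredD[OF col, unfolded clamp_to_def]
  note rho = \<Omega>7_checker[OF col f]
  have M: "z \<in> ?M \<longleftrightarrow> Re z = -2 \<and> \<bar>Im z - -2\<bar> \<le> 1/2 \<or> Im z = 2 \<and> \<bar>Re z - 2\<bar> \<le> 1/2" for z
    using tick_i[of "Re z" "Im z" "-2" "-2"] tick_1[of "Re z" "Im z" 2 2] by simp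
  have S: "z \<in> curve_\<Omega>7 \<longleftrightarrow> \<bar>Im z\<bar> \<le> 8 \<and> (Re z = clamp_to 4 (Im z) \<or> Re z = - 2 - clamp_to 2 (Im z + 2) \<or>
     Re z = 2 - clamp_to 2 (Im z - 2))" for z by (simp add: curve_\<Omega>7_def)
  have "?M \<inter> curve_\<Omega>7 \<subseteq> {?v, ?v'}"
  proof
    fix z assume z: "z \<in> ?M \<inter> curve_\<Omega>7"
    then have "Re z = -2 \<and> Im z = -2 \<or> Re z = 2 \<and> Im z = 2"
      unfolding Int_iff M S clamp_to_def by argo
    then show "z \<in> {?v, ?v'}" by (simp add: complex_eq_iff)
  qed
  moreover have "?M \<subseteq> disk_interior"
  proof
    fix z assume "z \<in> ?M"
    then show "z \<in> disk_interior" unfolding M disk_interior_def mem_Collect_eq by argo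
  qed
  ultimately have sub: "rainbow curve_\<Omega>7 ?M f \<subseteq> {?v, ?v'}" using rainbow_subset[OF f] by blast
  have colour: "fst (f z) = fst cN1" if "z \<in> ?M - curve_\<Omega>7" for z
  proof -
    have z: "Re z = -2 \<and> \<bar>Im z - -2\<bar> \<le> 1/2 \<and> Im z \<noteq> -2 \<or> Im z = 2 \<and> \<bar>Re z - 2\<bar> \<le> 1/2 \<and> Re z \<noteq> 2"
      using that unfolding Diff_iff M S clamp_to_def by argo
    then consider "Re z = -2" "\<bar>Im z - -2\<bar> \<le> 1/2" "Im z < -2" | "Re z = -2" "\<bar>Im z - -2\<bar> \<le> 1/2" "Im z > -2"
      | "Im z = 2" "\<bar>Re z - 2\<bar> \<le> 1/2" "Re z < 2" | "Im z = 2" "\<bar>Re z - 2\<bar> \<le> 1/2" "Re z > 2" by argo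
    then have "f (Complex (Re z) (Im z)) \<in> {cN1, cS1, cE}"
    proof cases
      case 1
      have "f (Complex (Re z) (Im z)) = cS1" by (rule F(6); use 1 in argo)
      then show ?thesis by blast
    next
      case 2
      have "f (Complex (Re z) (Im z)) = cN1" by (rule F(2); use 2 in argo)
      then show ?thesis by blast
    next
      case 3
      have "f (Complex (Re z) (Im z)) = cN1" by (rule F(2); use 3 in argo)
      then show ?thesis by blast
    next
      case 4
      have "f (Complex (Re z) (Im z)) = cE" by (rule F(4); use 4 in argo)
      then show ?thesis by blast
    qed
    then show ?thesis using rho by auto
  qed
  have v: "?v \<in> rainbow curve_\<Omega>7 ?M f \<longleftrightarrow> colours_at curve_\<Omega>7 f ?v = UNIV \<and> fst cN1"
  proof (rule rainbow_mem[where N = UNIV])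
    show "?v \<in> closure (?M - curve_\<Omega>7)"
    proof (rule mem_closure_ray_xy[of "1/2" "-2" 0 "-2" 1])
      fix t :: real assume "0 < t" "t < 1/2"
      then show "Complex (-2 + t * 0) (-2 + t * 1) \<in> ?M - curve_\<Omega>7"
        unfolding Diff_iff M S complex.sel clamp_to_def by argo
    qed simp
  qed (use colour M in auto)
  have v': "?v' \<in> rainbow curve_\<Omega>7 ?M f \<longleftrightarrow> colours_at curve_\<Omega>7 f ?v' = UNIV \<and> fst cN1"
  proof (rule rainbow_mem[where N = UNIV])
    show "?v' \<in> closure (?M - curve_\<Omega>7)"
    proof (rule mem_closure_ray_xy[of "1/2" 2 1 2 0])
      fix t :: real assume "0 < t" "t < 1/2"
      then show "Complex (2 + t * 1) (2 + t * 0) \<in> ?M - curve_\<Omega>7"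
        unfolding Diff_iff M S complex.sel clamp_to_def by argo
    qed simp
  qed (use colour M in auto)
  have A: "colours_at curve_\<Omega>7 f ?v = UNIV \<longleftrightarrow> snd cS2 \<noteq> snd cW \<and> snd cS1 \<noteq> snd cN1"
    unfolding \<Omega>7_vertices[OF col] by (rule rainbow_crossing_iff) (use rho in auto)
  have B: "colours_at curve_\<Omega>7 f ?v' = UNIV \<longleftrightarrow> snd cE \<noteq> snd cN1 \<and> snd cS2 \<noteq> snd cN2"
    unfolding \<Omega>7_vertices[OF col] by (rule rainbow_crossing_iff) (use rho in auto)
  have eq: "rainbow curve_\<Omega>7 ?M f = (if ?v \<in> rainbow curve_\<Omega>7 ?M f then {?v} else {}) \<union> (if ?v' \<in> rainbow curve_\<Omega>7 ?M f then {?v'} else {})"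
    using sub by auto
  show "finite (rainbow curve_\<Omega>7 ?M f)" using sub by (rule finite_subset) simp
  show "odd (card (rainbow curve_\<Omega>7 ?M f)) \<longleftrightarrow>
       fst cN1 \<and> ((snd cS2 \<noteq> snd cW \<and> snd cS1 \<noteq> snd cN1) \<noteq> (snd cE \<noteq> snd cN1 \<and> snd cS2 \<noteq> snd cN2))"
    by (subst eq, unfold v v' A B) auto
qed

text \<open>
  Under the move every region keeps its colour and its arcs on the boundary of the disk, while upside
  down \<open>cN1\<close> takes the place of \<open>cS1\<close> and \<open>cN2\<close> that of \<open>cS2\<close>.  Equality of the parities is the identity in
  six bits stated at the beginning.
\<close>

lemma transfers_\<Omega>7:
  "transfers curve_\<Omega>7 (tick \<i> (-2, -2) \<union> tick 1 (2, 2)) (cnj ` curve_\<Omega>7) (cnj ` (tick \<i> (-2, -2) \<union> tick 1 (2, 2)))"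
proof (rule transfers_reflect)
  let ?M = "tick \<i> (-2, -2) \<union> tick 1 (2, 2)"
  show "Complex x y \<in> curve_\<Omega>7 \<longleftrightarrow> Complex x (- y) \<in> curve_\<Omega>7" if "\<not> (\<bar>x\<bar> \<le> 7 \<and> \<bar>y\<bar> \<le> 7)" for x y
    using that unfolding curve_\<Omega>7_Complex clamp_to_def by argo
  show "\<bar>x\<bar> \<le> 7 \<and> \<bar>y\<bar> \<le> 7" if "Complex x y \<in> ?M" for x y
    using that unfolding Un_iff tick_i tick_1 by argo
  fix f assume f: "disk_colouring curve_\<Omega>7 ?M f"
  obtain cW cN1 cN2 cE cS2 cS1 where col: "\<Omega>7_coloured f cW cN1 cN2 cE cS2 cS1"
    using \<Omega>7_regions[of f] f unfolding disk_colouring_def by blast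
  note rho = \<Omega>7_checker[OF col f]
  define g where "g z = (if Re z < clamp_to 4 (Im z)
      then if Re z < - 2 - clamp_to 2 (Im z + 2) then cW else if Re z < 2 - clamp_to 2 (Im z - 2) then cS1 else cS2
      else if 2 - clamp_to 2 (Im z - 2) < Re z then cE else if - 2 - clamp_to 2 (Im z + 2) < Re z then cN2 else cN1)" for z
  have colg: "\<Omega>7_coloured g cW cS1 cS2 cE cN2 cN1"
    unfolding \<Omega>7_coloured_def g_def complex.sel clamp_to_def
    by (intro allI impI conjI; elim conjE; ((subst if_not_P, argo) | (subst if_P, argo))+; rule refl)
  have g: "disk_colouring curve_\<Omega>7 ?M g"
    by (rule \<Omega>7_disk_colouring[OF colg]) (use rho in \<open>auto simp: tick_i tick_1\<close>)
  have "odd (card (rainbow curve_\<Omega>7 ?M f)) \<longleftrightarrow> odd (card (rainbow curve_\<Omega>7 ?M g))"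
    unfolding \<Omega>7_rainbow(2)[OF col f] \<Omega>7_rainbow(2)[OF colg g] using rho by argo
  moreover have "g (Complex x (- y)) = f (Complex x y)"
    if xy: "\<bar>x\<bar> < 8" "\<bar>y\<bar> < 8" "\<not> (\<bar>x\<bar> \<le> 7 \<and> \<bar>y\<bar> \<le> 7)" "Complex x y \<notin> curve_\<Omega>7" for x y
  proof -
    have y': "\<bar>- y\<bar> < 8" using xy by simp
    note F = \<Omega>7_colouredD[OF col xy(1,2), unfolded clamp_to_def]
    note G = \<Omega>7_colouredD[OF colg xy(1) y', unfolded clamp_to_def]
    consider "x < -4" | "x > 4" | "-4 < x" "x < 0" "y > 7" | "-4 < x" "x < 0" "y < -7"
      | "0 < x" "x < 4" "y > 7" | "0 < x" "x < 4" "y < -7"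
      using xy unfolding curve_\<Omega>7_Complex clamp_to_def by argo
    then show ?thesis
    proof cases
      case 1
      show ?thesis by (rule trans[OF G(1) F(1)[symmetric]]; use xy(1-3) 1 in argo)
    next
      case 2
      show ?thesis by (rule trans[OF G(4) F(4)[symmetric]]; use xy(1-3) 2 in argo)
    next
      case 3
      show ?thesis by (rule trans[OF G(6) F(2)[symmetric]]; use xy(1-3) 3 in argo)
    next
      case 4
      show ?thesis by (rule trans[OF G(2) F(6)[symmetric]]; use xy(1-3) 4 in argo)
    next
      case 5
      show ?thesis by (rule trans[OF G(5) F(3)[symmetric]]; use xy(1-3) 5 in argo)
    next
      case 6
      show ?thesis by (rule trans[OF G(3) F(5)[symmetric]]; use xy(1-3) 6 in argo)
    qed
  qed
  ultimately show "\<exists>g. (\<forall>x y. \<bar>x\<bar> < 8 \<longrightarrow> \<bar>y\<bar> < 8 \<longrightarrow> \<not> (\<bar>x\<bar> \<le> 7 \<and> \<bar>y\<bar> \<le> 7) \<longrightarrow> Complex x y \<notin> curve_\<Omega>7 \<longrightarrow>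
              g (Complex x (- y)) = f (Complex x y)) \<and>
           disk_colouring curve_\<Omega>7 ?M g \<and> finite (rainbow curve_\<Omega>7 ?M g) \<and>
           (odd (card (rainbow curve_\<Omega>7 ?M f)) \<longleftrightarrow> odd (card (rainbow curve_\<Omega>7 ?M g)))"
    using g \<Omega>7_rainbow(1)[OF colg g] by blast
qed

section \<open>Moving a strand across a crossing\<close>

definition curve_\<Omega>3 :: "complex set" where
  "curve_\<Omega>3 = {z. \<bar>Im z\<bar> \<le> 8 \<and> (Re z = clamp_to 6 (Im z) \<or> Re z = - clamp_to 6 (Im z)) \<or>
     \<bar>Re z\<bar> \<le> 8 \<and> Im z = - bump (Re z)}"

lemma curve_\<Omega>3_Complex:
  "Complex x y \<in> curve_\<Omega>3 \<longleftrightarrow> \<bar>y\<bar> \<le> 8 \<and> (x = clamp_to 6 y \<or> x = - clamp_to 6 y) \<or> \<bar>x\<bar> \<le> 8 \<and> y = - bump x"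
  by (simp add: curve_\<Omega>3_def)

text \<open>
  The six regions at the boundary of the disk are named after the points of the compass, \<open>cNW\<close> and \<open>cNE\<close>
  lying above the strand \<open>H\<close> and \<open>cSW\<close> and \<open>cSE\<close> below it; \<open>cT\<close> is the triangle.
\<close>

definition \<Omega>3_coloured :: "(complex \<Rightarrow> 'a) \<Rightarrow> 'a \<Rightarrow> 'a \<Rightarrow> 'a \<Rightarrow> 'a \<Rightarrow> 'a \<Rightarrow> 'a \<Rightarrow> 'a \<Rightarrow> bool" where
  "\<Omega>3_coloured f cN cNW cNE cT cSW cSE cS \<longleftrightarrow> (\<forall>x y. \<bar>x\<bar> < 8 \<longrightarrow> \<bar>y\<bar> < 8 \<longrightarrow>
     (- bump x < y \<and> x < clamp_to 6 y \<and> - clamp_to 6 y < x \<longrightarrow> f (Complex x y) = cN) \<and>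
     (- bump x < y \<and> x < clamp_to 6 y \<and> x < - clamp_to 6 y \<longrightarrow> f (Complex x y) = cNW) \<and>
     (- bump x < y \<and> clamp_to 6 y < x \<and> - clamp_to 6 y < x \<longrightarrow> f (Complex x y) = cNE) \<and>
     (- bump x < y \<and> clamp_to 6 y < x \<and> x < - clamp_to 6 y \<longrightarrow> f (Complex x y) = cT) \<and>
     (y < - bump x \<and> x < clamp_to 6 y \<and> x < - clamp_to 6 y \<longrightarrow> f (Complex x y) = cSW) \<and>
     (y < - bump x \<and> clamp_to 6 y < x \<and> - clamp_to 6 y < x \<longrightarrow> f (Complex x y) = cSE) \<and>
     (y < - bump x \<and> clamp_to 6 y < x \<and> x < - clamp_to 6 y \<longrightarrow> f (Complex x y) = cS))"

lemma \<Omega>3_colouredD: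
  assumes "\<Omega>3_coloured f cN cNW cNE cT cSW cSE cS" "\<bar>x\<bar> < 8" "\<bar>y\<bar> < 8"
  shows "- bump x < y \<Longrightarrow> x < clamp_to 6 y \<Longrightarrow> - clamp_to 6 y < x \<Longrightarrow> f (Complex x y) = cN"
    "- bump x < y \<Longrightarrow> x < clamp_to 6 y \<Longrightarrow> x < - clamp_to 6 y \<Longrightarrow> f (Complex x y) = cNW"
    "- bump x < y \<Longrightarrow> clamp_to 6 y < x \<Longrightarrow> - clamp_to 6 y < x \<Longrightarrow> f (Complex x y) = cNE"
    "- bump x < y \<Longrightarrow> clamp_to 6 y < x \<Longrightarrow> x < - clamp_to 6 y \<Longrightarrow> f (Complex x y) = cT"
    "y < - bump x \<Longrightarrow> x < clamp_to 6 y \<Longrightarrow> x < - clamp_to 6 y \<Longrightarrow> f (Complex x y) = cSW"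
    "y < - bump x \<Longrightarrow> clamp_to 6 y < x \<Longrightarrow> - clamp_to 6 y < x \<Longrightarrow> f (Complex x y) = cSE"
    "y < - bump x \<Longrightarrow> clamp_to 6 y < x \<Longrightarrow> x < - clamp_to 6 y \<Longrightarrow> f (Complex x y) = cS"
  using assms unfolding \<Omega>3_coloured_def by blast+

text \<open>
  The triangle and the regions at the top and at the bottom lie between graphs over the ordinate.
  Each of the others is the union of two overlapping sets between graphs over the abscissa, one of
  them along the side of the disk.
\<close>

lemma \<Omega>3_regions:
  assumes f: "locally_constant_off (curve_\<Omega>3 \<union> - disk_interior) f"
  obtains cN cNW cNE cT cSW cSE cS where "\<Omega>3_coloured f cN cNW cNE cT cSW cSE cS"
proof -
  note constx = constant_between_xgraphs[OF f]
  note consty = constant_between_ygraphs[OF f]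
  note pw = curve_\<Omega>3_Complex clamp_to_def bump_def
  have "\<exists>c. \<forall>x y. 0 < y \<longrightarrow> y < 8 \<longrightarrow> - clamp_to 6 y < x \<longrightarrow> x < clamp_to 6 y \<longrightarrow> f (Complex x y) = c"
    by (rule constx; (intro continuous_intros | (unfold clamp_to_def, argo) | simp add: pw; argo))
  then obtain cN where cN: "\<And>x y. 0 < y \<Longrightarrow> y < 8 \<Longrightarrow> - clamp_to 6 y < x \<Longrightarrow> x < clamp_to 6 y \<Longrightarrow> f (Complex x y) = cN" by blast
  have "\<exists>c. \<forall>x y. -3 < y \<longrightarrow> y < 0 \<longrightarrow> clamp_to 6 y < x \<longrightarrow> x < - clamp_to 6 y \<longrightarrow> f (Complex x y) = c"
    by (rule constx; (intro continuous_intros | (unfold clamp_to_def, argo) | simp add: pw; argo))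
  then obtain cT where cT: "\<And>x y. -3 < y \<Longrightarrow> y < 0 \<Longrightarrow> clamp_to 6 y < x \<Longrightarrow> x < - clamp_to 6 y \<Longrightarrow> f (Complex x y) = cT" by blast
  have "\<exists>c. \<forall>x y. -8 < y \<longrightarrow> y < -3 \<longrightarrow> clamp_to 6 y < x \<longrightarrow> x < - clamp_to 6 y \<longrightarrow> f (Complex x y) = c"
    by (rule constx; (intro continuous_intros | (unfold clamp_to_def, argo) | simp add: pw; argo))
  then obtain cS where cS: "\<And>x y. -8 < y \<Longrightarrow> y < -3 \<Longrightarrow> clamp_to 6 y < x \<Longrightarrow> x < - clamp_to 6 y \<Longrightarrow> f (Complex x y) = cS" by blast
  have "\<exists>c. \<forall>x y. -8 < x \<longrightarrow> x < -6 \<longrightarrow> - bump x < y \<longrightarrow> y < 8 \<longrightarrow> f (Complex x y) = c"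
    by (rule consty; (intro continuous_intros | (unfold bump_def, argo) | simp add: pw; argo))
  then obtain n1 where n1: "\<And>x y. -8 < x \<Longrightarrow> x < -6 \<Longrightarrow> - bump x < y \<Longrightarrow> y < 8 \<Longrightarrow> f (Complex x y) = n1" by blast
  have "\<exists>c. \<forall>x y. -8 < x \<longrightarrow> x < 0 \<longrightarrow> max (- bump x) x < y \<longrightarrow> y < - x \<longrightarrow> f (Complex x y) = c"
    by (rule consty; (intro continuous_intros | (unfold bump_def, argo) | simp add: pw; argo))
  then obtain n2 where n2: "\<And>x y. -8 < x \<Longrightarrow> x < 0 \<Longrightarrow> max (- bump x) x < y \<Longrightarrow> y < - x \<Longrightarrow> f (Complex x y) = n2" by blast
  have "\<exists>c. \<forall>x y. 6 < x \<longrightarrow> x < 8 \<longrightarrow> - bump x < y \<longrightarrow> y < 8 \<longrightarrow> f (Complex x y) = c"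
    by (rule consty; (intro continuous_intros | (unfold bump_def, argo) | simp add: pw; argo))
  then obtain e1 where e1: "\<And>x y. 6 < x \<Longrightarrow> x < 8 \<Longrightarrow> - bump x < y \<Longrightarrow> y < 8 \<Longrightarrow> f (Complex x y) = e1" by blast
  have "\<exists>c. \<forall>x y. 0 < x \<longrightarrow> x < 8 \<longrightarrow> max (- bump x) (- x) < y \<longrightarrow> y < x \<longrightarrow> f (Complex x y) = c"
    by (rule consty; (intro continuous_intros | (unfold bump_def, argo) | simp add: pw; argo))
  then obtain e2 where e2: "\<And>x y. 0 < x \<Longrightarrow> x < 8 \<Longrightarrow> max (- bump x) (- x) < y \<Longrightarrow> y < x \<Longrightarrow> f (Complex x y) = e2" by blast
  have "\<exists>c. \<forall>x y. -8 < x \<longrightarrow> x < -6 \<longrightarrow> -8 < y \<longrightarrow> y < - bump x \<longrightarrow> f (Complex x y) = c"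
    by (rule consty; (intro continuous_intros | (unfold bump_def, argo) | simp add: pw; argo))
  then obtain s1 where s1: "\<And>x y. -8 < x \<Longrightarrow> x < -6 \<Longrightarrow> -8 < y \<Longrightarrow> y < - bump x \<Longrightarrow> f (Complex x y) = s1" by blast
  have "\<exists>c. \<forall>x y. -8 < x \<longrightarrow> x < -3 \<longrightarrow> x < y \<longrightarrow> y < - bump x \<longrightarrow> f (Complex x y) = c"
    by (rule consty; (intro continuous_intros | (unfold bump_def, argo) | simp add: pw; argo))
  then obtain s2 where s2: "\<And>x y. -8 < x \<Longrightarrow> x < -3 \<Longrightarrow> x < y \<Longrightarrow> y < - bump x \<Longrightarrow> f (Complex x y) = s2" by blast
  have "\<exists>c. \<forall>x y. 6 < x \<longrightarrow> x < 8 \<longrightarrow> -8 < y \<longrightarrow> y < - bump x \<longrightarrow> f (Complex x y) = c"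
    by (rule consty; (intro continuous_intros | (unfold bump_def, argo) | simp add: pw; argo))
  then obtain r1 where r1: "\<And>x y. 6 < x \<Longrightarrow> x < 8 \<Longrightarrow> -8 < y \<Longrightarrow> y < - bump x \<Longrightarrow> f (Complex x y) = r1" by blast
  have "\<exists>c. \<forall>x y. 3 < x \<longrightarrow> x < 8 \<longrightarrow> - x < y \<longrightarrow> y < - bump x \<longrightarrow> f (Complex x y) = c"
    by (rule consty; (intro continuous_intros | (unfold bump_def, argo) | simp add: pw; argo))
  then obtain r2 where r2: "\<And>x y. 3 < x \<Longrightarrow> x < 8 \<Longrightarrow> - x < y \<Longrightarrow> y < - bump x \<Longrightarrow> f (Complex x y) = r2" by blast
  have eq: "n2 = n1" "e2 = e1" "s2 = s1" "r2 = r1"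
    using n1[of "-7" 1] n2[of "-7" 1] e1[of 7 1] e2[of 7 1] s1[of "-7" "-1"] s2[of "-7" "-1"] r1[of 7 "-1"] r2[of 7 "-1"]
    by (simp_all add: bump_def)
  have "\<Omega>3_coloured f cN n1 e1 cT s1 r1 cS"
    unfolding \<Omega>3_coloured_def
  proof (intro allI impI conjI; elim conjE)
    fix x y :: real assume xy: "\<bar>x\<bar> < 8" "\<bar>y\<bar> < 8"
    let ?A = "clamp_to 6 y" and ?h = "- bump x"
    show "f (Complex x y) = cN" if "?h < y" "x < ?A" "- ?A < x"
      by (rule cN; use xy that in \<open>unfold clamp_to_def, argo\<close>)
    show "f (Complex x y) = n1" if that: "?h < y" "x < ?A" "x < - ?A"
    proof (cases "x < -6")
      case True
      show ?thesis by (rule n1; use xy that True in argo)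
    next
      case False
      show ?thesis unfolding eq(1)[symmetric] by (rule n2; use xy that False in \<open>unfold clamp_to_def, argo\<close>)
    qed
    show "f (Complex x y) = e1" if that: "?h < y" "?A < x" "- ?A < x"
    proof (cases "x > 6")
      case True
      show ?thesis by (rule e1; use xy that True in argo)
    next
      case False
      show ?thesis unfolding eq(2)[symmetric] by (rule e2; use xy that False in \<open>unfold clamp_to_def, argo\<close>)
    qed
    show "f (Complex x y) = cT" if "?h < y" "?A < x" "x < - ?A"
      by (rule cT; use xy that in \<open>unfold clamp_to_def bump_def, argo\<close>)
    show "f (Complex x y) = s1" if that: "y < ?h" "x < ?A" "x < - ?A"
    proof (cases "x < -6")
      case True
      show ?thesis by (rule s1; use xy that True in argo)
    next
      case False
      show ?thesis unfolding eq(3)[symmetric] by (rule s2; use xy that False in \<open>unfold clamp_to_def bump_def, argo\<close>)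
    qed
    show "f (Complex x y) = r1" if that: "y < ?h" "?A < x" "- ?A < x"
    proof (cases "x > 6")
      case True
      show ?thesis by (rule r1; use xy that True in argo)
    next
      case False
      show ?thesis unfolding eq(4)[symmetric] by (rule r2; use xy that False in \<open>unfold clamp_to_def bump_def, argo\<close>)
    qed
    show "f (Complex x y) = cS" if "y < ?h" "?A < x" "x < - ?A"
      by (rule cS; use xy that in \<open>unfold clamp_to_def bump_def, argo\<close>)
  qed
  then show ?thesis using that by blast
qed

lemma \<Omega>3_crossings:
  assumes col: "\<Omega>3_coloured f cN cNW cNE cT cSW cSE cS"
  shows "colours_at curve_\<Omega>3 f (Complex 0 0) = {cNE, cT, cN, cNW}"
    "colours_at curve_\<Omega>3 f (Complex (-3) (-3)) = {cT, cS, cNW, cSW}"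
    "colours_at curve_\<Omega>3 f (Complex 3 (-3)) = {cNE, cSE, cT, cS}"
proof -
  note F = \<Omega>3_colouredD[OF col, unfolded clamp_to_def bump_def]
  note pw = curve_\<Omega>3_Complex clamp_to_def bump_def
  show "colours_at curve_\<Omega>3 f (Complex 0 0) = {cNE, cT, cN, cNW}"
  proof (rule colours_at_crossing[where a = 1 and b = "-1" and c = 1 and d = 1 and e = 1])
    fix x y :: real assume xy: "\<bar>x - 0\<bar> < 1" "\<bar>y - 0\<bar> < 1"
    let ?s = "1 * (x - 0) + -1 * (y - 0)" and ?t = "1 * (x - 0) + 1 * (y - 0)"
    show "Complex x y \<in> curve_\<Omega>3 \<longleftrightarrow> ?s = 0 \<or> ?t = 0" using xy unfolding pw by argo
    show "f (Complex x y) = cNE" if "?s > 0" "?t > 0" by (rule F(3); use xy that in argo)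
    show "f (Complex x y) = cT" if "?s > 0" "?t < 0" by (rule F(4); use xy that in argo)
    show "f (Complex x y) = cN" if "?s < 0" "?t > 0" by (rule F(1); use xy that in argo)
    show "f (Complex x y) = cNW" if "?s < 0" "?t < 0" by (rule F(2); use xy that in argo)
  qed simp_all
  show "colours_at curve_\<Omega>3 f (Complex (-3) (-3)) = {cT, cS, cNW, cSW}"
  proof (rule colours_at_crossing[where a = 1 and b = "-1" and c = 0 and d = 1 and e = 1])
    fix x y :: real assume xy: "\<bar>x - -3\<bar> < 1" "\<bar>y - -3\<bar> < 1"
    let ?s = "1 * (x - -3) + -1 * (y - -3)" and ?t = "0 * (x - -3) + 1 * (y - -3)"
    show "Complex x y \<in> curve_\<Omega>3 \<longleftrightarrow> ?s = 0 \<or> ?t = 0" using xy unfolding pw by argo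
    show "f (Complex x y) = cT" if "?s > 0" "?t > 0" by (rule F(4); use xy that in argo)
    show "f (Complex x y) = cS" if "?s > 0" "?t < 0" by (rule F(7); use xy that in argo)
    show "f (Complex x y) = cNW" if "?s < 0" "?t > 0" by (rule F(2); use xy that in argo)
    show "f (Complex x y) = cSW" if "?s < 0" "?t < 0" by (rule F(5); use xy that in argo)
  qed simp_all
  show "colours_at curve_\<Omega>3 f (Complex 3 (-3)) = {cNE, cSE, cT, cS}"
  proof (rule colours_at_crossing[where a = 1 and b = 1 and c = 0 and d = 1 and e = 1])
    fix x y :: real assume xy: "\<bar>x - 3\<bar> < 1" "\<bar>y - -3\<bar> < 1"
    let ?s = "1 * (x - 3) + 1 * (y - -3)" and ?t = "0 * (x - 3) + 1 * (y - -3)"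
    show "Complex x y \<in> curve_\<Omega>3 \<longleftrightarrow> ?s = 0 \<or> ?t = 0" using xy unfolding pw by argo
    show "f (Complex x y) = cNE" if "?s > 0" "?t > 0" by (rule F(3); use xy that in argo)
    show "f (Complex x y) = cSE" if "?s > 0" "?t < 0" by (rule F(6); use xy that in argo)
    show "f (Complex x y) = cT" if "?s < 0" "?t > 0" by (rule F(4); use xy that in argo)
    show "f (Complex x y) = cS" if "?s < 0" "?t < 0" by (rule F(7); use xy that in argo)
  qed simp_all
qed

lemma \<Omega>3_checker:
  fixes f :: "complex \<Rightarrow> bool \<times> bool"
  assumes col: "\<Omega>3_coloured f cN cNW cNE cT cSW cSE cS" and f: "disk_colouring curve_\<Omega>3 M f"
  shows "fst cN \<noteq> fst cNW" "fst cNE \<noteq> fst cN" "fst cNE \<noteq> fst cSE" "fst cNW \<noteq> fst cSW" "fst cT \<noteq> fst cS" "fst cT \<noteq> fst cNW"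
proof -
  note F = \<Omega>3_colouredD[OF col, unfolded clamp_to_def bump_def]
  have 1: "fst ` colours_at curve_\<Omega>3 f p = UNIV" if "p \<in> curve_\<Omega>3" "p \<in> disk_interior" for p
    using f that by (simp add: disk_colouring_def)
  note pw = curve_\<Omega>3_Complex clamp_to_def bump_def
  have "colours_at curve_\<Omega>3 f (Complex (-2) 2) = {cN, cNW}"
  proof (rule colours_at_edge[where a = 1 and b = 1 and e = 1])
    fix x y :: real assume xy: "\<bar>x - -2\<bar> < 1" "\<bar>y - 2\<bar> < 1"
    let ?s = "1 * (x - -2) + 1 * (y - 2)"
    show "Complex x y \<in> curve_\<Omega>3 \<longleftrightarrow> ?s = 0" using xy unfolding pw by argo
    show "f (Complex x y) = cN" if "?s > 0" by (rule F(1); use xy that in argo)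
    show "f (Complex x y) = cNW" if "?s < 0" by (rule F(2); use xy that in argo)
  qed simp_all
  then show "fst cN \<noteq> fst cNW" by (rule fst_image_UNIV_D) (rule 1; simp add: pw)
  have "colours_at curve_\<Omega>3 f (Complex 2 2) = {cNE, cN}"
  proof (rule colours_at_edge[where a = 1 and b = "-1" and e = 1])
    fix x y :: real assume xy: "\<bar>x - 2\<bar> < 1" "\<bar>y - 2\<bar> < 1"
    let ?s = "1 * (x - 2) + -1 * (y - 2)"
    show "Complex x y \<in> curve_\<Omega>3 \<longleftrightarrow> ?s = 0" using xy unfolding pw by argo
    show "f (Complex x y) = cNE" if "?s > 0" by (rule F(3); use xy that in argo)
    show "f (Complex x y) = cN" if "?s < 0" by (rule F(1); use xy that in argo)
  qed simp_all
  then show "fst cNE \<noteq> fst cN" by (rule fst_image_UNIV_D) (rule 1; simp add: pw)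
  have "colours_at curve_\<Omega>3 f (Complex (15/2) 0) = {cNE, cSE}"
  proof (rule colours_at_edge[where a = 0 and b = 1 and e = "1/2"])
    fix x y :: real assume xy: "\<bar>x - 15/2\<bar> < 1/2" "\<bar>y - 0\<bar> < 1/2"
    let ?s = "0 * (x - 15/2) + 1 * (y - 0)"
    show "Complex x y \<in> curve_\<Omega>3 \<longleftrightarrow> ?s = 0" using xy unfolding pw by argo
    show "f (Complex x y) = cNE" if "?s > 0" by (rule F(3); use xy that in argo)
    show "f (Complex x y) = cSE" if "?s < 0" by (rule F(6); use xy that in argo)
  qed simp_all
  then show "fst cNE \<noteq> fst cSE" by (rule fst_image_UNIV_D) (rule 1; simp add: pw)
  have "colours_at curve_\<Omega>3 f (Complex (-15/2) 0) = {cNW, cSW}"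
  proof (rule colours_at_edge[where a = 0 and b = 1 and e = "1/2"])
    fix x y :: real assume xy: "\<bar>x - -15/2\<bar> < 1/2" "\<bar>y - 0\<bar> < 1/2"
    let ?s = "0 * (x - -15/2) + 1 * (y - 0)"
    show "Complex x y \<in> curve_\<Omega>3 \<longleftrightarrow> ?s = 0" using xy unfolding pw by argo
    show "f (Complex x y) = cNW" if "?s > 0" by (rule F(2); use xy that in argo)
    show "f (Complex x y) = cSW" if "?s < 0" by (rule F(5); use xy that in argo)
  qed simp_all
  then show "fst cNW \<noteq> fst cSW" by (rule fst_image_UNIV_D) (rule 1; simp add: pw)
  have "colours_at curve_\<Omega>3 f (Complex 0 (-3)) = {cT, cS}"
  proof (rule colours_at_edge[where a = 0 and b = 1 and e = 1])
    fix x y :: real assume xy: "\<bar>x - 0\<bar> < 1" "\<bar>y - -3\<bar> < 1"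
    let ?s = "0 * (x - 0) + 1 * (y - -3)"
    show "Complex x y \<in> curve_\<Omega>3 \<longleftrightarrow> ?s = 0" using xy unfolding pw by argo
    show "f (Complex x y) = cT" if "?s > 0" by (rule F(4); use xy that in argo)
    show "f (Complex x y) = cS" if "?s < 0" by (rule F(7); use xy that in argo)
  qed simp_all
  then show "fst cT \<noteq> fst cS" by (rule fst_image_UNIV_D) (rule 1; simp add: pw)
  have "colours_at curve_\<Omega>3 f (Complex (-1) (-1)) = {cT, cNW}"
  proof (rule colours_at_edge[where a = 1 and b = "-1" and e = 1])
    fix x y :: real assume xy: "\<bar>x - -1\<bar> < 1" "\<bar>y - -1\<bar> < 1"
    let ?s = "1 * (x - -1) + -1 * (y - -1)"
    show "Complex x y \<in> curve_\<Omega>3 \<longleftrightarrow> ?s = 0" using xy unfolding pw by argo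
    show "f (Complex x y) = cT" if "?s > 0" by (rule F(4); use xy that in argo)
    show "f (Complex x y) = cNW" if "?s < 0" by (rule F(2); use xy that in argo)
  qed simp_all
  then show "fst cT \<noteq> fst cNW" by (rule fst_image_UNIV_D) (rule 1; simp add: pw)
qed

lemma \<Omega>3_crossing_relations:
  fixes f :: "complex \<Rightarrow> bool \<times> bool"
  assumes col: "\<Omega>3_coloured f cN cNW cNE cT cSW cSE cS" and f: "disk_colouring curve_\<Omega>3 {} f"
  shows "snd cNE = snd cNW \<longleftrightarrow> snd cT = snd cN" "snd cT = snd cSW \<longleftrightarrow> snd cS = snd cNW"
    "snd cNE = snd cS \<longleftrightarrow> snd cSE = snd cT"
proof -
  note rho = \<Omega>3_checker[OF col f]
  have 3: "card (colours_at curve_\<Omega>3 f p) \<noteq> 3" if "p \<in> curve_\<Omega>3" "p \<in> disk_interior" for p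
    using f that by (simp add: disk_colouring_def)
  note pw = curve_\<Omega>3_Complex clamp_to_def bump_def
  have "card {cNE, cT, cN, cNW} \<noteq> 3"
    unfolding \<Omega>3_crossings(1)[OF col, symmetric] by (rule 3) (simp_all add: pw)
  then show "snd cNE = snd cNW \<longleftrightarrow> snd cT = snd cN"
    by (rule iffD1[OF card_crossing_iff, rotated 3]) (use rho in auto)
  have "card {cT, cS, cNW, cSW} \<noteq> 3"
    unfolding \<Omega>3_crossings(2)[OF col, symmetric] by (rule 3) (simp_all add: pw)
  then show "snd cT = snd cSW \<longleftrightarrow> snd cS = snd cNW"
    by (rule iffD1[OF card_crossing_iff, rotated 3]) (use rho in auto)
  have "card {cNE, cSE, cT, cS} \<noteq> 3"
    unfolding \<Omega>3_crossings(3)[OF col, symmetric] by (rule 3) (simp_all add: pw)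
  then show "snd cNE = snd cS \<longleftrightarrow> snd cSE = snd cT"
    by (rule iffD1[OF card_crossing_iff, rotated 3]) (use rho in auto)
qed

text \<open>
  The assumption \<open>O\<close> concerns the double point at the centre, \<open>A\<close> and \<open>B\<close> those where \<open>H\<close> crosses the two
  other strands.
\<close>

lemma \<Omega>3_disk_colouring:
  fixes f :: "complex \<Rightarrow> bool \<times> bool"
  assumes col: "\<Omega>3_coloured f cN cNW cNE cT cSW cSE cS"
    and rho: "fst cN \<noteq> fst cNW" "fst cNE \<noteq> fst cN" "fst cNE \<noteq> fst cSE" "fst cNW \<noteq> fst cSW" "fst cT \<noteq> fst cS" "fst cT \<noteq> fst cNW"
    and O: "Complex 0 0 \<notin> M \<Longrightarrow> (snd cNE = snd cNW \<longleftrightarrow> snd cT = snd cN)"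
    and A: "snd cT = snd cSW \<longleftrightarrow> snd cS = snd cNW"
    and B: "snd cNE = snd cS \<longleftrightarrow> snd cSE = snd cT"
  shows "disk_colouring curve_\<Omega>3 M f"
proof -
  define \<phi> where "\<phi> z = Re z - clamp_to 6 (Im z)" for z
  define \<psi> where "\<psi> z = Re z + clamp_to 6 (Im z)" for z
  define \<theta> where "\<theta> z = Im z + bump (Re z)" for z
  have cont: "continuous_on UNIV \<phi>" "continuous_on UNIV \<psi>" "continuous_on UNIV \<theta>"
    unfolding \<phi>_def \<psi>_def \<theta>_def by (intro continuous_intros)+
  define G where "G s t r = (if r then if s then if t then cNE else cT else if t then cN else cNW
    else if s then if t then cSE else cS else cSW)" for s t r :: bool
  have C: "z \<in> curve_\<Omega>3 \<longleftrightarrow> \<phi> z = 0 \<or> \<psi> z = 0 \<or> \<theta> z = 0" if "z \<in> disk_interior" for z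
    using that by (auto simp: disk_interior_def curve_\<Omega>3_def \<phi>_def \<psi>_def \<theta>_def)
  \<comment> \<open>The first two strands do not cross below \<open>H\<close>, so not all sign patterns occur.\<close>
  have order: "\<psi> z < 0" if "\<theta> z < 0" "\<phi> z \<le> 0" for z
    using that unfolding \<phi>_def \<psi>_def \<theta>_def bump_def clamp_to_def by argo
  have order': "\<phi> z > 0" if "\<theta> z < 0" "\<psi> z = 0" for z
    using that unfolding \<phi>_def \<psi>_def \<theta>_def bump_def clamp_to_def by argo
  have order'': "\<psi> z \<le> 0" if "\<theta> z = 0" "\<phi> z < 0" for z
    using that unfolding \<phi>_def \<psi>_def \<theta>_def bump_def clamp_to_def by argo
  have fG: "f z = G (\<phi> z > 0) (\<psi> z > 0) (\<theta> z > 0)" if "z \<in> disk_interior" "z \<notin> curve_\<Omega>3" for z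
  proof -
    have xy: "\<bar>Re z\<bar> < 8" "\<bar>Im z\<bar> < 8" using that(1) by (simp_all add: disk_interior_def)
    note F = \<Omega>3_colouredD[OF col xy, simplified complex.collapse]
    have nz: "\<phi> z \<noteq> 0" "\<psi> z \<noteq> 0" "\<theta> z \<noteq> 0" using C that by auto
    then consider "\<phi> z > 0" "\<psi> z > 0" "\<theta> z > 0" | "\<phi> z > 0" "\<psi> z < 0" "\<theta> z > 0" | "\<phi> z < 0" "\<psi> z > 0" "\<theta> z > 0"
      | "\<phi> z < 0" "\<psi> z < 0" "\<theta> z > 0" | "\<phi> z > 0" "\<psi> z > 0" "\<theta> z < 0" | "\<phi> z > 0" "\<psi> z < 0" "\<theta> z < 0"
      | "\<phi> z < 0" "\<psi> z < 0" "\<theta> z < 0"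
      using order[of z] by argo
    then show ?thesis
    proof cases
      case 1
      then show ?thesis using F(3) by (simp add: G_def \<phi>_def \<psi>_def \<theta>_def)
    next
      case 2
      then show ?thesis using F(4) by (simp add: G_def \<phi>_def \<psi>_def \<theta>_def)
    next
      case 3
      then show ?thesis using F(1) by (simp add: G_def \<phi>_def \<psi>_def \<theta>_def)
    next
      case 4
      then show ?thesis using F(2) by (simp add: G_def \<phi>_def \<psi>_def \<theta>_def)
    next
      case 5
      then show ?thesis using F(6) by (simp add: G_def \<phi>_def \<psi>_def \<theta>_def)
    next
      case 6
      then show ?thesis using F(7) by (simp add: G_def \<phi>_def \<psi>_def \<theta>_def)
    next
      case 7
      then show ?thesis using F(5) by (simp add: G_def \<phi>_def \<psi>_def \<theta>_def)
    qed
  qed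
  have lc: "locally_constant_off (curve_\<Omega>3 \<union> - disk_interior) f"
    by (rule locally_constant_signs[OF cont, where G = G]) (use C fG in auto)
  have edge: "\<exists>c d. fst c \<noteq> fst d \<and> colours_at curve_\<Omega>3 f p = {c, d}"
    if p: "p \<in> curve_\<Omega>3" "p \<in> disk_interior" "p \<noteq> Complex 0 0" "p \<noteq> Complex (-3) (-3)" "p \<noteq> Complex 3 (-3)" for p
  proof -
    obtain u v where uv: "p = Complex u v" by (cases p)
    have clx: "p \<in> closure {z. \<xi> z > 0}" "p \<in> closure {z. \<xi> z < 0}"
      if "\<xi> p = 0" "\<And>z. \<xi> z = Re z - w (Im z)" for \<xi> w
    proof -
      show "p \<in> closure {z. \<xi> z > 0}" unfolding uv
        by (rule mem_closure_pos(1)[where a = 1 and b = 0]) (use that in \<open>simp add: uv\<close>)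
      show "p \<in> closure {z. \<xi> z < 0}" unfolding uv
        by (rule mem_closure_pos(2)[where a = "-1" and b = 0]) (use that in \<open>simp add: uv\<close>)
    qed
    have cl\<phi>: "p \<in> closure {z. \<phi> z > 0}" "p \<in> closure {z. \<phi> z < 0}" if "\<phi> p = 0"
      using clx[of \<phi>, OF that \<phi>_def] by blast+
    have \<psi>_alt: "\<psi> z = Re z - (- clamp_to 6 (Im z))" for z by (simp add: \<psi>_def)
    have cl\<psi>: "p \<in> closure {z. \<psi> z > 0}" "p \<in> closure {z. \<psi> z < 0}" if "\<psi> p = 0"
      using clx[of \<psi> "\<lambda>y. - clamp_to 6 y", OF that \<psi>_alt] by blast+
    have cl\<theta>: "p \<in> closure {z. \<theta> z > 0}" "p \<in> closure {z. \<theta> z < 0}" if "\<theta> p = 0"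
    proof -
      show "p \<in> closure {z. \<theta> z > 0}" unfolding uv
        by (rule mem_closure_pos(1)[where a = 0 and b = 1]) (use that in \<open>simp add: uv \<theta>_def\<close>)
      show "p \<in> closure {z. \<theta> z < 0}" unfolding uv
        by (rule mem_closure_pos(2)[where a = 0 and b = "-1"]) (use that in \<open>simp add: uv \<theta>_def\<close>)
    qed
    have P: "\<not> (u = 0 \<and> v = 0)" "\<not> (u = -3 \<and> v = -3)" "\<not> (u = 3 \<and> v = -3)" using p by (auto simp: uv)
    have dbl: "\<not> (\<phi> p = 0 \<and> \<psi> p = 0)" "\<not> (\<phi> p = 0 \<and> \<theta> p = 0)" "\<not> (\<psi> p = 0 \<and> \<theta> p = 0)"
      using P unfolding \<phi>_def \<psi>_def \<theta>_def uv complex.sel clamp_to_def bump_def by argo+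
    consider "\<phi> p = 0" | "\<psi> p = 0" | "\<theta> p = 0" using C p by blast
    then show ?thesis
    proof cases
      case 1
      then have nz: "\<psi> p \<noteq> 0" "\<theta> p \<noteq> 0" using dbl by auto
      have "colours_at curve_\<Omega>3 f p = {G True (\<psi> p > 0) (\<theta> p > 0), G False (\<psi> p > 0) (\<theta> p > 0)}"
        by (rule colours_at_wall3[OF cont, where G = G]) (use C fG p nz cl\<phi> 1 in auto)
      moreover have "\<psi> p < 0 \<or> \<theta> p > 0" using order[of p] 1 nz by linarith
      then have "fst (G True (\<psi> p > 0) (\<theta> p > 0)) \<noteq> fst (G False (\<psi> p > 0) (\<theta> p > 0))"
        using rho by (auto simp: G_def)
      ultimately show ?thesis by blast
    next
      case 2
      then have nz: "\<phi> p \<noteq> 0" "\<theta> p \<noteq> 0" using dbl by auto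
      have "colours_at curve_\<Omega>3 f p = {G (\<phi> p > 0) True (\<theta> p > 0), G (\<phi> p > 0) False (\<theta> p > 0)}"
        by (rule colours_at_wall3[OF cont(2) cont(1) cont(3), where G = "\<lambda>t s r. G s t r"])
          (use C fG p nz cl\<psi> 2 in auto)
      moreover have "\<phi> p > 0 \<or> \<theta> p > 0" using order'[of p] 2 nz by linarith
      then have "fst (G (\<phi> p > 0) True (\<theta> p > 0)) \<noteq> fst (G (\<phi> p > 0) False (\<theta> p > 0))"
        using rho by (auto simp: G_def)
      ultimately show ?thesis by blast
    next
      case 3
      then have nz: "\<phi> p \<noteq> 0" "\<psi> p \<noteq> 0" using dbl by auto
      have "colours_at curve_\<Omega>3 f p = {G (\<phi> p > 0) (\<psi> p > 0) True, G (\<phi> p > 0) (\<psi> p > 0) False}"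
        by (rule colours_at_wall3[OF cont(3) cont(1) cont(2), where G = "\<lambda>r s t. G s t r"])
          (use C fG p nz cl\<theta> 3 in auto)
      moreover have "\<phi> p > 0 \<or> \<psi> p < 0" using order''[of p] 3 nz by linarith
      then have "fst (G (\<phi> p > 0) (\<psi> p > 0) True) \<noteq> fst (G (\<phi> p > 0) (\<psi> p > 0) False)"
        using rho by (auto simp: G_def)
      ultimately show ?thesis by blast
    qed
  qed
  have cases4: "p = Complex 0 0 \<or> p = Complex (-3) (-3) \<or> p = Complex 3 (-3) \<or>
    (\<exists>c d. fst c \<noteq> fst d \<and> colours_at curve_\<Omega>3 f p = {c, d})" if "p \<in> curve_\<Omega>3" "p \<in> disk_interior" for p
    using edge[of p] that by blast
  show ?thesis
    unfolding disk_colouring_def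
  proof (intro conjI ballI lc)
    show "fst ` colours_at curve_\<Omega>3 f p = UNIV" if p: "p \<in> curve_\<Omega>3 \<inter> disk_interior" for p
    proof -
      consider "p = Complex 0 0" | "p = Complex (-3) (-3)" | "p = Complex 3 (-3)"
        | c d where "fst c \<noteq> fst d" "colours_at curve_\<Omega>3 f p = {c, d}"
        using cases4[of p] p by blast
      then show ?thesis
      proof cases
        case 1
        show ?thesis unfolding 1 \<Omega>3_crossings[OF col]
          by (rule fst_image_UNIV[of cN _ cNW]) (use rho in auto)
      next
        case 2
        show ?thesis unfolding 2 \<Omega>3_crossings[OF col]
          by (rule fst_image_UNIV[of cT _ cS]) (use rho in auto)
      next
        case 3
        show ?thesis unfolding 3 \<Omega>3_crossings[OF col]
          by (rule fst_image_UNIV[of cT _ cS]) (use rho in auto)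
      next
        case 4
        then show ?thesis by (intro fst_image_UNIV[of c _ d]) auto
      qed
    qed
    show "card (colours_at curve_\<Omega>3 f p) \<noteq> 3" if p: "p \<in> curve_\<Omega>3 \<inter> disk_interior - M" for p
    proof -
      consider "p = Complex 0 0" | "p = Complex (-3) (-3)" | "p = Complex 3 (-3)"
        | c d where "fst c \<noteq> fst d" "colours_at curve_\<Omega>3 f p = {c, d}"
        using cases4[of p] p by blast
      then show ?thesis
      proof cases
        case 1
        show ?thesis unfolding 1 \<Omega>3_crossings[OF col]
          by (rule iffD2[OF card_crossing_iff]) (use rho O p 1 in auto)
      next
        case 2
        show ?thesis unfolding 2 \<Omega>3_crossings[OF col]
          by (rule iffD2[OF card_crossing_iff]) (use rho A in auto)
      next
        case 3
        show ?thesis unfolding 3 \<Omega>3_crossings[OF col]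
          by (rule iffD2[OF card_crossing_iff]) (use rho B in auto)
      next
        case 4
        then show ?thesis by (simp add: two_colours)
      qed
    qed
  qed
qed

text \<open>
  The new triangle takes the only colour \<open>cT'\<close> that makes the central crossing straight.  The two
  other crossings are then straight by the relations before the move.
\<close>

lemma transfers_\<Omega>3: "transfers curve_\<Omega>3 {} (cnj ` curve_\<Omega>3) (cnj ` {})"
proof (rule transfers_reflect)
  note pw = curve_\<Omega>3_Complex clamp_to_def bump_def
  show "Complex x y \<in> curve_\<Omega>3 \<longleftrightarrow> Complex x (- y) \<in> curve_\<Omega>3" if "\<not> (\<bar>x\<bar> \<le> 7 \<and> \<bar>y\<bar> \<le> 7)" for x y
    using that unfolding pw by argo
  fix f assume f: "disk_colouring curve_\<Omega>3 {} f"
  obtain cN cNW cNE cT cSW cSE cS where col: "\<Omega>3_coloured f cN cNW cNE cT cSW cSE cS"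
    using \<Omega>3_regions[of f] f unfolding disk_colouring_def by blast
  note rho = \<Omega>3_checker[OF col f] and rel = \<Omega>3_crossing_relations[OF col f]
  define cT' where "cT' = (fst cS, snd cS = (snd cSE = snd cSW))"
  define g where "g z = (if - bump (Re z) < Im z
      then if Re z < clamp_to 6 (Im z) then if - clamp_to 6 (Im z) < Re z then cS else cSW
        else if - clamp_to 6 (Im z) < Re z then cSE else cT'
      else if Re z < clamp_to 6 (Im z) then cNW else if - clamp_to 6 (Im z) < Re z then cNE else cN)" for z
  have colg: "\<Omega>3_coloured g cS cSW cSE cT' cNW cNE cN"
    unfolding \<Omega>3_coloured_def g_def complex.sel clamp_to_def bump_def
    by (intro allI impI conjI; elim conjE; ((subst if_not_P, argo) | (subst if_P, argo))+; rule refl)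
  have rho': "fst cS \<noteq> fst cSW" "fst cSE \<noteq> fst cS" "fst cSE \<noteq> fst cNE" "fst cSW \<noteq> fst cNW" "fst cT' \<noteq> fst cN" "fst cT' \<noteq> fst cSW"
    unfolding cT'_def fst_conv using rho by argo+
  have rel': "snd cSE = snd cSW \<longleftrightarrow> snd cT' = snd cS" "snd cT' = snd cNW \<longleftrightarrow> snd cN = snd cSW"
    "snd cSE = snd cN \<longleftrightarrow> snd cNE = snd cT'"
    unfolding cT'_def snd_conv using rel by argo+
  have g: "disk_colouring curve_\<Omega>3 {} g"
    by (rule \<Omega>3_disk_colouring[OF colg rho' rel'])
  have "g (Complex x (- y)) = f (Complex x y)"
    if xy: "\<bar>x\<bar> < 8" "\<bar>y\<bar> < 8" "\<not> (\<bar>x\<bar> \<le> 7 \<and> \<bar>y\<bar> \<le> 7)" "Complex x y \<notin> curve_\<Omega>3" for x y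
  proof -
    have y': "\<bar>- y\<bar> < 8" using xy by simp
    note F = \<Omega>3_colouredD[OF col xy(1,2), unfolded clamp_to_def bump_def]
    note G = \<Omega>3_colouredD[OF colg xy(1) y', unfolded clamp_to_def bump_def]
    consider "y > 7" "x < -6" | "y > 7" "-6 < x" "x < 6" | "y > 7" "x > 6"
      | "y < -7" "x < -6" | "y < -7" "-6 < x" "x < 6" | "y < -7" "x > 6"
      | "y > 0" "x < -7" | "y < 0" "x < -7" | "y > 0" "x > 7" | "y < 0" "x > 7"
      using xy unfolding pw by argo
    then show ?thesis
    proof cases
      case 1
      show ?thesis by (rule trans[OF G(5) F(2)[symmetric]]; use xy(1-3) 1 in argo)
    next
      case 2
      show ?thesis by (rule trans[OF G(7) F(1)[symmetric]]; use xy(1-3) 2 in argo)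
    next
      case 3
      show ?thesis by (rule trans[OF G(6) F(3)[symmetric]]; use xy(1-3) 3 in argo)
    next
      case 4
      show ?thesis by (rule trans[OF G(2) F(5)[symmetric]]; use xy(1-3) 4 in argo)
    next
      case 5
      show ?thesis by (rule trans[OF G(1) F(7)[symmetric]]; use xy(1-3) 5 in argo)
    next
      case 6
      show ?thesis by (rule trans[OF G(3) F(6)[symmetric]]; use xy(1-3) 6 in argo)
    next
      case 7
      show ?thesis by (rule trans[OF G(5) F(2)[symmetric]]; use xy(1-3) 7 in argo)
    next
      case 8
      show ?thesis by (rule trans[OF G(2) F(5)[symmetric]]; use xy(1-3) 8 in argo)
    next
      case 9
      show ?thesis by (rule trans[OF G(6) F(3)[symmetric]]; use xy(1-3) 9 in argo)
    next
      case 10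
      show ?thesis by (rule trans[OF G(3) F(6)[symmetric]]; use xy(1-3) 10 in argo)
    qed
  qed
  then show "\<exists>g. (\<forall>x y. \<bar>x\<bar> < 8 \<longrightarrow> \<bar>y\<bar> < 8 \<longrightarrow> \<not> (\<bar>x\<bar> \<le> 7 \<and> \<bar>y\<bar> \<le> 7) \<longrightarrow> Complex x y \<notin> curve_\<Omega>3 \<longrightarrow>
              g (Complex x (- y)) = f (Complex x y)) \<and>
           disk_colouring curve_\<Omega>3 {} g \<and> finite (rainbow curve_\<Omega>3 {} g) \<and>
           (odd (card (rainbow curve_\<Omega>3 {} f)) \<longleftrightarrow> odd (card (rainbow curve_\<Omega>3 {} g)))"
    using g by (intro exI[of _ g]) (simp add: recolours_def rainbow_def)
qed simp

section \<open>Invariance under all moves except two\<close>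

lemma cnj_disk: "cnj ` disk = disk"
  by (rule set_eq_Complex) (simp add: cnj_image_Complex disk_Complex)

text \<open>
  The bigon has been treated with its crossings on a vertical line, in \<open>\<Omega>5\<close> they lie on a horizontal one.
\<close>

definition swap :: "complex \<Rightarrow> complex" where
  "swap z = Complex (Im z) (Re z)"

lemma homeomorphism_swap: "homeomorphism UNIV UNIV swap swap"
proof -
  have "continuous_on UNIV swap" unfolding swap_def Complex_eq by (intro continuous_intros)
  moreover have inv: "swap (swap z) = z" for z by (simp add: swap_def)
  moreover have "swap ` UNIV = UNIV" by (rule surjI) (rule inv)
  ultimately show ?thesis by (simp add: homeomorphism_def)
qed

lemma swap_image_Complex: "Complex x y \<in> swap ` A \<longleftrightarrow> Complex y x \<in> A"
  by (simp only: mem_image_homeo[OF homeomorphism_swap] swap_def complex.sel)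

lemma swap_disk: "swap ` disk = disk"
  by (rule set_eq_Complex) (auto simp: swap_image_Complex disk_Complex)

lemma cnj_cnj_image: "cnj ` cnj ` A = A" by (simp add: image_image)

lemma \<Omega>3_curves: "curve (left_side \<Omega>3) = curve_\<Omega>3" "curve (right_side \<Omega>3) = cnj ` curve_\<Omega>3"
proof -
  show "curve (left_side \<Omega>3) = curve_\<Omega>3"
    by (rule set_eq_Complex) (simp add: strand_SW_NE_Complex strand_NW_SE_Complex strand_H_below_Complex curve_\<Omega>3_Complex; argo)
  show "curve (right_side \<Omega>3) = cnj ` curve_\<Omega>3"
    by (rule set_eq_Complex)
      (simp add: cnj_image_Complex strand_SW_NE_Complex strand_NW_SE_Complex strand_H_above_Complex curve_\<Omega>3_Complex clamp_to_def; argo)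
qed

lemma \<Omega>5_pictures:
  "curve_\<Omega>5 = swap ` bigon 3" "tick 1 (3, 0) = swap ` tick \<i> (0, 3)" "tick 1 (-3, 0) = swap ` tick \<i> (0, -3)"
proof -
  show "curve_\<Omega>5 = swap ` bigon 3"
    by (rule set_eq_Complex) (simp only: swap_image_Complex curve_\<Omega>5_Complex bigon_Complex; argo)
  show "tick 1 (3, 0) = swap ` tick \<i> (0, 3)" "tick 1 (-3, 0) = swap ` tick \<i> (0, -3)"
    by (rule set_eq_Complex; simp only: swap_image_Complex tick_1 tick_i)+
qed

lemma cnj_bigon: "cnj ` bigon k = bigon k" "cnj ` tick \<i> (0, 3) = tick \<i> (0, -3)" "cnj ` tick \<i> (0, -3) = tick \<i> (0, 3)"
  by (rule set_eq_Complex; simp only: cnj_image_Complex bigon_Complex tick_i abs_minus_cancel; argo)+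

lemma \<Omega>7_pictures:
  "curve (left_side \<Omega>7) = curve_\<Omega>7" "curve (right_side \<Omega>7) = cnj ` curve_\<Omega>7"
  "markers (right_side \<Omega>7) = cnj ` (tick \<i> (-2, -2) \<union> tick 1 (2, 2))"
proof -
  show "curve (left_side \<Omega>7) = curve_\<Omega>7"
    by (rule set_eq_Complex) (simp only: left_\<Omega>7_Complex curve_\<Omega>7_Complex)
  show "curve (right_side \<Omega>7) = cnj ` curve_\<Omega>7"
    by (rule set_eq_Complex)
      (simp add: cnj_image_Complex curve_\<Omega>7_Complex clamp_to_def drawn_def closed_segment_Complex; argo)
  show "markers (right_side \<Omega>7) = cnj ` (tick \<i> (-2, -2) \<union> tick 1 (2, 2))"
    by (rule set_eq_Complex) (simp add: cnj_image_Complex tick_i tick_1; argo)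
qed

definition flat_transfers :: "picture \<Rightarrow> picture \<Rightarrow> bool" where
  "flat_transfers P Q \<longleftrightarrow> transfers (curve P) (markers P) (curve Q) (markers Q)"

lemma moves_transfer:
  assumes "m \<in> {\<Omega>1, \<Omega>2, \<Omega>3, \<Omega>5, \<Omega>6, \<Omega>6', \<Omega>7, \<Omega>8}"
  shows "flat_transfers (left_side m) (right_side m) \<and> flat_transfers (right_side m) (left_side m)"
proof -
  have kink: "transfers kink M (curve simple_arc) {} \<and> transfers (curve simple_arc) {} kink M"
    if "\<And>x y. Complex x y \<in> M \<Longrightarrow> (x = 0 \<or> y = 0) \<and> \<bar>x\<bar> \<le> 1/2 \<and> \<bar>y\<bar> \<le> 1/2" for M
  proof -
    have "\<bar>x\<bar> \<le> 7 \<and> \<bar>y\<bar> \<le> 7 \<and> (Complex x y \<in> kink \<longrightarrow> x = 0 \<and> y = 0)" if "Complex x y \<in> M" for x y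
      using \<open>\<And>x y. Complex x y \<in> M \<Longrightarrow> (x = 0 \<or> y = 0) \<and> \<bar>x\<bar> \<le> 1/2 \<and> \<bar>y\<bar> \<le> 1/2\<close>[OF that]
      unfolding kink_Complex by argo
    then show ?thesis using transfers_unkink[of M] transfers_kink[of M] by blast
  qed
  have arc: "markers simple_arc = {}" by (simp add: simple_arc_def)
  consider "m = \<Omega>1" | "m = \<Omega>2" | "m = \<Omega>3" | "m = \<Omega>5" | "m = \<Omega>6" | "m = \<Omega>6'" | "m = \<Omega>7" | "m = \<Omega>8"
    using assms by blast
  then show ?thesis
  proof cases
    case 1
    then show ?thesis using kink[of "{}"] by (simp add: flat_transfers_def arc)
  next
    case 2
    have "markers (left_side \<Omega>2) = {}" "markers (right_side \<Omega>2) = {}" by simp_all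
    then show ?thesis unfolding 2 flat_transfers_def \<Omega>2_curves using transfers_\<Omega>2 transfers_\<Omega>2_back by simp
  next
    case 3
    have "markers (left_side \<Omega>3) = {}" "markers (right_side \<Omega>3) = {}" by simp_all
    then show ?thesis
      unfolding 3 flat_transfers_def \<Omega>3_curves
      using transfers_\<Omega>3 transfers_homeo[OF homeomorphism_cnj cnj_disk transfers_\<Omega>3] by (simp add: cnj_cnj_image)
  next
    case 4
    show ?thesis
      using transfers_homeo[OF homeomorphism_swap swap_disk transfers_\<Omega>5_swapped]
        transfers_homeo[OF homeomorphism_swap swap_disk transfers_homeo[OF homeomorphism_cnj cnj_disk transfers_\<Omega>5_swapped]]
      unfolding 4 flat_transfers_def by (simp add: \<Omega>5_pictures cnj_bigon)
  next
    case 5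
    have "transfers kink (tick \<i> (0,0)) (curve simple_arc) {} \<and> transfers (curve simple_arc) {} kink (tick \<i> (0,0))"
      by (rule kink) (simp add: tick_i)
    then show ?thesis by (simp add: 5 flat_transfers_def arc)
  next
    case 6
    have "transfers kink (tick 1 (0,0)) (curve simple_arc) {} \<and> transfers (curve simple_arc) {} kink (tick 1 (0,0))"
      by (rule kink) (simp add: tick_1)
    then show ?thesis by (simp add: 6 flat_transfers_def arc)
  next
    case 7
    have M: "markers (left_side \<Omega>7) = tick \<i> (-2, -2) \<union> tick 1 (2, 2)" by simp
    show ?thesis
      unfolding 7 flat_transfers_def \<Omega>7_pictures M
      using transfers_\<Omega>7 transfers_homeo[OF homeomorphism_cnj cnj_disk transfers_\<Omega>7] by (simp only: cnj_cnj_image simp_thms)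
  next
    case 8
    \<comment> \<open>The two sides have the same curve and the same markers.\<close>
    have "transfers C M C M" for C M
      unfolding transfers_def
    proof (intro allI impI)
      fix A B A' B' :: "complex set"
      assume "A \<inter> disk = C" "B \<inter> disk = M" "A' \<inter> disk = C" "B' \<inter> disk = M" "A - disk = A' - disk" "B - disk = B' - disk"
      then have "A = A'" "B = B'" by (metis Un_Diff_Int)+
      then show "odd_colourable A B \<Longrightarrow> odd_colourable A' B'" by simp
    qed
    then show ?thesis by (simp add: 8 flat_transfers_def)
  qed
qed

abbreviation odd_colourable_diagram :: "picture \<Rightarrow> bool" where
  "odd_colourable_diagram D \<equiv> odd_colourable (curve D) (markers D)"

lemma replaces_odd_colourable:
  assumes r: "replaces m E E'" and m: "m \<in> {\<Omega>1, \<Omega>2, \<Omega>3, \<Omega>5, \<Omega>6, \<Omega>6', \<Omega>7, \<Omega>8}"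
  shows "odd_colourable_diagram E \<longleftrightarrow> odd_colourable_diagram E'"
proof -
  have r': "restrict_pic E disk = left_side m" "restrict_pic E' disk = right_side m"
    "restrict_pic E (- disk) = restrict_pic E' (- disk)"
    using r by (simp_all add: replaces_def)
  have P: "curve (restrict_pic X A) = curve X \<inter> A" "markers (restrict_pic X A) = markers X \<inter> A" for X A
    by (simp_all add: restrict_pic_def)
  have d: "curve E \<inter> disk = curve (left_side m)" "markers E \<inter> disk = markers (left_side m)"
    "curve E' \<inter> disk = curve (right_side m)" "markers E' \<inter> disk = markers (right_side m)"
    "curve E - disk = curve E' - disk" "markers E - disk = markers E' - disk"
    unfolding Diff_eq P[symmetric] r' by (rule refl)+
  have t: "transfers (curve (left_side m)) (markers (left_side m)) (curve (right_side m)) (markers (right_side m))"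
    "transfers (curve (right_side m)) (markers (right_side m)) (curve (left_side m)) (markers (left_side m))"
    using moves_transfer[OF m] by (simp_all add: flat_transfers_def)
  show ?thesis
    using transfersD[OF t(1) d] transfersD[OF t(2) d(3,4,1,2) d(5,6)[symmetric]] by blast
qed

text \<open>
  The final stage of an isotopy is a homeomorphism of the plane that carries one diagram to the other.
\<close>

lemma isotopic_odd_colourable:
  assumes "plane_isotopic D D'"
  shows "odd_colourable_diagram D \<longleftrightarrow> odd_colourable_diagram D'"
proof -
  obtain h where h: "\<forall>t\<in>{0..1}. \<exists>g. homeomorphism UNIV UNIV (h t) g" "D' = image_pic (h (1::real)) D"
    using assms unfolding plane_isotopic_def by blast
  then obtain g where g: "homeomorphism UNIV UNIV (h 1) g" by fastforce
  have D': "curve D' = h 1 ` curve D" "markers D' = h 1 ` markers D" by (simp_all add: h(2) image_pic_def)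
  have "g (h 1 z) = z" for z using g by (simp add: homeomorphism_def)
  then have "g ` curve D' = curve D" "g ` markers D' = markers D" by (simp_all add: D' image_image)
  then show ?thesis
    using odd_colourable_homeo[OF g, of "curve D" "markers D"]
      odd_colourable_homeo[OF homeomorphism_symD[OF g], of "curve D'" "markers D'"] D' by auto
qed

lemma related_by_odd_colourable:
  assumes "related_by {\<Omega>1, \<Omega>2, \<Omega>3, \<Omega>5, \<Omega>6, \<Omega>6', \<Omega>7, \<Omega>8} D D'"
  shows "odd_colourable_diagram D \<longleftrightarrow> odd_colourable_diagram D'"
  using assms unfolding related_by_def
proof (induction rule: rtranclp_induct)
  case (step E F)
  have mv: "odd_colourable_diagram A \<longleftrightarrow> odd_colourable_diagram B"
    if "m \<in> {\<Omega>1, \<Omega>2, \<Omega>3, \<Omega>5, \<Omega>6, \<Omega>6', \<Omega>7, \<Omega>8}" "move m A B" for m A B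
    using that(2) replaces_odd_colourable[OF _ that(1)] isotopic_odd_colourable unfolding move_def by metis
  from step(2) have "odd_colourable_diagram E \<longleftrightarrow> odd_colourable_diagram F"
    using mv isotopic_odd_colourable by blast
  then show ?case using step(3) by simp
qed simp

section \<open>Charts for explicit diagrams\<close>

text \<open>
  A homeomorphism of the plane that straightens the curve near \<open>p\<close>, restricted to the preimage of a
  small ball and rescaled.
\<close>

lemma chart_of_homeo:
  assumes h: "homeomorphism UNIV UNIV \<Phi> \<Psi>" and p: "\<Phi> p = 0" "open N" "p \<in> N"
    and C: "\<And>z. z \<in> N \<Longrightarrow> z \<in> C \<longleftrightarrow> Im (\<Phi> z) = 0"
  shows "\<exists>V h. chart_at p V h \<and> h ` (C \<inter> V) = {z \<in> ball 0 1. Im z = 0}"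
proof -
  have cont: "continuous_on UNIV \<Phi>" "continuous_on UNIV \<Psi>" and inv: "\<And>z. \<Psi> (\<Phi> z) = z" "\<And>z. \<Phi> (\<Psi> z) = z"
    using h by (auto simp: homeomorphism_def)
  have "open (\<Psi> -` N)" using continuous_open_vimage[of N \<Psi>] cont(2) p(2) by (simp add: continuous_on_eq_continuous_at)
  moreover have "0 \<in> \<Psi> -` N" using inv(1)[of p] p by simp
  ultimately obtain r where r: "r > 0" "ball 0 r \<subseteq> \<Psi> -` N" by (meson open_contains_ball)
  define V where "V = {z. norm (\<Phi> z) < r}"
  define k where "k z = \<Phi> z / of_real r" for z
  have VN: "z \<in> N" if "z \<in> V" for z
    using that r(2) inv(1)[of z] by (auto simp: V_def subset_iff)
  have kn: "norm (k z) < 1 \<longleftrightarrow> z \<in> V" for z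
    using r(1) by (simp add: k_def V_def norm_divide field_simps)
  have inv': "k (\<Psi> (of_real r * w)) = w" "\<Psi> (of_real r * k z) = z" for w z
    using r(1) by (simp_all add: k_def inv)
  have "open V" unfolding V_def by (intro open_Collect_less continuous_intros cont(1))
  moreover have "homeomorphism V (ball 0 1) k (\<lambda>w. \<Psi> (of_real r * w))"
    unfolding homeomorphism_def
  proof (intro conjI ballI)
    show "k ` V = ball 0 1"
    proof (intro equalityI subsetI)
      fix w :: complex assume w: "w \<in> ball 0 1"
      then have "\<Psi> (of_real r * w) \<in> V" using inv'(1)[of w] kn[of "\<Psi> (of_real r * w)"] by simp
      then show "w \<in> k ` V" using inv'(1)[of w] by (metis imageI)
    qed (use kn in auto)
    show "(\<lambda>w. \<Psi> (of_real r * w)) ` ball 0 1 = V"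
    proof (intro equalityI subsetI)
      fix z assume z: "z \<in> V"
      then have "k z \<in> ball 0 1" using kn by simp
      then show "z \<in> (\<lambda>w. \<Psi> (of_real r * w)) ` ball 0 1" using inv'(2)[of z] by (metis imageI)
    next
      fix z assume "z \<in> (\<lambda>w. \<Psi> (of_real r * w)) ` ball 0 1"
      then obtain w where "w \<in> ball 0 1" "z = \<Psi> (of_real r * w)" by blast
      then show "z \<in> V" using inv'(1)[of w] kn[of z] by simp
    qed
    show "continuous_on V k" unfolding k_def using r(1)
      by (intro continuous_intros continuous_on_subset[OF cont(1)]) auto
    show "continuous_on (ball 0 1) (\<lambda>w. \<Psi> (of_real r * w))"
      by (rule continuous_on_compose2[OF cont(2)]) (auto intro!: continuous_intros)
  qed (use inv' in auto)
  ultimately have "chart_at p V k"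
    unfolding chart_at_def using p r(1) by (auto simp: V_def k_def)
  moreover have "k ` (C \<inter> V) = {z \<in> ball 0 1. Im z = 0}"
  proof (intro equalityI subsetI)
    fix w assume "w \<in> k ` (C \<inter> V)"
    then obtain z where z: "z \<in> C" "z \<in> V" "w = k z" by blast
    then show "w \<in> {z \<in> ball 0 1. Im z = 0}" using C VN kn[of z] by (simp add: k_def)
  next
    fix w :: complex assume w: "w \<in> {z \<in> ball 0 1. Im z = 0}"
    let ?z = "\<Psi> (of_real r * w)"
    have "?z \<in> V" using w inv'(1)[of w] kn[of ?z] by simp
    moreover have "?z \<in> C" using C[OF VN[OF \<open>?z \<in> V\<close>]] w by (simp add: inv)
    ultimately show "w \<in> k ` (C \<inter> V)" using inv'(1)[of w] by (metis IntI imageI)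
  qed
  ultimately show ?thesis by blast
qed

text \<open>
  The points with \<open>wall a b c d \<eta> p z = 0\<close> form the graph of \<open>\<eta>\<close> in the affine coordinates centred at
  \<open>p\<close> whose coordinate functions have the gradients \<open>(a, b)\<close> and \<open>(c, d)\<close>.  Corners of polygons are graphs of
  the absolute value in suitable coordinates.
\<close>

definition wall :: "real \<Rightarrow> real \<Rightarrow> real \<Rightarrow> real \<Rightarrow> (real \<Rightarrow> real) \<Rightarrow> complex \<Rightarrow> complex \<Rightarrow> real" where
  "wall a b c d \<eta> p z = c * (Re z - Re p) + d * (Im z - Im p) - \<eta> (a * (Re z - Re p) + b * (Im z - Im p))"

definition graph_near :: "complex set \<Rightarrow> complex \<Rightarrow> complex set \<Rightarrow> (complex \<Rightarrow> real) \<Rightarrow> bool" where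
  "graph_near C p N \<phi> \<longleftrightarrow> open N \<and> p \<in> N \<and> (\<forall>z\<in>N. z \<in> C \<longleftrightarrow> \<phi> z = 0) \<and>
     (\<exists>a b c d \<eta>. a * d - b * c \<noteq> 0 \<and> continuous_on UNIV \<eta> \<and> \<eta> 0 = 0 \<and> \<phi> = wall a b c d \<eta> p)"

text \<open>
  Subtracting \<open>\<eta>\<close> from the second coordinate is a homeomorphism that straightens the graph.
\<close>

lemma graph_near_chart:
  assumes "graph_near C p N \<phi>"
  shows "\<exists>V h. chart_at p V h \<and> h ` (C \<inter> V) = {z \<in> ball 0 1. Im z = 0}"
proof -
  obtain a b c d \<eta> where det: "a * d - b * c \<noteq> 0" and \<eta>: "continuous_on UNIV \<eta>" "\<eta> 0 = 0"
    and \<phi>: "\<phi> = wall a b c d \<eta> p" and N: "open N" "p \<in> N" and C: "\<And>z. z \<in> N \<Longrightarrow> z \<in> C \<longleftrightarrow> \<phi> z = 0"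
    using assms unfolding graph_near_def by blast
  let ?D = "a * d - b * c"
  define \<Phi> where "\<Phi> z = Complex (a * (Re z - Re p) + b * (Im z - Im p)) (wall a b c d \<eta> p z)" for z
  define \<beta> where "\<beta> w = Im w + \<eta> (Re w)" for w
  define \<Psi> where "\<Psi> w = Complex (Re p + (d * Re w - b * \<beta> w) / ?D) (Im p + (a * \<beta> w - c * Re w) / ?D)" for w
  have "\<Psi> (\<Phi> z) = z" for z
  proof -
    have \<beta>: "\<beta> (\<Phi> z) = c * (Re z - Re p) + d * (Im z - Im p)" by (simp add: \<beta>_def \<Phi>_def wall_def)
    have "d * (a * x + b * y) - b * (c * x + d * y) = ?D * x" "a * (c * x + d * y) - c * (a * x + b * y) = ?D * y" for x y
      by (simp_all add: algebra_simps)
    then show ?thesis unfolding \<Psi>_def \<beta> using det by (simp add: \<Phi>_def)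
  qed
  moreover have "\<Phi> (\<Psi> w) = w" for w
  proof -
    have "a * ((d * x - b * y) / ?D) + b * ((a * y - c * x) / ?D) = x"
      "c * ((d * x - b * y) / ?D) + d * ((a * y - c * x) / ?D) = y" for x y
      using det by (simp_all add: divide_simps) (simp_all add: algebra_simps)
    then show ?thesis unfolding \<Phi>_def wall_def \<Psi>_def by (simp add: \<beta>_def complex_eq_iff)
  qed
  moreover have "continuous_on UNIV \<Phi>" unfolding \<Phi>_def wall_def Complex_eq
    by (intro continuous_intros continuous_on_compose2[OF \<eta>(1)]) auto
  moreover have "continuous_on UNIV \<Psi>" unfolding \<Psi>_def \<beta>_def Complex_eq
    by (intro continuous_intros continuous_on_compose2[OF \<eta>(1)]) (use det in auto)
  ultimately have "homeomorphism UNIV UNIV \<Phi> \<Psi>"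
    unfolding homeomorphism_def by (metis UNIV_I surj_def surjI)
  moreover have "\<Phi> p = 0" using \<eta> by (simp add: \<Phi>_def wall_def complex_eq_iff)
  ultimately show ?thesis
    by (rule chart_of_homeo[OF _ _ N]) (simp add: C \<Phi>_def \<phi>)
qed

lemma graph_near_colours:
  assumes g: "graph_near C p N \<phi>" and f: "\<And>z. z \<in> N \<Longrightarrow> \<phi> z \<noteq> 0 \<Longrightarrow> f z = G (\<phi> z > 0)"
  shows "colours_at C f p = {G True, G False}"
proof -
  obtain a b c d \<eta> where det: "a * d - b * c \<noteq> 0" and \<eta>: "continuous_on UNIV \<eta>" "\<eta> 0 = 0"
    and \<phi>: "\<phi> = wall a b c d \<eta> p" and N: "open N" "p \<in> N" and C: "\<And>z. z \<in> N \<Longrightarrow> z \<in> C \<longleftrightarrow> \<phi> z = 0"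
    using g unfolding graph_near_def by blast
  let ?D = "a * d - b * c"
  \<comment> \<open>In this direction the first affine coordinate is constant and the second one grows.\<close>
  have ray: "\<phi> (Complex (Re p + t * (s * (- b / ?D))) (Im p + t * (s * (a / ?D)))) = t * s" for s t
  proof -
    have "a * (t * (s * (- b / ?D))) + b * (t * (s * (a / ?D))) = 0" by simp
    moreover have "c * (t * (s * (- b / ?D))) + d * (t * (s * (a / ?D))) = t * s"
      using det by (simp add: divide_simps) (simp add: algebra_simps)
    ultimately show ?thesis by (simp add: \<phi> wall_def \<eta>(2))
  qed
  show ?thesis
  proof (rule colours_at_wall[OF N, where \<phi> = \<phi> and G = G])
    have "Complex (Re p) (Im p) \<in> closure {z. \<phi> z > 0}"
      by (rule mem_closure_pos(1)[where a = "1 * (- b / ?D)" and b = "1 * (a / ?D)"]) (subst ray, simp)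
    then show "p \<in> closure {z. \<phi> z > 0}" by simp
    have "Complex (Re p) (Im p) \<in> closure {z. \<phi> z < 0}"
      by (rule mem_closure_pos(2)[where a = "-1 * (- b / ?D)" and b = "-1 * (a / ?D)"]) (subst ray, simp)
    then show "p \<in> closure {z. \<phi> z < 0}" by simp
  qed (use C f in auto)
qed

text \<open>
  Near \<open>p\<close> the diagram consists of an over-strand in direction \<open>du\<close> and an under-strand in direction \<open>dv\<close>,
  and \<open>U\<close> is the elliptical disk with these conjugate half-diameters.  The chart sends the coordinates along
  \<open>du\<close> and \<open>dv\<close> to the two diagonals of the model; dividing by \<open>sqrt 2\<close> makes the image the unit disk.
\<close>

lemma crossing_chart:
  assumes det: "Re du * Im dv - Im du * Re dv \<noteq> 0"
    and D: "\<And>a b. a\<^sup>2 + b\<^sup>2 < 1 \<Longrightarrow> (p + of_real a * du + of_real b * dv \<in> curve D \<longleftrightarrow> a = 0 \<or> b = 0)"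
      "\<And>a b. a\<^sup>2 + b\<^sup>2 < 1 \<Longrightarrow> (p + of_real a * du + of_real b * dv \<in> overs D \<longleftrightarrow> b = 0 \<and> \<bar>a\<bar> \<le> 1/2)"
      "\<And>a b. a\<^sup>2 + b\<^sup>2 < 1 \<Longrightarrow> p + of_real a * du + of_real b * dv \<notin> markers D"
    and U: "U = {p + of_real a * du + of_real b * dv | a b. a\<^sup>2 + b\<^sup>2 < 1}"
  shows "\<exists>h. chart_at p U h \<and> image_pic h (restrict_pic D U) = crossing_model"
proof -
  let ?D = "Re du * Im dv - Im du * Re dv"
  define \<alpha> where "\<alpha> z = (Im dv * Re (z - p) - Re dv * Im (z - p)) / ?D" for z
  define \<beta> where "\<beta> z = (Re du * Im (z - p) - Im du * Re (z - p)) / ?D" for z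
  define h where "h z = Complex ((\<alpha> z + \<beta> z) / sqrt 2) ((\<alpha> z - \<beta> z) / sqrt 2)" for z
  define g where "g w = p + of_real ((Re w + Im w) / sqrt 2) * du + of_real ((Re w - Im w) / sqrt 2) * dv" for w
  have s2: "sqrt 2 * sqrt 2 = (2::real)" by simp
  have ab: "\<alpha> (p + of_real a * du + of_real b * dv) = a" "\<beta> (p + of_real a * du + of_real b * dv) = b" for a b
    using det unfolding \<alpha>_def \<beta>_def by (simp_all add: divide_simps) (simp_all add: algebra_simps)
  have rep: "p + of_real (\<alpha> z) * du + of_real (\<beta> z) * dv = z" for z
  proof -
    have "(Im dv * x - Re dv * y) / ?D * Re du + (Re du * y - Im du * x) / ?D * Re dv = x"
      "(Im dv * x - Re dv * y) / ?D * Im du + (Re du * y - Im du * x) / ?D * Im dv = y" for x y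
      using det by (simp_all add: divide_simps) (simp_all add: algebra_simps)
    from this(1)[of "Re (z - p)" "Im (z - p)"] this(2)[of "Re (z - p)" "Im (z - p)"]
    show ?thesis unfolding \<alpha>_def \<beta>_def complex_eq_iff
      by (simp del: minus_complex.sel of_real_divide of_real_diff of_real_mult) (simp add: algebra_simps)
  qed
  have hg: "h (g w) = w" for w
    unfolding h_def g_def ab complex_eq_iff using s2 by (simp add: field_simps)
  have gh: "g (h z) = z" for z
  proof -
    have "(Re (h z) + Im (h z)) / sqrt 2 = \<alpha> z" "(Re (h z) - Im (h z)) / sqrt 2 = \<beta> z"
      unfolding h_def using s2 by (simp_all add: field_simps)
    then show ?thesis unfolding g_def using rep[of z] by simp
  qed
  have nrm: "((Re w + Im w) / sqrt 2)\<^sup>2 + ((Re w - Im w) / sqrt 2)\<^sup>2 = (norm w)\<^sup>2" for w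
    unfolding cmod_power2 by (simp add: power_divide power2_eq_square field_simps)
  have small: "((Re w + Im w) / sqrt 2)\<^sup>2 + ((Re w - Im w) / sqrt 2)\<^sup>2 < 1 \<longleftrightarrow> norm w < 1" for w
    unfolding nrm using abs_square_less_1[of "norm w"] by simp
  have gU: "g w \<in> U \<longleftrightarrow> norm w < 1" for w
  proof
    assume "g w \<in> U"
    then obtain a b where *: "g w = p + of_real a * du + of_real b * dv" "a\<^sup>2 + b\<^sup>2 < 1" unfolding U by blast
    have "a = (Re w + Im w) / sqrt 2" "b = (Re w - Im w) / sqrt 2"
      using *(1) ab[of a b] ab[of "(Re w + Im w) / sqrt 2" "(Re w - Im w) / sqrt 2"] unfolding g_def by metis+
    then show "norm w < 1" using *(2) small by simp
  next
    assume "norm w < 1"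
    then show "g w \<in> U" unfolding U g_def using small by blast
  qed
  have img: "h ` (A \<inter> U) = {w \<in> ball 0 1. g w \<in> A}" for A
  proof (intro equalityI subsetI)
    fix w assume "w \<in> h ` (A \<inter> U)"
    then obtain z where "z \<in> A" "z \<in> U" "w = h z" by blast
    then show "w \<in> {w \<in> ball 0 1. g w \<in> A}" using gh[of z] gU[of "h z"] by simp
  next
    fix w assume "w \<in> {w \<in> ball 0 1. g w \<in> A}"
    then have "g w \<in> A \<inter> U" using gU[of w] by simp
    then show "w \<in> h ` (A \<inter> U)" using hg[of w] by (metis imageI)
  qed
  have conth: "continuous_on UNIV h" unfolding h_def \<alpha>_def \<beta>_def Complex_eq
    by (intro continuous_intros) (use det in auto)
  have contg: "continuous_on UNIV g" unfolding g_def by (intro continuous_intros) auto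
  have Uh: "U = {z. norm (h z) < 1}"
  proof (rule set_eqI)
    show "z \<in> U \<longleftrightarrow> z \<in> {z. norm (h z) < 1}" for z using gU[of "h z"] gh[of z] by simp
  qed
  have "open U" unfolding Uh by (intro open_Collect_less continuous_intros conth)
  moreover have "homeomorphism U (ball 0 1) h g"
    unfolding homeomorphism_def
  proof (intro conjI ballI)
    show "h ` U = ball 0 1" using img[of UNIV] by auto
    show "g ` ball 0 1 = U"
    proof (intro equalityI subsetI)
      fix z assume "z \<in> U"
      then have "h z \<in> ball 0 1" using gU[of "h z"] gh by simp
      then show "z \<in> g ` ball 0 1" using gh[of z] by (metis imageI)
    next
      fix z assume "z \<in> g ` ball 0 1"
      then obtain w where "norm w < 1" "z = g w" by auto
      then show "z \<in> U" using gU[of w] by simp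
    qed
    show "continuous_on U h" "continuous_on (ball 0 1) g"
      using conth contg continuous_on_subset by blast+
    show "g (h z) = z" for z by (rule gh)
    show "h (g z) = z" for z by (rule hg)
  qed
  moreover have "h p = 0" using ab[of 0 0] by (simp add: h_def complex_eq_iff)
  moreover have "p \<in> U" unfolding Uh using \<open>h p = 0\<close> by simp
  ultimately have "chart_at p U h" unfolding chart_at_def by blast
  moreover have "image_pic h (restrict_pic D U) = crossing_model"
  proof -
    have "h ` (curve D \<inter> U) = {z \<in> ball 0 1. \<bar>Re z\<bar> = \<bar>Im z\<bar>}"
    proof -
      have "g w \<in> curve D \<longleftrightarrow> \<bar>Re w\<bar> = \<bar>Im w\<bar>" if "norm w < 1" for w
        unfolding g_def using D(1)[OF small[THEN iffD2, OF that]] by (simp add: abs_eq_iff add_eq_0_iff2) argo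
      then show ?thesis unfolding img by auto
    qed
    moreover have "h ` (overs D \<inter> U) = {z. Re z = Im z \<and> norm z \<le> 1/2}"
    proof -
      have nr: "\<bar>(Re w + Im w) / sqrt 2\<bar> = norm w" if "Re w = Im w" for w
      proof -
        have "(norm w)\<^sup>2 = ((Re w + Im w) / sqrt 2)\<^sup>2" using nrm[of w] that by simp
        then have "\<bar>norm w\<bar> = \<bar>(Re w + Im w) / sqrt 2\<bar>" by (simp only: power2_eq_iff abs_eq_iff)
        then show ?thesis by simp
      qed
      have "g w \<in> overs D \<longleftrightarrow> Re w = Im w \<and> norm w \<le> 1/2" if "norm w < 1" for w
      proof -
        have o: "g w \<in> overs D \<longleftrightarrow> (Re w - Im w) / sqrt 2 = 0 \<and> \<bar>(Re w + Im w) / sqrt 2\<bar> \<le> 1/2"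
          unfolding g_def by (rule D(2)[OF small[THEN iffD2, OF that]])
        have "(Re w - Im w) / sqrt 2 = 0 \<longleftrightarrow> Re w = Im w" by simp
        then show ?thesis unfolding o using nr[of w] by (metis (no_types))
      qed
      then show ?thesis unfolding img by auto
    qed
    moreover have "h ` (markers D \<inter> U) = {}"
      unfolding img g_def using D(3) small by (auto simp del: of_real_divide)
    ultimately show ?thesis by (simp add: image_pic_def restrict_pic_def crossing_model_def)
  qed
  ultimately show ?thesis by blast
qed

section \<open>Two link diagrams that differ by a single move\<close>

lemma graph_near_x:
  assumes "continuous_on UNIV w" "open N" "p \<in> N" "Re p = w (Im p)" "\<And>z. z \<in> N \<Longrightarrow> z \<in> C \<longleftrightarrow> Re z = w (Im z)"
  shows "graph_near C p N (\<lambda>z. Re z - w (Im z))"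
  unfolding graph_near_def
proof (intro conjI ballI exI)
  show "(\<lambda>z. Re z - w (Im z)) = wall 0 1 1 0 (\<lambda>t. w (Im p + t) - Re p) p"
    by (rule ext) (simp add: wall_def)
  show "continuous_on UNIV (\<lambda>t. w (Im p + t) - Re p)"
    by (intro continuous_intros continuous_on_compose2[OF assms(1)]) auto
qed (use assms in auto)

lemma graph_near_y:
  assumes "continuous_on UNIV w" "open N" "p \<in> N" "Im p = w (Re p)" "\<And>z. z \<in> N \<Longrightarrow> z \<in> C \<longleftrightarrow> Im z = w (Re z)"
  shows "graph_near C p N (\<lambda>z. Im z - w (Re z))"
  unfolding graph_near_def
proof (intro conjI ballI exI)
  show "(\<lambda>z. Im z - w (Re z)) = wall 1 0 0 1 (\<lambda>t. w (Re p + t) - Im p) p"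
    by (rule ext) (simp add: wall_def)
  show "continuous_on UNIV (\<lambda>t. w (Re p + t) - Im p)"
    by (intro continuous_intros continuous_on_compose2[OF assms(1)]) auto
qed (use assms in auto)

lemma graph_near_corner:
  assumes "a * d - b * c \<noteq> 0" "e > 0"
    and "\<And>z. \<bar>Re z - u\<bar> < e \<Longrightarrow> \<bar>Im z - v\<bar> < e \<Longrightarrow>
      z \<in> C \<longleftrightarrow> c * (Re z - u) + d * (Im z - v) - \<bar>a * (Re z - u) + b * (Im z - v)\<bar> = 0"
  shows "graph_near C (Complex u v) {z. \<bar>Re z - u\<bar> < e \<and> \<bar>Im z - v\<bar> < e} (wall a b c d abs (Complex u v))"
  unfolding graph_near_def
proof (intro conjI ballI exI)
  show "open {z. \<bar>Re z - u\<bar> < e \<and> \<bar>Im z - v\<bar> < e}" by (rule open_box_xy)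
  show "continuous_on UNIV (abs :: real \<Rightarrow> real)" by (intro continuous_intros)
qed (use assms in \<open>auto simp: wall_def\<close>)

lemma graph_near_shrink:
  "graph_near C p N \<phi> \<Longrightarrow> open N' \<Longrightarrow> p \<in> N' \<Longrightarrow> graph_near C p (N \<inter> N') \<phi>"
  unfolding graph_near_def by blast

text \<open>
  The three strands of \<open>\<Omega>4\<close> and \<open>\<Omega>4'\<close>, as graphs over the whole axis.  Outside the disk they are continued
  along straight lines: the rising strand and the strand \<open>H\<close> meet at \<open>(9, 9)\<close> and at \<open>(-9, -9)\<close>, and the falling
  strand leaves to the right at both ends, towards \<open>(18, 16)\<close> and \<open>(18, -20)\<close>.  The bit \<open>s\<close> tells whether
  \<open>H\<close> passes above the vertex.
\<close>

definition rising_x :: "real \<Rightarrow> real" where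
  "rising_x y = clamp_to 6 y + 3 * max 0 (y - 8) - 3 * max 0 (- 8 - y)"
definition falling_x :: "real \<Rightarrow> real" where
  "falling_x y = - clamp_to 6 y + 3 * max 0 (y - 8) + max 0 (- 8 - y)"
definition level_y :: "bool \<Rightarrow> real \<Rightarrow> real" where
  "level_y s x = (if s then bump x else - bump x) + 9 * max 0 (x - 8) - 9 * max 0 (- 8 - x)"

text \<open>
  Rising arc and level arc form a figure eight.  The falling arc, closed up by a vertical edge, is a
  simple loop.
\<close>

definition rising_arc where "rising_arc = {z. Re z = rising_x (Im z) \<and> \<bar>Im z\<bar> \<le> 9}"
definition falling_arc where "falling_arc = {z. Re z = falling_x (Im z) \<and> - 20 \<le> Im z \<and> Im z \<le> 16}"
definition level_arc where "level_arc s = {z. Im z = level_y s (Re z) \<and> \<bar>Re z\<bar> \<le> 9}"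
definition closing_edge where "closing_edge = {z. Re z = 18 \<and> - 20 \<le> Im z \<and> Im z \<le> 16}"

definition link_curve :: "bool \<Rightarrow> complex set" where
  "link_curve s = rising_arc \<union> falling_arc \<union> level_arc s \<union> closing_edge"

lemmas arc_defs = rising_arc_def falling_arc_def level_arc_def closing_edge_def
lemmas piecewise_defs = rising_x_def falling_x_def level_y_def clamp_to_def bump_def

lemma continuous_strands: "continuous_on UNIV rising_x" "continuous_on UNIV falling_x" "continuous_on UNIV (level_y s)"
proof -
  show "continuous_on UNIV rising_x" unfolding rising_x_def by (intro continuous_intros)
  show "continuous_on UNIV falling_x" unfolding falling_x_def by (intro continuous_intros)
  show "continuous_on UNIV (level_y s)" unfolding level_y_def by (cases s; simp; intro continuous_intros)
qed

lemma continuous_on_strands [continuous_intros]: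
  "continuous_on A (\<lambda>z. rising_x (Im z))" "continuous_on A (\<lambda>z. falling_x (Im z))" "continuous_on A (\<lambda>z. level_y s (Re z))"
  by (rule continuous_on_compose2[OF continuous_strands(1)] continuous_on_compose2[OF continuous_strands(2)] continuous_on_compose2[OF continuous_strands(3)];
      intro continuous_intros subset_UNIV)+

lemma closed_arcs: "closed rising_arc" "closed falling_arc" "closed (level_arc s)" "closed closing_edge"
  unfolding arc_defs by (intro closed_Collect_conj closed_Collect_eq closed_Collect_le continuous_intros)+

definition crossing_level :: "bool \<Rightarrow> real" where "crossing_level s = (if s then 3 else - 3)"

definition double_points :: "bool \<Rightarrow> complex set" where
  "double_points s = {0, Complex (-3) (crossing_level s), Complex 3 (crossing_level s)}"

text \<open>
  Away from the double points and from its ends an arc is disjoint from the others, so the curve is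
  there the graph that defines the arc.  The same holds for the other arcs.
\<close>

lemma rising_arc_regular:
  assumes p: "p \<in> rising_arc" "\<bar>Im p\<bar> < 9" "p \<notin> double_points s"
  shows "p \<notin> falling_arc" "p \<notin> level_arc s" "p \<notin> closing_edge"
    and "\<exists>N. graph_near (link_curve s) p N (\<lambda>z. Re z - rising_x (Im z))"
proof -
  have np: "\<not> (Re p = 0 \<and> Im p = 0)" "\<not> (Re p = -3 \<and> Im p = crossing_level s)" "\<not> (Re p = 3 \<and> Im p = crossing_level s)"
    using p(3) by (auto simp: double_points_def complex_eq_iff)
  have *: "Re p = rising_x (Im p)" using p by (simp add: rising_arc_def)
  show 2: "p \<notin> falling_arc" using np(1) p(2) * unfolding falling_arc_def mem_Collect_eq piecewise_defs by argo
  show 3: "p \<notin> level_arc s" using np p(2) * unfolding level_arc_def mem_Collect_eq piecewise_defs crossing_level_def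
    by (cases s; simp only: if_True if_False; argo)
  show 4: "p \<notin> closing_edge" using p(2) * unfolding closing_edge_def mem_Collect_eq piecewise_defs by argo
  have "graph_near (link_curve s) p (- (falling_arc \<union> level_arc s \<union> closing_edge) \<inter> {z. \<bar>Im z\<bar> < 9}) (\<lambda>z. Re z - rising_x (Im z))"
  proof (rule graph_near_x)
    show "open (- (falling_arc \<union> level_arc s \<union> closing_edge) \<inter> {z. \<bar>Im z\<bar> < 9})"
      by (intro open_Int open_Compl closed_Un closed_arcs open_Collect_less continuous_intros)
  qed (use p 2 3 4 * continuous_strands in \<open>auto simp: link_curve_def rising_arc_def\<close>)
  then show "\<exists>N. graph_near (link_curve s) p N (\<lambda>z. Re z - rising_x (Im z))" by blast
qed

lemma falling_arc_regular:
  assumes p: "p \<in> falling_arc" "- 20 < Im p" "Im p < 16" "p \<notin> double_points s"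
  shows "p \<notin> rising_arc" "p \<notin> level_arc s" "p \<notin> closing_edge"
    and "\<exists>N. graph_near (link_curve s) p N (\<lambda>z. Re z - falling_x (Im z))"
proof -
  have np: "\<not> (Re p = 0 \<and> Im p = 0)" "\<not> (Re p = -3 \<and> Im p = crossing_level s)" "\<not> (Re p = 3 \<and> Im p = crossing_level s)"
    using p(4) by (auto simp: double_points_def complex_eq_iff)
  have *: "Re p = falling_x (Im p)" using p by (simp add: falling_arc_def)
  show 1: "p \<notin> rising_arc" using np(1) p(2,3) * unfolding rising_arc_def mem_Collect_eq piecewise_defs by argo
  show 3: "p \<notin> level_arc s" using np p(2,3) * unfolding level_arc_def mem_Collect_eq piecewise_defs crossing_level_def
    by (cases s; simp only: if_True if_False; argo)
  show 4: "p \<notin> closing_edge" using p(2,3) * unfolding closing_edge_def mem_Collect_eq piecewise_defs by argo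
  have "graph_near (link_curve s) p (- (rising_arc \<union> level_arc s \<union> closing_edge) \<inter> {z. - 20 < Im z \<and> Im z < 16}) (\<lambda>z. Re z - falling_x (Im z))"
  proof (rule graph_near_x)
    show "open (- (rising_arc \<union> level_arc s \<union> closing_edge) \<inter> {z. - 20 < Im z \<and> Im z < 16})"
      by (intro open_Int open_Compl closed_Un closed_arcs open_Collect_conj open_Collect_less continuous_intros)
  qed (use p 1 3 4 * continuous_strands in \<open>auto simp: link_curve_def falling_arc_def\<close>)
  then show "\<exists>N. graph_near (link_curve s) p N (\<lambda>z. Re z - falling_x (Im z))" by blast
qed

lemma level_arc_regular:
  assumes p: "p \<in> level_arc s" "\<bar>Re p\<bar> < 9" "p \<notin> double_points s"
  shows "p \<notin> rising_arc" "p \<notin> falling_arc" "p \<notin> closing_edge"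
    and "\<exists>N. graph_near (link_curve s) p N (\<lambda>z. Im z - level_y s (Re z))"
proof -
  have np: "\<not> (Re p = 0 \<and> Im p = 0)" "\<not> (Re p = -3 \<and> Im p = crossing_level s)" "\<not> (Re p = 3 \<and> Im p = crossing_level s)"
    using p(3) by (auto simp: double_points_def complex_eq_iff)
  have *: "Im p = level_y s (Re p)" using p by (simp add: level_arc_def)
  show 1: "p \<notin> rising_arc" using np p(2) * unfolding rising_arc_def mem_Collect_eq piecewise_defs crossing_level_def
    by (cases s; simp only: if_True if_False; argo)
  show 2: "p \<notin> falling_arc" using np p(2) * unfolding falling_arc_def mem_Collect_eq piecewise_defs crossing_level_def
    by (cases s; simp only: if_True if_False; argo)
  show 4: "p \<notin> closing_edge" using p(2) * unfolding closing_edge_def mem_Collect_eq by argo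
  have "graph_near (link_curve s) p (- (rising_arc \<union> falling_arc \<union> closing_edge) \<inter> {z. \<bar>Re z\<bar> < 9}) (\<lambda>z. Im z - level_y s (Re z))"
  proof (rule graph_near_y)
    show "open (- (rising_arc \<union> falling_arc \<union> closing_edge) \<inter> {z. \<bar>Re z\<bar> < 9})"
      by (intro open_Int open_Compl closed_Un closed_arcs open_Collect_less continuous_intros)
  qed (use p 1 2 4 * continuous_strands in \<open>auto simp: link_curve_def level_arc_def\<close>)
  then show "\<exists>N. graph_near (link_curve s) p N (\<lambda>z. Im z - level_y s (Re z))" by blast
qed

lemma closing_edge_regular:
  assumes p: "p \<in> closing_edge" "- 20 < Im p" "Im p < 16"
  shows "p \<notin> rising_arc" "p \<notin> falling_arc" "p \<notin> level_arc s"
    and "\<exists>N. graph_near (link_curve s) p N (\<lambda>z. Re z - 18)"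
proof -
  have *: "Re p = 18" using p by (simp add: closing_edge_def)
  show 1: "p \<notin> rising_arc" using p(2,3) * unfolding rising_arc_def mem_Collect_eq piecewise_defs by argo
  show 2: "p \<notin> falling_arc" using p(2,3) * unfolding falling_arc_def mem_Collect_eq piecewise_defs by argo
  show 3: "p \<notin> level_arc s" using * unfolding level_arc_def by simp
  have "graph_near (link_curve s) p (- (rising_arc \<union> falling_arc \<union> level_arc s) \<inter> {z. - 20 < Im z \<and> Im z < 16}) (\<lambda>z. Re z - 18)"
  proof (rule graph_near_x[where w = "\<lambda>_. 18"])
    show "open (- (rising_arc \<union> falling_arc \<union> level_arc s) \<inter> {z. - 20 < Im z \<and> Im z < 16})"
      by (intro open_Int open_Compl closed_Un closed_arcs open_Collect_conj open_Collect_less continuous_intros)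
  qed (use p 1 2 3 * in \<open>auto simp: link_curve_def closing_edge_def\<close>)
  then show "\<exists>N. graph_near (link_curve s) p N (\<lambda>z. Re z - 18)" by blast
qed

text \<open>
  At a corner with the edge directions \<open>e\<close> and \<open>f\<close>, the curve is the graph of the absolute value in linear
  coordinates that take the values \<open>(1, 1)\<close> and \<open>(-1, 1)\<close> on positive multiples of \<open>e\<close> and \<open>f\<close>.  The
  coefficients are such coordinates, scaled to be integers.
\<close>

lemma link_corners:
  "graph_near (link_curve s) (Complex 9 9) {z. \<bar>Re z - 9\<bar> < 1 \<and> \<bar>Im z - 9\<bar> < 1} (wall (-5) 2 (-4) (-1) abs (Complex 9 9))"
  "graph_near (link_curve s) (Complex (-9) (-9)) {z. \<bar>Re z - -9\<bar> < 1 \<and> \<bar>Im z - -9\<bar> < 1} (wall 5 (-2) 4 1 abs (Complex (-9) (-9)))"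
  "graph_near (link_curve s) (Complex 18 16) {z. \<bar>Re z - 18\<bar> < 1 \<and> \<bar>Im z - 16\<bar> < 1} (wall (-2) 3 0 (-3) abs (Complex 18 16))"
  "graph_near (link_curve s) (Complex 18 (-20)) {z. \<bar>Re z - 18\<bar> < 1 \<and> \<bar>Im z - -20\<bar> < 1} (wall (-2) (-1) 0 1 abs (Complex 18 (-20)))"
  by (rule graph_near_corner; simp;
      cases s; simp only: link_curve_def arc_defs Un_iff mem_Collect_eq piecewise_defs if_True if_False; argo)+

lemma link_regular_cases:
  assumes "p \<in> link_curve s" "p \<notin> double_points s"
  obtains "p \<in> rising_arc" "\<bar>Im p\<bar> < 9" | "p \<in> falling_arc" "- 20 < Im p" "Im p < 16" | "p \<in> level_arc s" "\<bar>Re p\<bar> < 9"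
    | "p \<in> closing_edge" "- 20 < Im p" "Im p < 16" | "p = Complex 9 9" | "p = Complex (-9) (-9)" | "p = Complex 18 16" | "p = Complex 18 (-20)"
proof -
  have "p \<in> rising_arc \<and> \<bar>Im p\<bar> < 9 \<or> p \<in> falling_arc \<and> - 20 < Im p \<and> Im p < 16 \<or> p \<in> level_arc s \<and> \<bar>Re p\<bar> < 9 \<or>
    p \<in> closing_edge \<and> - 20 < Im p \<and> Im p < 16 \<or> Re p = 9 \<and> Im p = 9 \<or> Re p = -9 \<and> Im p = -9 \<or>
    Re p = 18 \<and> Im p = 16 \<or> Re p = 18 \<and> Im p = -20"
    using assms(1) unfolding link_curve_def arc_defs Un_iff mem_Collect_eq piecewise_defs
    by (cases s; simp only: if_True if_False; argo)
  then show ?thesis using that by (auto simp: complex_eq_iff)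
qed

lemma tick_slanted:
  assumes "m = 0 \<or> m = 1 \<or> m = -1"
  shows "Complex x y \<in> tick (Complex 1 m) (u, v) \<longleftrightarrow> y - v = m * (x - u) \<and> \<bar>x - u\<bar> \<le> 1/2"
  using assms by (elim disjE; simp add: tick_Complex closed_segment_Complex; argo)

text \<open>
  The slope \<open>m\<close> of the over-strand at the right crossing tells which strand is over; at the left
  crossing the slope is reversed.  For \<open>m = 0\<close> this is \<open>H\<close>, as in \<open>\<Omega>4\<close>.  In \<open>\<Omega>4'\<close> the other two strands are over,
  with the slope \<open>1\<close> or \<open>-1\<close> that depends on the position of \<open>H\<close>.
\<close>

definition link_pic :: "bool \<Rightarrow> real \<Rightarrow> picture" where
  "link_pic s m = \<lparr>curve = link_curve s,
     overs = tick (Complex 1 (- m)) (-3, crossing_level s) \<union> tick (Complex 1 m) (3, crossing_level s), markers = tick 1 (0, 0)\<rparr>"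

lemma link_curve_Complex:
  "Complex x y \<in> link_curve s \<longleftrightarrow> x = rising_x y \<and> \<bar>y\<bar> \<le> 9 \<or> x = falling_x y \<and> - 20 \<le> y \<and> y \<le> 16 \<or>
     y = level_y s x \<and> \<bar>x\<bar> \<le> 9 \<or> x = 18 \<and> - 20 \<le> y \<and> y \<le> 16"
  by (simp add: link_curve_def arc_defs)

definition slope :: "bool \<Rightarrow> real" where "slope s = (if s then 1 else - 1)"

text \<open>
  The neighbourhoods of the crossings for \<open>crossing_chart\<close>.  The half-diameters follow the two strands and
  are short enough for the neighbourhoods of the three double points to be disjoint.
\<close>

definition crossing_cell :: "complex \<Rightarrow> complex \<Rightarrow> complex \<Rightarrow> complex set" where
  "crossing_cell p du dv = {p + of_real a * du + of_real b * dv | a b. a\<^sup>2 + b\<^sup>2 < (1::real)}"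

lemma crossing_cell_swap: "crossing_cell p dv du = crossing_cell p du dv"
  unfolding crossing_cell_def by (rule set_eqI) (auto simp: algebra_simps; metis add.commute)

lemma unit_disk_bounds: "a\<^sup>2 + b\<^sup>2 < 1 \<Longrightarrow> \<bar>a\<bar> < 1 \<and> \<bar>b\<bar> < 1" for a b :: real
proof -
  assume "a\<^sup>2 + b\<^sup>2 < 1"
  moreover have "0 \<le> a\<^sup>2" "0 \<le> b\<^sup>2" by simp_all
  ultimately have "a\<^sup>2 < 1" "b\<^sup>2 < 1" by linarith+
  then show ?thesis using abs_square_less_1 by blast
qed

lemma crossing_cell_point: "Complex u v + of_real a * 1 + of_real b * Complex 1 m = Complex (u + a + b) (v + b * m)"
  "Complex u v + of_real a * Complex 1 m + of_real b * 1 = Complex (u + a + b) (v + a * m)"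
  by (simp_all add: complex_eq_iff)

lemma link_crossing_charts:
  assumes m: "m = 0 \<or> m = slope s" and r: "r = 3 \<or> r = -3"
  defines "U \<equiv> crossing_cell (Complex r (crossing_level s)) 1 (Complex 1 (slope s * (r / 3)))"
  shows "\<exists>h. chart_at (Complex r (crossing_level s)) U h \<and> image_pic h (restrict_pic (link_pic s m) U) = crossing_model"
proof -
  let ?k = "slope s * (r / 3)"
  have sl: "slope s = 1 \<and> crossing_level s = 3 \<and> s \<or> slope s = -1 \<and> crossing_level s = -3 \<and> \<not> s" by (simp add: slope_def crossing_level_def)
  have k: "?k = 1 \<or> ?k = -1" using sl r by auto
  have mm: "m = 0 \<or> m = 1 \<or> m = -1" "- m = 0 \<or> - m = 1 \<or> - m = -1" using m sl by auto
  note P = unit_disk_bounds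
  have curve: "Complex (r + a + b) (crossing_level s + b * ?k) \<in> link_curve s \<longleftrightarrow> a = 0 \<or> b = 0" if "\<bar>a\<bar> < 1" "\<bar>b\<bar> < 1" for a b
    using sl r that
    by (elim disjE conjE; simp add: link_curve_Complex piecewise_defs; argo)
  have mark: "Complex (r + a + b) y \<notin> tick 1 (0, 0)" if "\<bar>a\<bar> < 1" "\<bar>b\<bar> < 1" for a b y
    using r that by (elim disjE; simp add: tick_1; argo)
  show ?thesis
  proof (cases "m = 0")
    case True
    show ?thesis
    proof (rule crossing_chart[where du = 1 and dv = "Complex 1 ?k"])
      fix a b :: real assume ab: "a\<^sup>2 + b\<^sup>2 < 1"
      show "Complex r (crossing_level s) + of_real a * 1 + of_real b * Complex 1 ?k \<in> curve (link_pic s m) \<longleftrightarrow> a = 0 \<or> b = 0"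
        unfolding crossing_cell_point using curve P[OF ab] by (simp add: link_pic_def)
      show "Complex r (crossing_level s) + of_real a * 1 + of_real b * Complex 1 ?k \<in> overs (link_pic s m) \<longleftrightarrow> b = 0 \<and> \<bar>a\<bar> \<le> 1/2"
        unfolding crossing_cell_point link_pic_def picture.simps Un_iff tick_slanted[OF mm(1)] tick_slanted[OF mm(2)]
        using P[OF ab] r k True by (elim disjE; simp; argo)
      show "Complex r (crossing_level s) + of_real a * 1 + of_real b * Complex 1 ?k \<notin> markers (link_pic s m)"
        unfolding crossing_cell_point using mark P[OF ab] by (simp add: link_pic_def)
    qed (use k in \<open>auto simp: U_def crossing_cell_def\<close>)
  next
    case False
    then have mk: "r = 3 \<and> m = ?k \<or> r = -3 \<and> - m = ?k" using m r by auto
    show ?thesis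
    proof (rule crossing_chart[where du = "Complex 1 ?k" and dv = 1])
      fix a b :: real assume ab: "a\<^sup>2 + b\<^sup>2 < 1"
      then have ba: "b\<^sup>2 + a\<^sup>2 < 1" by (simp add: add.commute)
      have com: "Complex (r + a + b) (crossing_level s + a * ?k) = Complex (r + b + a) (crossing_level s + a * ?k)" by (simp add: complex_eq_iff)
      show "Complex r (crossing_level s) + of_real a * Complex 1 ?k + of_real b * 1 \<in> curve (link_pic s m) \<longleftrightarrow> a = 0 \<or> b = 0"
        unfolding crossing_cell_point com using curve[of b a] P[OF ab] by (auto simp: link_pic_def)
      show "Complex r (crossing_level s) + of_real a * Complex 1 ?k + of_real b * 1 \<in> overs (link_pic s m) \<longleftrightarrow> b = 0 \<and> \<bar>a\<bar> \<le> 1/2"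
        unfolding crossing_cell_point link_pic_def picture.simps Un_iff tick_slanted[OF mm(1)] tick_slanted[OF mm(2)]
        using P[OF ab] mk k by (elim disjE conjE; simp; argo)
      show "Complex r (crossing_level s) + of_real a * Complex 1 ?k + of_real b * 1 \<notin> markers (link_pic s m)"
        unfolding crossing_cell_point com using mark[of b a] P[OF ab] by (simp add: link_pic_def)
    qed (use k in \<open>auto simp: U_def crossing_cell_swap[of _ 1] crossing_cell_def[of _ "Complex 1 _" 1]\<close>)
  qed
qed

lemma link_vertex_chart:
  assumes m: "m = 0 \<or> m = slope s"
  shows "\<exists>h. chart_at 0 (ball 0 1) h \<and> image_pic h (restrict_pic (link_pic s m) (ball 0 1)) = vertex_model"
proof (intro exI conjI)
  show "chart_at 0 (ball 0 1) id"
    unfolding chart_at_def by (auto intro!: exI[of _ id] simp: homeomorphism_def)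
  have nb: "\<bar>Re z\<bar> < 1 \<and> \<bar>Im z\<bar> < 1" if "norm z < 1" for z
    using that abs_Re_le_cmod[of z] abs_Im_le_cmod[of z] by linarith
  have c: "z \<in> link_curve s \<longleftrightarrow> \<bar>Re z\<bar> = \<bar>Im z\<bar>" if "norm z < 1" for z
    using nb[OF that] unfolding link_curve_def arc_defs Un_iff mem_Collect_eq piecewise_defs
    by (cases s; simp only: if_True if_False; argo)
  have mm: "m = 0 \<or> m = 1 \<or> m = -1" "- m = 0 \<or> - m = 1 \<or> - m = -1" using m by (auto simp: slope_def split: if_splits)
  have o: "z \<notin> overs (link_pic s m)" if "norm z < 1" for z
  proof -
    have "\<not> \<bar>Re z - 3\<bar> \<le> 1/2" "\<not> \<bar>Re z - -3\<bar> \<le> 1/2" using nb[OF that] by argo+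
    then show ?thesis
      using tick_slanted[OF mm(1), of "Re z" "Im z" 3 "crossing_level s"] tick_slanted[OF mm(2), of "Re z" "Im z" "-3" "crossing_level s"]
      by (simp add: link_pic_def)
  qed
  have t: "z \<in> tick 1 (0, 0) \<longleftrightarrow> Im z = 0 \<and> norm z \<le> 1/2" for z
  proof -
    have "z \<in> tick 1 (0, 0) \<longleftrightarrow> Im z = 0 \<and> \<bar>Re z\<bar> \<le> 1/2" using tick_1[of "Re z" "Im z" 0 0] by simp
    moreover have "norm z = \<bar>Re z\<bar>" if "Im z = 0" using that by (simp add: cmod_def)
    ultimately show ?thesis by auto
  qed
  show "image_pic id (restrict_pic (link_pic s m) (ball 0 1)) = vertex_model"
    using c o t by (auto simp: image_pic_def restrict_pic_def vertex_model_def link_pic_def)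
qed

lemma link_diagram:
  assumes m: "m = 0 \<or> m = slope s"
  shows "marked_graph_diagram (link_pic s m)"
  unfolding marked_graph_diagram_def
proof (intro conjI)
  let ?D = "link_pic s m"
  have cD: "curve ?D = link_curve s" by (simp add: link_pic_def)
  have "closed (link_curve s)" unfolding link_curve_def by (intro closed_Un closed_arcs)
  moreover have "link_curve s \<subseteq> cbox (Complex (-20) (-20)) (Complex 20 20)"
  proof
    fix z assume "z \<in> link_curve s"
    then have "\<bar>Re z\<bar> \<le> 20 \<and> \<bar>Im z\<bar> \<le> 20"
      unfolding link_curve_def arc_defs Un_iff mem_Collect_eq piecewise_defs by (cases s; simp only: if_True if_False; argo)
    then show "z \<in> cbox (Complex (-20) (-20)) (Complex 20 20)" by (auto simp: in_cbox_complex_iff)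
  qed
  ultimately show "compact (curve ?D)" unfolding cD by (metis bounded_cbox bounded_subset compact_eq_bounded_closed)
  let ?l = "Complex (-3) (crossing_level s)" and ?r = "Complex 3 (crossing_level s)"
  define U where "U p = (if p = 0 then ball 0 1 else if p = ?l then crossing_cell ?l 1 (Complex 1 (- slope s))
     else crossing_cell ?r 1 (Complex 1 (slope s)))" for p
  have U: "U 0 = ball 0 1" "U ?l = crossing_cell ?l 1 (Complex 1 (- slope s))" "U ?r = crossing_cell ?r 1 (Complex 1 (slope s))"
    by (auto simp: U_def complex_eq_iff)
  \<comment> \<open>The three neighbourhoods are separated by the vertical lines of abscissa -1 and 1.\<close>
  have re: "\<bar>Re z\<bar> < 1" if "z \<in> U 0" for z
    using that abs_Re_le_cmod[of z] unfolding U by simp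
  have rl: "Re z < -1" if "z \<in> U ?l" for z
    using that unit_disk_bounds unfolding U crossing_cell_def by fastforce
  have rr: "Re z > 1" if "z \<in> U ?r" for z
    using that unit_disk_bounds unfolding U crossing_cell_def by fastforce
  show "\<exists>S U. finite S \<and> S \<subseteq> curve ?D \<and> disjoint_family_on U S \<and>
        (\<forall>p\<in>S. \<exists>h. chart_at p (U p) h \<and> image_pic h (restrict_pic ?D (U p)) \<in> {crossing_model, vertex_model}) \<and>
        overs ?D \<union> markers ?D \<subseteq> (\<Union>p\<in>S. U p) \<and>
        (\<forall>p \<in> curve ?D - S. \<exists>V h. chart_at p V h \<and> h ` (curve ?D \<inter> V) = {z \<in> ball 0 1. Im z = 0})"
  proof (intro exI conjI)
    show "finite (double_points s)" by (simp add: double_points_def)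
    show "double_points s \<subseteq> curve ?D"
      unfolding cD double_points_def using link_curve_Complex[of 0 0 s]
      by (cases s; simp add: link_curve_Complex crossing_level_def piecewise_defs zero_complex.code)
    show "disjoint_family_on U (double_points s)"
      unfolding disjoint_family_on_def
    proof (intro ballI impI)
      fix p q assume "p \<in> double_points s" "q \<in> double_points s" "p \<noteq> q"
      then consider "p = 0" "q = ?l" | "p = 0" "q = ?r" | "p = ?l" "q = ?r" | "p = ?l" "q = 0" | "p = ?r" "q = 0" | "p = ?r" "q = ?l"
        unfolding double_points_def by blast
      then show "U p \<inter> U q = {}"
      proof cases
        case 1 then show ?thesis using re rl by fastforce
      next
        case 2 then show ?thesis using re rr by fastforce
      next
        case 3 then show ?thesis using rl rr by fastforce
      next
        case 4 then show ?thesis using re rl by fastforce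
      next
        case 5 then show ?thesis using re rr by fastforce
      next
        case 6 then show ?thesis using rl rr by fastforce
      qed
    qed
    show "\<forall>p\<in>double_points s. \<exists>h. chart_at p (U p) h \<and> image_pic h (restrict_pic ?D (U p)) \<in> {crossing_model, vertex_model}"
    proof
      fix p assume "p \<in> double_points s"
      then consider "p = 0" | "p = ?l" | "p = ?r" unfolding double_points_def by blast
      then show "\<exists>h. chart_at p (U p) h \<and> image_pic h (restrict_pic ?D (U p)) \<in> {crossing_model, vertex_model}"
      proof cases
        case 1
        show ?thesis unfolding 1 U using link_vertex_chart[OF m] by blast
      next
        case 2
        show ?thesis unfolding 2 U using link_crossing_charts[OF m, of "-3"] by auto
      next
        case 3
        show ?thesis unfolding 3 U using link_crossing_charts[OF m, of 3] by auto
      qed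
    qed
    show "overs ?D \<union> markers ?D \<subseteq> (\<Union>p\<in>double_points s. U p)"
    proof
      fix z assume "z \<in> overs ?D \<union> markers ?D"
      then consider "z \<in> tick (Complex 1 (- m)) (-3, crossing_level s)" | "z \<in> tick (Complex 1 m) (3, crossing_level s)" | "z \<in> tick 1 (0, 0)"
        unfolding link_pic_def by auto
      then show "z \<in> (\<Union>p\<in>double_points s. U p)"
      proof cases
        case 1
        have mm: "- m = 0 \<or> - m = 1 \<or> - m = -1" using m by (auto simp: slope_def split: if_splits)
        have z: "Im z = crossing_level s - m * (Re z + 3)" "\<bar>Re z + 3\<bar> \<le> 1/2"
          using 1 tick_slanted[OF mm, of "Re z" "Im z" "-3" "crossing_level s"] by simp_all
        have sq: "(Re z + 3)\<^sup>2 < 1" using z(2) abs_square_less_1[of "Re z + 3"] by linarith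
        have "z \<in> U ?l"
        proof (cases "m = 0")
          case True
          have "z = ?l + of_real (Re z + 3) * 1 + of_real 0 * Complex 1 (- slope s)" using z True by (simp add: complex_eq_iff)
          moreover have "(Re z + 3)\<^sup>2 + 0\<^sup>2 < 1" using sq by simp
          ultimately show ?thesis unfolding U crossing_cell_def by blast
        next
          case False
          then have "z = ?l + of_real 0 * 1 + of_real (Re z + 3) * Complex 1 (- slope s)" using z m by (simp add: complex_eq_iff)
          moreover have "0\<^sup>2 + (Re z + 3)\<^sup>2 < 1" using sq by simp
          ultimately show ?thesis unfolding U crossing_cell_def by blast
        qed
        then show ?thesis by (auto simp: double_points_def)
      next
        case 2
        have mm: "m = 0 \<or> m = 1 \<or> m = -1" using m by (auto simp: slope_def split: if_splits)
        have z: "Im z = crossing_level s + m * (Re z - 3)" "\<bar>Re z - 3\<bar> \<le> 1/2"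
          using 2 tick_slanted[OF mm, of "Re z" "Im z" "3" "crossing_level s"] by simp_all
        have sq: "(Re z - 3)\<^sup>2 < 1" using z(2) abs_square_less_1[of "Re z - 3"] by linarith
        have "z \<in> U ?r"
        proof (cases "m = 0")
          case True
          have "z = ?r + of_real (Re z - 3) * 1 + of_real 0 * Complex 1 (slope s)" using z True by (simp add: complex_eq_iff)
          moreover have "(Re z - 3)\<^sup>2 + 0\<^sup>2 < 1" using sq by simp
          ultimately show ?thesis unfolding U crossing_cell_def by blast
        next
          case False
          then have "z = ?r + of_real 0 * 1 + of_real (Re z - 3) * Complex 1 (slope s)" using z m by (simp add: complex_eq_iff)
          moreover have "0\<^sup>2 + (Re z - 3)\<^sup>2 < 1" using sq by simp
          ultimately show ?thesis unfolding U crossing_cell_def by blast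
        qed
        then show ?thesis by (auto simp: double_points_def)
      next
        case 3
        then have "Im z = 0" "\<bar>Re z\<bar> \<le> 1/2" using tick_1[of "Re z" "Im z" 0 0] by simp_all
        then have "z \<in> U 0" unfolding U by (simp add: cmod_def)
        then show ?thesis by (auto simp: double_points_def)
      qed
    qed
    show "\<forall>p \<in> curve ?D - double_points s. \<exists>V h. chart_at p V h \<and> h ` (curve ?D \<inter> V) = {z \<in> ball 0 1. Im z = 0}"
    proof
      fix p assume "p \<in> curve ?D - double_points s"
      then have p: "p \<in> link_curve s" "p \<notin> double_points s" by (simp_all add: cD)
      from p have "\<exists>N \<phi>. graph_near (link_curve s) p N \<phi>"
      proof (cases rule: link_regular_cases)
        case 1 then show ?thesis using rising_arc_regular(4)[of p s] p(2) by blast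
      next
        case 2 then show ?thesis using falling_arc_regular(4)[of p s] p(2) by blast
      next
        case 3 then show ?thesis using level_arc_regular(4)[of p s] p(2) by blast
      next
        case 4 then show ?thesis using closing_edge_regular(4)[of p s] by blast
      qed (use link_corners in blast)+
      then show "\<exists>V h. chart_at p V h \<and> h ` (curve ?D \<inter> V) = {z \<in> ball 0 1. Im z = 0}"
        unfolding cD using graph_near_chart by blast
    qed
  qed
qed

lemma link_replaces:
  "replaces \<Omega>4 (link_pic False 0) (link_pic True 0)"
  "replaces \<Omega>4' (link_pic False (-1)) (link_pic True 1)"
proof -
  have out: "link_curve False \<inter> - disk = link_curve True \<inter> - disk"
    by (rule set_eq_Complex) (simp add: link_curve_Complex disk_Complex piecewise_defs; argo)
  have ov: "overs (link_pic s m) \<subseteq> disk" if "m = 0 \<or> m = 1 \<or> m = -1" for s m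
  proof
    fix z assume "z \<in> overs (link_pic s m)"
    moreover have m': "- m = 0 \<or> - m = 1 \<or> - m = -1" using that by auto
    ultimately have "Im z - crossing_level s = m * (Re z - 3) \<and> \<bar>Re z - 3\<bar> \<le> 1/2 \<or>
        Im z - crossing_level s = - m * (Re z - -3) \<and> \<bar>Re z - -3\<bar> \<le> 1/2"
      using tick_slanted[OF that, of "Re z" "Im z" 3 "crossing_level s"] tick_slanted[OF m', of "Re z" "Im z" "-3" "crossing_level s"]
      unfolding link_pic_def by auto
    then have "Complex (Re z) (Im z) \<in> disk"
      using that unfolding disk_Complex crossing_level_def by (elim disjE; cases s; simp; argo)
    then show "z \<in> disk" by simp
  qed
  have mk: "tick 1 (0, 0) \<subseteq> disk"
  proof
    fix z assume "z \<in> tick 1 (0, 0)"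
    then have "Complex (Re z) (Im z) \<in> disk" using tick_1[of "Re z" "Im z" 0 0] unfolding disk_Complex by simp
    then show "z \<in> disk" by simp
  qed
  have inl: "link_curve False \<inter> disk = strand_SW_NE \<union> strand_NW_SE \<union> strand_H_below"
    by (rule set_eq_Complex)
      (simp add: link_curve_Complex disk_Complex strand_SW_NE_Complex strand_NW_SE_Complex strand_H_below_Complex piecewise_defs; argo)
  have inr: "link_curve True \<inter> disk = strand_SW_NE \<union> strand_NW_SE \<union> strand_H_above"
    by (rule set_eq_Complex)
      (simp add: link_curve_Complex disk_Complex strand_SW_NE_Complex strand_NW_SE_Complex strand_H_above_Complex piecewise_defs; argo)
  have dirs: "Complex 1 0 = 1" "Complex 1 1 = 1 + \<i>" "Complex 1 (-1) = 1 - \<i>" by (simp_all add: complex_eq_iff)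
  have eqs: "restrict_pic (link_pic False m) (- disk) = restrict_pic (link_pic True m') (- disk)"
    if "m = 0 \<or> m = 1 \<or> m = -1" "m' = 0 \<or> m' = 1 \<or> m' = -1" for m m'
    using out ov[OF that(1), of False] ov[OF that(2), of True] mk by (auto simp: restrict_pic_def link_pic_def)
  have ins: "restrict_pic (link_pic s m) disk =
      \<lparr>curve = link_curve s \<inter> disk, overs = overs (link_pic s m), markers = tick 1 (0, 0)\<rparr>"
    if "m = 0 \<or> m = 1 \<or> m = -1" for s m
    using ov[OF that, of s] mk by (auto simp: restrict_pic_def link_pic_def)
  show "replaces \<Omega>4 (link_pic False 0) (link_pic True 0)"
    unfolding replaces_def
  proof (intro conjI)
    show "restrict_pic (link_pic False 0) (- disk) = restrict_pic (link_pic True 0) (- disk)"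
      by (rule eqs) simp_all
    show "restrict_pic (link_pic False 0) disk = left_side \<Omega>4" "restrict_pic (link_pic True 0) disk = right_side \<Omega>4"
      by (subst ins, simp, simp add: inl inr link_pic_def crossing_level_def dirs)+
  qed (rule link_diagram; simp)+
  show "replaces \<Omega>4' (link_pic False (-1)) (link_pic True 1)"
    unfolding replaces_def
  proof (intro conjI)
    show "restrict_pic (link_pic False (-1)) (- disk) = restrict_pic (link_pic True 1) (- disk)"
      by (rule eqs) simp_all
    show "restrict_pic (link_pic False (-1)) disk = left_side \<Omega>4'" "restrict_pic (link_pic True 1) disk = right_side \<Omega>4'"
      by (subst ins, simp, simp add: inl inr link_pic_def crossing_level_def dirs)+
  qed (rule link_diagram; simp add: slope_def)+
qed

lemma plane_isotopic_refl: "plane_isotopic D D"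
  unfolding plane_isotopic_def
proof (intro exI conjI ballI allI)
  show "continuous_on ({0..1} \<times> UNIV) (\<lambda>(t :: real, z :: complex). z)"
    unfolding case_prod_unfold by (intro continuous_intros)
  show "homeomorphism UNIV UNIV (\<lambda>z :: complex. z) (\<lambda>z. z)" by (simp add: homeomorphism_def)
  show "D = image_pic (\<lambda>z. z) D" by (simp add: image_pic_def)
qed simp

lemma move_of_replaces: "replaces m D D' \<Longrightarrow> move m D D'"
  unfolding move_def using plane_isotopic_refl by blast

text \<open>
  From the vertex to the left, the marker lies between the rising strand and the falling strand.  With
  \<open>H\<close> below, this sector is not cut off: it widens to the unbounded region, which is unshaded.
\<close>

lemma lower_link_not_odd_colourable: "\<not> odd_colourable (link_curve False) (tick 1 (0, 0))"
proof
  let ?C = "link_curve False" and ?M = "tick 1 (0, 0)"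
  assume "odd_colourable ?C ?M"
  then obtain f where f: "region_colouring ?C ?M f" and odd: "odd (card (rainbow ?C ?M f))"
    unfolding odd_colourable_def by blast
  have lc: "locally_constant_off ?C f" and "bounded {z. z \<notin> ?C \<and> fst (f z)}"
    using f by (simp_all add: region_colouring_def)
  then obtain B where B: "\<And>z. z \<notin> ?C \<Longrightarrow> fst (f z) \<Longrightarrow> norm z \<le> B"
    unfolding bounded_iff by blast
  define R where "R = \<bar>B\<bar> + 2"
  have R: "R \<ge> 2" "R > B" by (simp_all add: R_def)
  \<comment> \<open>A strip between two polygonal lines that leads from the marker to infinity without meeting the
      curve: it starts at the vertex and stays above the rising strand and the left end of \<open>H\<close>, and
      below the falling strand.\<close>
  have off: "Complex x y \<notin> ?C" if "x < 0" "max x ((- x - 1) / 4) < y" "y < - x / 2" for x y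
    using that unfolding link_curve_Complex piecewise_defs if_False by argo
  have "\<exists>c. \<forall>x y. - (R + 1) < x \<longrightarrow> x < 0 \<longrightarrow> max x ((- x - 1) / 4) < y \<longrightarrow> y < - x / 2 \<longrightarrow> f (Complex x y) = c"
  proof (rule constant_between_ygraphs[OF lc])
    show "continuous_on {- (R + 1)<..<0} (\<lambda>x. max x ((- x - 1) / 4))" "continuous_on {- (R + 1)<..<0} (\<lambda>x::real. - x / 2)"
      by (intro continuous_intros; simp)+
  qed (use off in auto)
  then obtain c where c: "\<And>x y. - (R + 1) < x \<Longrightarrow> x < 0 \<Longrightarrow> max x ((- x - 1) / 4) < y \<Longrightarrow> y < - x / 2 \<Longrightarrow> f (Complex x y) = c"
    by blast
  let ?far = "Complex (- R) (R / 3)"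
  have far: "f ?far = c" "?far \<notin> ?C" by (rule c off; use R in argo)+
  have "\<bar>Re ?far\<bar> \<le> norm ?far" by (rule abs_Re_le_cmod)
  then have "\<not> norm ?far \<le> B" using R by simp
  then have nc: "\<not> fst c" using B[of ?far] far by auto
  have near: "Complex (- t) 0 \<in> {z \<in> ?M - ?C. \<not> fst (f z)}" if "0 < t" "t < 1/2" for t
  proof -
    have "f (Complex (- t) 0) = c" "Complex (- t) 0 \<notin> ?C" by (rule c off; use R that in argo)+
    then show ?thesis using that nc by (simp add: tick_1)
  qed
  have "Complex 0 0 \<in> closure {z \<in> ?M - ?C. \<not> fst (f z)}"
    by (rule mem_closure_ray_xy[of "1/2" 0 "-1" 0 0]) (use near in simp_all)
  then have zero: "Complex 0 0 \<notin> rainbow ?C ?M f" by (simp add: rainbow_def)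
  have lcW: "locally_constant_off (?C \<union> - disk_interior) f"
    using lc unfolding locally_constant_off_def by (auto elim: eventually_mono)
  have "v \<notin> rainbow ?C ?M f" for v
  proof
    assume v: "v \<in> rainbow ?C ?M f"
    then have vM: "Im v = 0" "\<bar>Re v\<bar> \<le> 1/2" using tick_1[of "Re v" "Im v" 0 0] by (auto simp: rainbow_def)
    then have "v \<in> disk_interior" by (simp add: disk_interior_def)
    then have "v \<in> ?C" using v off_not_rainbow[OF lcW, of v] by (auto simp: rainbow_def)
    then have "Re v = 0" using vM unfolding link_curve_def arc_defs Un_iff mem_Collect_eq piecewise_defs if_False by argo
    then have "v = Complex 0 0" using vM(1) by (simp add: complex_eq_iff)
    then show False using v zero by simp
  qed
  then have "rainbow ?C ?M f = {}" by blast
  then show False using odd by simp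
qed

section \<open>A colouring with one rainbow vertex\<close>

definition inside_loop :: "complex \<Rightarrow> bool" where
  "inside_loop z \<longleftrightarrow> falling_x (Im z) < Re z \<and> Re z < 18"

text \<open>
  One lobe of the figure eight lies below the rising strand and above \<open>H\<close>, the other one above the rising
  strand and below \<open>H\<close>.  The bounds on the ordinate and on the abscissa cut off the regions beyond the
  corners, where the two graphs run on and cross back.
\<close>

definition inside_eight :: "complex \<Rightarrow> bool" where
  "inside_eight z \<longleftrightarrow> rising_x (Im z) < Re z \<and> level_y True (Re z) < Im z \<and> 0 < Im z \<or>
     Re z < rising_x (Im z) \<and> Im z < level_y True (Re z) \<and> Re z < 6"

text \<open>
  The shading of two closed curves in general position is the sum of their insides; the active edges
  are those of the simple loop.
\<close>

definition link_colour :: "complex \<Rightarrow> bool \<times> bool" where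
  "link_colour z = (inside_loop z \<noteq> inside_eight z, inside_loop z)"

lemma inside_loop_local:
  assumes "p \<notin> falling_arc" "p \<notin> closing_edge"
  shows "\<exists>N. open N \<and> p \<in> N \<and> (\<forall>z\<in>N. inside_loop z = inside_loop p)"
proof -
  have "falling_x (Im p) < Re p \<and> Re p < 18 \<or> Re p < falling_x (Im p) \<or> 18 < Re p"
    using assms unfolding falling_arc_def closing_edge_def mem_Collect_eq piecewise_defs by argo
  moreover have "open {z. falling_x (Im z) < Re z \<and> Re z < 18}" "open {z. Re z < falling_x (Im z) \<or> 18 < Re z}"
    by (intro open_Collect_conj open_Collect_disj open_Collect_less continuous_intros)+
  ultimately consider "open {z. falling_x (Im z) < Re z \<and> Re z < 18}" "p \<in> {z. falling_x (Im z) < Re z \<and> Re z < 18}"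
    | "open {z. Re z < falling_x (Im z) \<or> 18 < Re z}" "p \<in> {z. Re z < falling_x (Im z) \<or> 18 < Re z}" by blast
  then show ?thesis
  proof cases
    case 1
    then show ?thesis by (intro exI[of _ "{z. falling_x (Im z) < Re z \<and> Re z < 18}"]) (auto simp: inside_loop_def)
  next
    case 2
    then show ?thesis by (intro exI[of _ "{z. Re z < falling_x (Im z) \<or> 18 < Re z}"]) (auto simp: inside_loop_def)
  qed
qed

lemma inside_eight_local:
  assumes "p \<notin> rising_arc" "p \<notin> level_arc True"
  shows "\<exists>N. open N \<and> p \<in> N \<and> (\<forall>z\<in>N. inside_eight z = inside_eight p)"
proof -
  let ?H = "\<lambda>z. level_y True (Re z)" and ?X = "\<lambda>z. rising_x (Im z)"
  \<comment> \<open>The complement of \<open>?A\<close> is, away from the two arcs, the open set \<open>?B\<close>; both sets are described by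
      strict inequalities.\<close>
  let ?A = "{z. ?X z < Re z \<and> ?H z < Im z \<and> 0 < Im z \<or> Re z < ?X z \<and> Im z < ?H z \<and> Re z < 6}"
  let ?B = "{z. Re z < ?X z \<and> ?H z < Im z \<or> ?X z < Re z \<and> Im z < ?H z \<or> Im z < ?H z \<and> 6 < Re z \<or>
     ?H z < Im z \<and> Im z < 0 \<or> Re z < ?X z \<and> 6 < Re z \<or> ?X z < Re z \<and> Im z < 0}"
  have "open ?A" "open ?B"
    by (intro open_Collect_conj open_Collect_disj open_Collect_less continuous_intros)+
  moreover have "p \<in> ?A \<or> p \<in> ?B"
    using assms unfolding rising_arc_def level_arc_def mem_Collect_eq piecewise_defs if_True by argo
  moreover have "inside_eight z" if "z \<in> ?A" for z using that by (simp add: inside_eight_def)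
  moreover have "\<not> inside_eight z" if "z \<in> ?B" for z
    using that unfolding inside_eight_def mem_Collect_eq by argo
  ultimately show ?thesis
    by (elim disjE) (rule exI[of _ ?A], blast, rule exI[of _ ?B], blast)
qed

text \<open>
  Crossing an edge of the link flips exactly one of \<open>inside_loop\<close> and \<open>inside_eight\<close>, hence the shading.
\<close>

lemma link_colour_flip:
  assumes g: "graph_near (link_curve True) p N \<phi>" and N': "open N'" "p \<in> N'"
    and b: "\<And>z. z \<in> N \<Longrightarrow> z \<in> N' \<Longrightarrow> \<phi> z \<noteq> 0 \<Longrightarrow> inside_loop z = b (\<phi> z > 0)"
    and l: "\<And>z. z \<in> N \<Longrightarrow> z \<in> N' \<Longrightarrow> \<phi> z \<noteq> 0 \<Longrightarrow> inside_eight z = l (\<phi> z > 0)"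
    and flip: "(b True \<noteq> b False) \<noteq> (l True \<noteq> l False)"
  shows "\<exists>c d. fst c \<noteq> fst d \<and> colours_at (link_curve True) link_colour p = {c, d}"
proof -
  let ?G = "\<lambda>x. (b x \<noteq> l x, b x)"
  have "colours_at (link_curve True) link_colour p = {?G True, ?G False}"
    by (rule graph_near_colours[OF graph_near_shrink[OF g N']]) (use b l in \<open>simp add: link_colour_def\<close>)
  moreover have "fst (?G True) \<noteq> fst (?G False)" using flip by auto
  ultimately show ?thesis by blast
qed

lemma upper_link_edges:
  assumes p: "p \<in> link_curve True" "p \<notin> double_points True"
  shows "\<exists>c d. fst c \<noteq> fst d \<and> colours_at (link_curve True) link_colour p = {c, d}"
  using p
proof (cases rule: link_regular_cases)
  case 1
  note reg = rising_arc_regular[OF 1 p(2)]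
  obtain N where N: "graph_near (link_curve True) p N (\<lambda>z. Re z - rising_x (Im z))" using reg(4) by blast
  obtain M where M: "open M" "p \<in> M" "\<And>z. z \<in> M \<Longrightarrow> inside_loop z = inside_loop p" using inside_loop_local[OF reg(1,3)] by blast
  have x: "Re p = rising_x (Im p)" using 1 by (simp add: rising_arc_def)
  have "level_y True (Re p) < Im p \<and> 0 < Im p \<or> Im p < level_y True (Re p) \<and> Re p < 6"
    using x 1(2) reg(2) unfolding level_arc_def mem_Collect_eq piecewise_defs if_True by argo
  then show ?thesis
  proof
    assume s: "level_y True (Re p) < Im p \<and> 0 < Im p"
    show ?thesis
    proof (rule link_colour_flip[OF N, where N' = "M \<inter> {z. level_y True (Re z) < Im z \<and> 0 < Im z}" and b = "\<lambda>_. inside_loop p" and l = "\<lambda>x. x"])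
      show "open (M \<inter> {z. level_y True (Re z) < Im z \<and> 0 < Im z})"
        by (intro open_Int M open_Collect_conj open_Collect_less continuous_intros)
      show "inside_loop z = inside_loop p" if "z \<in> M \<inter> {z. level_y True (Re z) < Im z \<and> 0 < Im z}" for z using M(3)[of z] that by blast
    qed (use M(1,2) s in \<open>auto simp: inside_eight_def\<close>)
  next
    assume s: "Im p < level_y True (Re p) \<and> Re p < 6"
    show ?thesis
    proof (rule link_colour_flip[OF N, where N' = "M \<inter> {z. Im z < level_y True (Re z) \<and> Re z < 6}" and b = "\<lambda>_. inside_loop p" and l = "\<lambda>x. \<not> x"])
      show "open (M \<inter> {z. Im z < level_y True (Re z) \<and> Re z < 6})"
        by (intro open_Int M open_Collect_conj open_Collect_less continuous_intros)
      show "inside_loop z = inside_loop p" if "z \<in> M \<inter> {z. Im z < level_y True (Re z) \<and> Re z < 6}" for z using M(3)[of z] that by blast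
    qed (use M(1,2) s in \<open>auto simp: inside_eight_def\<close>)
  qed
next
  case 2
  note reg = falling_arc_regular[OF 2 p(2)]
  obtain N where N: "graph_near (link_curve True) p N (\<lambda>z. Re z - falling_x (Im z))" using reg(4) by blast
  obtain M where M: "open M" "p \<in> M" "\<And>z. z \<in> M \<Longrightarrow> inside_eight z = inside_eight p" using inside_eight_local[OF reg(1,2)] by blast
  have s: "Re p < 18" using 2 unfolding falling_arc_def mem_Collect_eq piecewise_defs by argo
  show ?thesis
  proof (rule link_colour_flip[OF N, where N' = "M \<inter> {z. Re z < 18}" and b = "\<lambda>x. x" and l = "\<lambda>_. inside_eight p"])
    show "open (M \<inter> {z. Re z < 18})" by (intro open_Int M open_Collect_less continuous_intros)
    show "inside_eight z = inside_eight p" if "z \<in> M \<inter> {z. Re z < 18}" for z using M(3)[of z] that by blast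
  qed (use M(1,2) s in \<open>auto simp: inside_loop_def\<close>)
next
  case 3
  note reg = level_arc_regular[OF 3 p(2)]
  obtain N where N: "graph_near (link_curve True) p N (\<lambda>z. Im z - level_y True (Re z))" using reg(4) by blast
  obtain M where M: "open M" "p \<in> M" "\<And>z. z \<in> M \<Longrightarrow> inside_loop z = inside_loop p" using inside_loop_local[OF reg(2,3)] by blast
  have y: "Im p = level_y True (Re p)" using 3 by (simp add: level_arc_def)
  have "rising_x (Im p) < Re p \<and> - 8 < Re p \<or> Re p < rising_x (Im p) \<and> Re p < 6"
    using y 3(2) reg(1) unfolding rising_arc_def mem_Collect_eq piecewise_defs if_True by argo
  then show ?thesis
  proof
    assume s: "rising_x (Im p) < Re p \<and> - 8 < Re p"
    have Y: "level_y True x \<ge> 0" if "- 8 < x" for x using that unfolding piecewise_defs if_True by argo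
    show ?thesis
    proof (rule link_colour_flip[OF N, where N' = "M \<inter> {z. rising_x (Im z) < Re z \<and> - 8 < Re z}" and b = "\<lambda>_. inside_loop p" and l = "\<lambda>x. x"])
      show "open (M \<inter> {z. rising_x (Im z) < Re z \<and> - 8 < Re z})"
        by (intro open_Int M open_Collect_conj open_Collect_less continuous_intros)
      fix z assume "z \<in> M \<inter> {z. rising_x (Im z) < Re z \<and> - 8 < Re z}"
      then show "inside_eight z = (Im z - level_y True (Re z) > 0)"
        using Y[of "Re z"] by (auto simp: inside_eight_def)
    next
      show "inside_loop z = inside_loop p" if "z \<in> M \<inter> {z. rising_x (Im z) < Re z \<and> - 8 < Re z}" for z using M(3)[of z] that by blast
    qed (use M(1,2) s in auto)
  next
    assume s: "Re p < rising_x (Im p) \<and> Re p < 6"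
    show ?thesis
    proof (rule link_colour_flip[OF N, where N' = "M \<inter> {z. Re z < rising_x (Im z) \<and> Re z < 6}" and b = "\<lambda>_. inside_loop p" and l = "\<lambda>x. \<not> x"])
      show "open (M \<inter> {z. Re z < rising_x (Im z) \<and> Re z < 6})"
        by (intro open_Int M open_Collect_conj open_Collect_less continuous_intros)
      show "inside_loop z = inside_loop p" if "z \<in> M \<inter> {z. Re z < rising_x (Im z) \<and> Re z < 6}" for z using M(3)[of z] that by blast
    qed (use M(1,2) s in \<open>auto simp: inside_eight_def\<close>)
  qed
next
  case 4
  note reg = closing_edge_regular(1,2)[OF 4] closing_edge_regular(3,4)[OF 4, where s = True]
  obtain N where N: "graph_near (link_curve True) p N (\<lambda>z. Re z - 18)" using reg(4) by blast
  obtain M where M: "open M" "p \<in> M" "\<And>z. z \<in> M \<Longrightarrow> inside_eight z = inside_eight p" using inside_eight_local[OF reg(1,3)] by blast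
  have s: "falling_x (Im p) < Re p" using 4 unfolding closing_edge_def mem_Collect_eq piecewise_defs by argo
  show ?thesis
  proof (rule link_colour_flip[OF N, where N' = "M \<inter> {z. falling_x (Im z) < Re z}" and b = "\<lambda>x. \<not> x" and l = "\<lambda>_. inside_eight p"])
    show "open (M \<inter> {z. falling_x (Im z) < Re z})" by (intro open_Int M open_Collect_less continuous_intros)
    show "inside_eight z = inside_eight p" if "z \<in> M \<inter> {z. falling_x (Im z) < Re z}" for z using M(3)[of z] that by blast
  qed (use M(1,2) s in \<open>auto simp: inside_loop_def\<close>)
next
  case 5
  show ?thesis unfolding 5
  proof (rule link_colour_flip[OF link_corners(1), where N' = UNIV and b = "\<lambda>_. True" and l = "\<lambda>x. x"])
    fix z assume "z \<in> {z. \<bar>Re z - 9\<bar> < 1 \<and> \<bar>Im z - 9\<bar> < 1}" and nz: "wall (-5) 2 (-4) (-1) abs (Complex 9 9) z \<noteq> 0"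
    then have z: "\<bar>Re z - 9\<bar> < 1" "\<bar>Im z - 9\<bar> < 1" by simp_all
    show "inside_loop z = True" using z unfolding inside_loop_def piecewise_defs by argo
    show "inside_eight z = (wall (-5) 2 (-4) (-1) abs (Complex 9 9) z > 0)"
      using z nz unfolding inside_eight_def wall_def complex.sel piecewise_defs if_True by argo
  qed auto
next
  case 6
  show ?thesis unfolding 6
  proof (rule link_colour_flip[OF link_corners(2), where N' = UNIV and b = "\<lambda>_. False" and l = "\<lambda>x. x"])
    fix z assume "z \<in> {z. \<bar>Re z - -9\<bar> < 1 \<and> \<bar>Im z - -9\<bar> < 1}" and nz: "wall 5 (-2) 4 1 abs (Complex (-9) (-9)) z \<noteq> 0"
    then have z: "\<bar>Re z - -9\<bar> < 1" "\<bar>Im z - -9\<bar> < 1" by simp_all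
    show "inside_loop z = False" using z unfolding inside_loop_def piecewise_defs by argo
    show "inside_eight z = (wall 5 (-2) 4 1 abs (Complex (-9) (-9)) z > 0)"
      using z nz unfolding inside_eight_def wall_def complex.sel piecewise_defs if_True by argo
  qed auto
next
  case 7
  show ?thesis unfolding 7
  proof (rule link_colour_flip[OF link_corners(3), where N' = UNIV and b = "\<lambda>x. x" and l = "\<lambda>_. False"])
    fix z assume "z \<in> {z. \<bar>Re z - 18\<bar> < 1 \<and> \<bar>Im z - 16\<bar> < 1}" and nz: "wall (-2) 3 0 (-3) abs (Complex 18 16) z \<noteq> 0"
    then have z: "\<bar>Re z - 18\<bar> < 1" "\<bar>Im z - 16\<bar> < 1" by simp_all
    show "inside_loop z = (wall (-2) 3 0 (-3) abs (Complex 18 16) z > 0)"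
      using z nz unfolding inside_loop_def wall_def complex.sel piecewise_defs by argo
    show "inside_eight z = False"
      using z unfolding inside_eight_def piecewise_defs if_True by argo
  qed auto
next
  case 8
  show ?thesis unfolding 8
  proof (rule link_colour_flip[OF link_corners(4), where N' = UNIV and b = "\<lambda>x. x" and l = "\<lambda>_. False"])
    fix z assume "z \<in> {z. \<bar>Re z - 18\<bar> < 1 \<and> \<bar>Im z - -20\<bar> < 1}" and nz: "wall (-2) (-1) 0 1 abs (Complex 18 (-20)) z \<noteq> 0"
    then have z: "\<bar>Re z - 18\<bar> < 1" "\<bar>Im z - -20\<bar> < 1" by simp_all
    show "inside_loop z = (wall (-2) (-1) 0 1 abs (Complex 18 (-20)) z > 0)"
      using z nz unfolding inside_loop_def wall_def complex.sel piecewise_defs by argo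
    show "inside_eight z = False"
      using z unfolding inside_eight_def piecewise_defs if_True by argo
  qed auto
qed

lemma link_colourI:
  "inside_loop z = b \<Longrightarrow> inside_eight z = l \<Longrightarrow> link_colour z = (b \<noteq> l, b)"
  by (simp add: link_colour_def)

text \<open>
  At the vertex and at the left crossing, where the loop meets the figure eight, all four colours occur.
  The right crossing is the self-crossing of the figure eight; no edge is active there.
\<close>

lemma upper_link_crossings:
  "colours_at (link_curve True) link_colour (Complex 0 0) = {(True, True), (False, False), (False, True), (True, False)}"
  "colours_at (link_curve True) link_colour (Complex (-3) 3) = {(True, True), (False, True), (False, False), (True, False)}"
  "colours_at (link_curve True) link_colour (Complex 3 3) = {(False, True), (True, True), (True, True), (False, True)}"
proof -
  note lc = link_curve_Complex piecewise_defs if_True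
  note big = inside_loop_def complex.sel piecewise_defs and lob = inside_eight_def complex.sel piecewise_defs if_True
  show "colours_at (link_curve True) link_colour (Complex 0 0) = {(True, True), (False, False), (False, True), (True, False)}"
  proof (rule colours_at_crossing[where a = 1 and b = "-1" and c = 1 and d = 1 and e = 1])
    fix x y :: real assume xy: "\<bar>x - 0\<bar> < 1" "\<bar>y - 0\<bar> < 1"
    let ?s = "1 * (x - 0) + -1 * (y - 0)" and ?t = "1 * (x - 0) + 1 * (y - 0)"
    show "Complex x y \<in> link_curve True \<longleftrightarrow> ?s = 0 \<or> ?t = 0" using xy unfolding lc by argo
    have "inside_loop (Complex x y) = (?t > 0)" using xy unfolding big by argo
    moreover have "inside_eight (Complex x y) = (?s < 0)" using xy unfolding lob by argo
    ultimately have c: "link_colour (Complex x y) = ((?t > 0) \<noteq> (?s < 0), ?t > 0)" by (rule link_colourI)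
    show "link_colour (Complex x y) = (True, True)" if "?s > 0" "?t > 0" unfolding c using that by auto
    show "link_colour (Complex x y) = (False, False)" if "?s > 0" "?t < 0" unfolding c using that by auto
    show "link_colour (Complex x y) = (False, True)" if "?s < 0" "?t > 0" unfolding c using that by auto
    show "link_colour (Complex x y) = (True, False)" if "?s < 0" "?t < 0" unfolding c using that by auto
  qed simp_all
  show "colours_at (link_curve True) link_colour (Complex (-3) 3) = {(True, True), (False, True), (False, False), (True, False)}"
  proof (rule colours_at_crossing[where a = 1 and b = 1 and c = 0 and d = 1 and e = 1])
    fix x y :: real assume xy: "\<bar>x - -3\<bar> < 1" "\<bar>y - 3\<bar> < 1"
    let ?s = "1 * (x - -3) + 1 * (y - 3)" and ?t = "0 * (x - -3) + 1 * (y - 3)"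
    show "Complex x y \<in> link_curve True \<longleftrightarrow> ?s = 0 \<or> ?t = 0" using xy unfolding lc by argo
    have "inside_loop (Complex x y) = (?s > 0)" using xy unfolding big by argo
    moreover have "inside_eight (Complex x y) = (?t < 0)" using xy unfolding lob by argo
    ultimately have c: "link_colour (Complex x y) = ((?s > 0) \<noteq> (?t < 0), ?s > 0)" by (rule link_colourI)
    show "link_colour (Complex x y) = (True, True)" if "?s > 0" "?t > 0" unfolding c using that by auto
    show "link_colour (Complex x y) = (False, True)" if "?s > 0" "?t < 0" unfolding c using that by auto
    show "link_colour (Complex x y) = (False, False)" if "?s < 0" "?t > 0" unfolding c using that by auto
    show "link_colour (Complex x y) = (True, False)" if "?s < 0" "?t < 0" unfolding c using that by auto
  qed simp_all
  show "colours_at (link_curve True) link_colour (Complex 3 3) = {(False, True), (True, True), (True, True), (False, True)}"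
  proof (rule colours_at_crossing[where a = 1 and b = "-1" and c = 0 and d = 1 and e = 1])
    fix x y :: real assume xy: "\<bar>x - 3\<bar> < 1" "\<bar>y - 3\<bar> < 1"
    let ?s = "1 * (x - 3) + -1 * (y - 3)" and ?t = "0 * (x - 3) + 1 * (y - 3)"
    show "Complex x y \<in> link_curve True \<longleftrightarrow> ?s = 0 \<or> ?t = 0" using xy unfolding lc by argo
    have "inside_loop (Complex x y) = True" using xy unfolding big by argo
    moreover have "inside_eight (Complex x y) = (?s > 0 \<and> ?t > 0 \<or> ?s < 0 \<and> ?t < 0)" using xy unfolding lob by argo
    ultimately have c: "link_colour (Complex x y) = (True \<noteq> (?s > 0 \<and> ?t > 0 \<or> ?s < 0 \<and> ?t < 0), True)" by (rule link_colourI)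
    show "link_colour (Complex x y) = (False, True)" if "?s > 0" "?t > 0" unfolding c using that by auto
    show "link_colour (Complex x y) = (True, True)" if "?s > 0" "?t < 0" unfolding c using that by auto
    show "link_colour (Complex x y) = (True, True)" if "?s < 0" "?t > 0" unfolding c using that by auto
    show "link_colour (Complex x y) = (False, True)" if "?s < 0" "?t < 0" unfolding c using that by auto
  qed simp_all
qed

lemma upper_link_odd_colourable: "odd_colourable (link_curve True) (tick 1 (0, 0))"
proof -
  let ?C = "link_curve True" and ?M = "tick 1 (0, 0)"
  have dp: "double_points True = {Complex 0 0, Complex (-3) 3, Complex 3 3}"
    by (simp add: double_points_def crossing_level_def zero_complex.code)
  have lc: "locally_constant_off ?C link_colour"
  proof (rule locally_constant_offI)
    fix z assume "z \<notin> ?C"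
    then have "z \<notin> rising_arc" "z \<notin> falling_arc" "z \<notin> level_arc True" "z \<notin> closing_edge" by (simp_all add: link_curve_def)
    then obtain N N' where N: "open N" "z \<in> N" "\<forall>w\<in>N. inside_loop w = inside_loop z" "open N'" "z \<in> N'" "\<forall>w\<in>N'. inside_eight w = inside_eight z"
      using inside_loop_local[of z] inside_eight_local[of z] by blast
    show "\<exists>N. open N \<and> z \<in> N \<and> (\<forall>w\<in>N. w \<notin> ?C \<longrightarrow> link_colour w = link_colour z)"
    proof (intro exI[of _ "N \<inter> N'"] conjI ballI impI)
      fix w assume "w \<in> N \<inter> N'"
      then have "inside_loop w = inside_loop z" "inside_eight w = inside_eight z" using N(3,6) by blast+
      then show "link_colour w = link_colour z" by (simp only: link_colour_def)
    qed (use N in auto)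
  qed
  have "region_colouring ?C ?M link_colour"
    unfolding region_colouring_def
  proof (intro conjI ballI lc)
    show "fst ` colours_at ?C link_colour p = UNIV" if p: "p \<in> ?C" for p
    proof (cases "p \<in> double_points True")
      case True
      then consider "p = Complex 0 0" | "p = Complex (-3) 3" | "p = Complex 3 3" unfolding dp by blast
      then show ?thesis
        by cases (simp_all only: upper_link_crossings, rule_tac [!] fst_image_UNIV[of "(True, True)" _ "(False, True)"], simp_all)
    next
      case False
      then obtain c d where "fst c \<noteq> fst d" "colours_at ?C link_colour p = {c, d}" using upper_link_edges p by blast
      then show ?thesis by (intro fst_image_UNIV[of c _ d]) auto
    qed
    show "card (colours_at ?C link_colour p) \<noteq> 3" if p: "p \<in> ?C - ?M" for p
    proof (cases "p \<in> double_points True")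
      case True
      moreover have "p \<noteq> Complex 0 0" using p by (auto simp: tick_1)
      ultimately consider "p = Complex (-3) 3" | "p = Complex 3 3" unfolding dp by blast
      then show ?thesis by cases (simp_all add: upper_link_crossings card_insert_if)
    next
      case False
      then obtain c d where "colours_at ?C link_colour p = {c, d}" using upper_link_edges[of p] p by blast
      then show ?thesis by (simp add: two_colours)
    qed
    have "{z. z \<notin> ?C \<and> fst (link_colour z)} \<subseteq> cbox (Complex (-20) (-20)) (Complex 20 20)"
    proof
      fix z assume "z \<in> {z. z \<notin> ?C \<and> fst (link_colour z)}"
      then have "inside_loop z \<or> inside_eight z" by (auto simp: link_colour_def)
      then have "\<bar>Re z\<bar> \<le> 20 \<and> \<bar>Im z\<bar> \<le> 20" unfolding inside_loop_def inside_eight_def piecewise_defs if_True by argo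
      then show "z \<in> cbox (Complex (-20) (-20)) (Complex 20 20)" by (auto simp: in_cbox_complex_iff)
    qed
    then show "bounded {z. z \<notin> ?C \<and> fst (link_colour z)}" using bounded_cbox bounded_subset by blast
  qed
  moreover have "rainbow ?C ?M link_colour = {Complex 0 0}"
  proof -
    have "Complex 0 0 \<in> rainbow ?C ?M link_colour \<longleftrightarrow> colours_at ?C link_colour (Complex 0 0) = UNIV \<and> True"
    proof (rule rainbow_mem[where N = UNIV])
      show "Complex 0 0 \<in> closure (?M - ?C)"
      proof (rule mem_closure_ray_xy[of "1/2" 0 1 0 0])
        fix t :: real assume t: "0 < t" "t < 1/2"
        have "Complex (0 + t * 1) (0 + t * 0) \<notin> ?C" using t unfolding link_curve_Complex piecewise_defs if_True by argo
        then show "Complex (0 + t * 1) (0 + t * 0) \<in> ?M - ?C" using t by (simp add: tick_1)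
      qed simp
      fix z assume z: "z \<in> ?M - ?C"
      then have "Im z = 0" "\<bar>Re z\<bar> \<le> 1/2" using tick_1[of "Re z" "Im z" 0 0] by simp_all
      moreover have "Re z \<noteq> 0"
      proof
        assume "Re z = 0"
        then have "z \<in> rising_arc" using \<open>Im z = 0\<close> by (simp add: rising_arc_def piecewise_defs)
        then show False using z by (simp add: link_curve_def)
      qed
      ultimately have "inside_loop z \<noteq> inside_eight z" unfolding inside_loop_def inside_eight_def piecewise_defs if_True by argo
      then show "fst (link_colour z) = True" by (simp add: link_colour_def)
    qed (simp_all add: tick_1)
    moreover have "{(True, True), (False, False), (False, True), (True, False)} = (UNIV :: (bool \<times> bool) set)"
      by (auto simp: UNIV_bool)
    ultimately have 0: "Complex 0 0 \<in> rainbow ?C ?M link_colour" by (simp only: upper_link_crossings)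
    have lcW: "locally_constant_off (?C \<union> - disk_interior) link_colour"
      using lc unfolding locally_constant_off_def by (auto elim: eventually_mono)
    have "v = Complex 0 0" if v: "v \<in> rainbow ?C ?M link_colour" for v
    proof -
      have vM: "Im v = 0" "\<bar>Re v\<bar> \<le> 1/2" using v tick_1[of "Re v" "Im v" 0 0] by (auto simp: rainbow_def)
      then have "v \<in> disk_interior" by (simp add: disk_interior_def)
      then have "v \<in> ?C" using v off_not_rainbow[OF lcW, of v] by (auto simp: rainbow_def)
      then have "Re v = 0" using vM unfolding link_curve_def arc_defs Un_iff mem_Collect_eq piecewise_defs if_True by argo
      then show ?thesis using vM(1) by (simp add: complex_eq_iff)
    qed
    with 0 show ?thesis by blast
  qed
  ultimately show ?thesis unfolding odd_colourable_def by (intro exI[of _ link_colour]) simp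
qed

theorem corollary6p3:
  "(\<exists>D D'. marked_graph_diagram D \<and> marked_graph_diagram D' \<and> move \<Omega>4 D D' \<and>
      \<not> related_by {\<Omega>1, \<Omega>2, \<Omega>3, \<Omega>5, \<Omega>6, \<Omega>6', \<Omega>7, \<Omega>8} D D') \<and>
   (\<exists>D D'. marked_graph_diagram D \<and> marked_graph_diagram D' \<and> move \<Omega>4' D D' \<and>
      \<not> related_by {\<Omega>1, \<Omega>2, \<Omega>3, \<Omega>5, \<Omega>6, \<Omega>6', \<Omega>7, \<Omega>8} D D')"
proof -
  have inv: "\<not> odd_colourable_diagram (link_pic False m)" "odd_colourable_diagram (link_pic True m)" for m
    using lower_link_not_odd_colourable upper_link_odd_colourable by (simp_all add: link_pic_def)
  have "\<exists>D D'. marked_graph_diagram D \<and> marked_graph_diagram D' \<and> move k D D' \<and>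
      \<not> related_by {\<Omega>1, \<Omega>2, \<Omega>3, \<Omega>5, \<Omega>6, \<Omega>6', \<Omega>7, \<Omega>8} D D'"
    if "replaces k (link_pic False m) (link_pic True m')" for k m m'
    using that move_of_replaces[OF that] related_by_odd_colourable inv unfolding replaces_def by blast
  then show ?thesis using link_replaces by blast
qed

end
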